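(* Let $1<s<2$, $a>0$, $p>1$, $n\geq 1$, $b=3-2s$, and let $u_e$ be a solution of $$\begin{cases}\Delta_b^2u_e=0&\text{in }\mathbb{R}^{n+1}_+,\\ \lim_{y\to0}y^b\partial_yu_e=0&\text{on }\partial\mathbb{R}^{n+1}_+,\\ \lim_{y\to0}y^b\partial_y\Delta_bu_e=C_{n,s}|x|^a|u_e|^{p-1}u_e&\text{on }\partial\mathbb{R}^{n+1}_+=\mathbb{R}^n,\end{cases}$$ and let $E(u_e,\lambda)$, $\lambda>0$, be the energy $$\begin{aligned}E(u_e,r)={}&r^{\frac{2s(p+1)+2a}{p-1}-n}\left(\int_{\mathbb{R}^{n+1}_+\cap B_r}\frac12y^{3-2s}|\Delta_bu_e|^2\,dx\,dy-\frac{C_{n,s}}{p+1}\int_{\partial\mathbb{R}^{n+1}_+\cap B_r}|x|^a|u_e|^{p+1}\,dx\right)\\&-\frac{s+\frac a2}{p-1}\left(\frac{p+2s+a-1}{p-1}-n-b\right)r^{-3+2s+\frac{4s+2a}{p-1}-n}\int_{\mathbb{R}^{n+1}_+\cap\partial B_r}y^{3-2s}u_e^2\,d\sigma\\&-\frac{s+\frac a2}{p-1}\left(\frac{p+2s+a-1}{p-1}-n-b\right)\frac{d}{dr}\left[r^{\frac{4s+2a}{p-1}+2s-2-n}\int_{\mathbb{R}^{n+1}_+\cap\partial B_r}y^{3-2s}u_e^2\,d\sigma\right]\\&+\frac12r^3\frac{d}{dr}\left[r^{\frac{4s+2a}{p-1}+2s-3-n}\int_{\mathbb{R}^{n+1}_+\cap\partial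 B_r}y^{3-2s}\left(\frac{2s+a}{p-1}r^{-1}u_e+\frac{\partial u_e}{\partial r}\right)^2d\sigma\right]\\&+\frac12\frac{d}{dr}\left[r^{\frac{2s(p+1)+2a}{p-1}-n}\int_{\mathbb{R}^{n+1}_+\cap\partial B_r}y^{3-2s}\left(|\nabla u_e|^2-\left|\frac{\partial u_e}{\partial r}\right|^2\right)d\sigma\right]\\&+\frac12r^{\frac{2s(p+1)+2a}{p-1}-n-1}\int_{\mathbb{R}^{n+1}_+\cap\partial B_r}y^{3-2s}\left(|\nabla u_e|^2-\left|\frac{\partial u_e}{\partial r}\right|^2\right)d\sigma .\end{aligned}$$ Assume that $$n>\frac{p+4s+2a-1}{p+2s+a-1}+\frac{2s+a}{p-1}-b .$$ Then $E(u_e,\lambda)$ is a nondecreasing function of $\lambda>0$. Furthermore, there is a constant $C>0$ depending only on $n,s,p$ and $a$ (in particular independent of $\lambda$) such that $$\frac{dE(u_e,\lambda)}{d\lambda}\ge C\,\lambda^{\frac{4s+2a}{p-1}+2s-2-n}\int_{\mathbb{R}^{n+1}_+\cap\partial B_\lambda}y^{3-2s}\left(\frac{2s+a}{p-1}r^{-1}u_e+\frac{\partial u_e}{\partial r}\right)^2d\sigma .$$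
   Context: Points of $\mathbb{R}^{n+1}_+=\{X=(x,y):x\in\mathbb{R}^n,\ y>0\}$ are written $X=(x,y)$; $r=|X|$, $\partial/\partial r$ is the radial derivative $\nabla\cdot\frac{X}{r}$, $B_r$ is the open ball of radius $r$ in $\mathbb{R}^{n+1}$ centered at the origin, $d\sigma$ is surface measure. The operator $\Delta_b$ is $\Delta_bw=\Delta w+\frac by w_y=y^{-b}\,\mathrm{div}(y^b\nabla w)$. The constant $C_{n,s}>0$ is a fixed normalization constant depending only on $n$ and $s$. The system is the extension problem associated with $(-\Delta)^su=|x|^a|u|^{p-1}u$ in $\mathbb{R}^n$, with $u(x)=u_e(x,0)$. The solution $u_e$ is understood to be regular enough up to $\{y=0\}$ that the boundary limits, the integrals over half-balls and half-spheres, and the derivatives with respect to the radius appearing in $E$ and $dE/d\lambda$ exist and may be computed by the usual scaling, differentiation under the integral and integration by parts. *)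

theory Defs
  imports "HOL-Analysis.Analysis"
begin

(* Points X = (x, y) of R^{n+1} have type (real^'n) \<times> real, with n = CARD('n); the norm of the
   product type is the Euclidean one. *)

definition upper_half :: "((real^'n) \<times> real) set" where
  "upper_half = {X. 0 < snd X}"

definition closed_upper_half :: "((real^'n) \<times> real) set" where
  "closed_upper_half = {X. 0 \<le> snd X}"


definition partial :: "'a::euclidean_space \<Rightarrow> ('a \<Rightarrow> real) \<Rightarrow> 'a \<Rightarrow> real" where
  "partial e f X = frechet_derivative f (at X) e"

definition grad :: "('a::euclidean_space \<Rightarrow> real) \<Rightarrow> 'a \<Rightarrow> 'a" where
  "grad f X = (\<Sum>e\<in>Basis. partial e f X *\<^sub>R e)"

definition radial_deriv :: "('a::euclidean_space \<Rightarrow> real) \<Rightarrow> 'a \<Rightarrow> real" where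
  "radial_deriv f X = grad f X \<bullet> (X /\<^sub>R norm X)"

definition laplacian :: "('a::euclidean_space \<Rightarrow> real) \<Rightarrow> 'a \<Rightarrow> real" where
  "laplacian f X = (\<Sum>e\<in>Basis. partial e (partial e f) X)"

definition partial_y :: "((real^'n) \<times> real \<Rightarrow> real) \<Rightarrow> (real^'n) \<times> real \<Rightarrow> real" where
  "partial_y = partial (0, 1)"

definition Delta_b :: "real \<Rightarrow> ((real^'n) \<times> real \<Rightarrow> real) \<Rightarrow> (real^'n) \<times> real \<Rightarrow> real" where
  "Delta_b b w X = laplacian w X + b / snd X * partial_y w X"

text \<open>\<open>C_k k S f\<close>: f is k times continuously differentiable on the open set S.\<close>

primrec C_k :: "nat \<Rightarrow> 'a::euclidean_space set \<Rightarrow> ('a \<Rightarrow> real) \<Rightarrow> bool" where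
  "C_k 0 S f \<longleftrightarrow> continuous_on S f"
| "C_k (Suc k) S f \<longleftrightarrow> f differentiable_on S \<and> (\<forall>e\<in>Basis. C_k k S (partial e f))"


text \<open>Surface measure on the sphere of radius r > 0 centred at the origin of an N-dimensional
  space, N = \<open>DIM('a)\<close>: the measure of a Borel subset A of the sphere is N / r times the volume of the
  cone of all t X with 0 < t < 1 and X in A. As a measure on the whole space it is the correspondingly
  scaled image of Lebesgue measure on the ball under radial projection (the origin, which is not
  projected to the sphere, is a null set).\<close>

definition sphere_measure :: "real \<Rightarrow> 'a::euclidean_space measure" where
  "sphere_measure r =
     scale_measure (ennreal (real DIM('a) / r))
       (distr (restrict_space lborel (ball 0 r)) borel (\<lambda>X. (r / norm X) *\<^sub>R X))"

definition half_sphere_integral :: "((real^'n) \<times> real \<Rightarrow> real) \<Rightarrow> real \<Rightarrow> real" where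
  "half_sphere_integral f r = (LINT X:upper_half|sphere_measure r. f X)"

definition half_ball_integral :: "((real^'n) \<times> real \<Rightarrow> real) \<Rightarrow> real \<Rightarrow> real" where
  "half_ball_integral f r = (LINT X:(upper_half \<inter> ball 0 r)|lborel. f X)"


text \<open>The boundary value problem, in the classical pointwise sense; the trace of u on the boundary is
  \<open>u (x, 0)\<close>.\<close>

definition extension_solution ::
    "real \<Rightarrow> real \<Rightarrow> real \<Rightarrow> real \<Rightarrow> ((real^'n) \<times> real \<Rightarrow> real) \<Rightarrow> bool" where
  "extension_solution s a p Cns u \<longleftrightarrow>
     (let b = 3 - 2 * s in
       (\<forall>X\<in>upper_half. Delta_b b (Delta_b b u) X = 0) \<and>
       (\<forall>x. ((\<lambda>y. y powr b * partial_y u (x, y)) \<longlongrightarrow> 0) (at_right 0)) \<and>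
       (\<forall>x. ((\<lambda>y. y powr b * partial_y (Delta_b b u) (x, y))
               \<longlongrightarrow> Cns * norm x powr a * \<bar>u (x, 0)\<bar> powr (p - 1) * u (x, 0)) (at_right 0)))"

definition extends_continuously ::
    "((real^'n) \<times> real) set \<Rightarrow> ((real^'n) \<times> real \<Rightarrow> real) \<Rightarrow> bool" where
  "extends_continuously S f \<longleftrightarrow> (\<exists>g. continuous_on S g \<and> (\<forall>X\<in>upper_half. g X = f X))"

text \<open>Regularity up to the boundary. The functions entering the boundary conditions and the
  half-ball integrals are continuous up to y = 0. Radial derivatives, needed for differentiating the
  half-sphere integrals with respect to the radius, are continuous up to y = 0 only away from the
  origin, where the weight of the nonlinearity limits the smoothness of solutions. The gradient
  of \<open>Delta_b b u\<close> is not required to be continuous at y = 0, because \<open>Delta_b b u\<close> in general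
  contains a term of the order of the fractional power y^(1 - b).\<close>

definition regular_up_to_boundary :: "real \<Rightarrow> ((real^'n) \<times> real \<Rightarrow> real) \<Rightarrow> bool" where
  "regular_up_to_boundary b u \<longleftrightarrow>
     C_k 4 upper_half u \<and>
     continuous_on closed_upper_half u \<and>
     (\<forall>e\<in>Basis. extends_continuously closed_upper_half (partial e u)) \<and>
     extends_continuously closed_upper_half (Delta_b b u) \<and>
     extends_continuously closed_upper_half (\<lambda>X. snd X powr b * partial_y u X) \<and>
     extends_continuously closed_upper_half (\<lambda>X. snd X powr b * partial_y (Delta_b b u) X) \<and>
     (\<forall>e\<in>Basis. extends_continuously (closed_upper_half - {0}) (radial_deriv (partial e u))) \<and>
     (\<forall>e\<in>Basis. extends_continuously (closed_upper_half - {0})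
                  (radial_deriv (radial_deriv (partial e u)))) \<and>
     extends_continuously (closed_upper_half - {0}) (radial_deriv (Delta_b b u))"


definition energy ::
    "real \<Rightarrow> real \<Rightarrow> real \<Rightarrow> real \<Rightarrow> ((real^'n) \<times> real \<Rightarrow> real) \<Rightarrow> real \<Rightarrow> real" where
  "energy s a p Cns u r =
     (let n = real CARD('n);
          b = 3 - 2 * s;
          \<kappa> = (s + a / 2) / (p - 1) * ((p + 2 * s + a - 1) / (p - 1) - n - b);
          mass = half_sphere_integral (\<lambda>X. snd X powr (3 - 2 * s) * (u X)\<^sup>2);
          scaling = half_sphere_integral
            (\<lambda>X. snd X powr (3 - 2 * s)
                  * ((2 * s + a) / (p - 1) * inverse (norm X) * u X + radial_deriv u X)\<^sup>2);
          tangential = half_sphere_integral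
            (\<lambda>X. snd X powr (3 - 2 * s) * ((norm (grad u X))\<^sup>2 - \<bar>radial_deriv u X\<bar>\<^sup>2))
      in
        r powr ((2 * s * (p + 1) + 2 * a) / (p - 1) - n)
          * (half_ball_integral (\<lambda>X. 1 / 2 * snd X powr (3 - 2 * s) * \<bar>Delta_b b u X\<bar>\<^sup>2) r
             - Cns / (p + 1)
               * (LINT x:ball (0 :: real^'n) r|lborel. norm x powr a * \<bar>u (x, 0)\<bar> powr (p + 1)))
        - \<kappa> * r powr (- 3 + 2 * s + (4 * s + 2 * a) / (p - 1) - n) * mass r
        - \<kappa> * deriv (\<lambda>t. t powr ((4 * s + 2 * a) / (p - 1) + 2 * s - 2 - n) * mass t) r
        + 1 / 2 * r ^ 3
          * deriv (\<lambda>t. t powr ((4 * s + 2 * a) / (p - 1) + 2 * s - 3 - n) * scaling t) r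
        + 1 / 2
          * deriv (\<lambda>t. t powr ((2 * s * (p + 1) + 2 * a) / (p - 1) - n) * tangential t) r
        + 1 / 2 * r powr ((2 * s * (p + 1) + 2 * a) / (p - 1) - n - 1) * tangential r)"

end

theory Submission
  imports Defs
begin

text \<open>Put \<open>\<alpha> = (2 s + a) / (p - 1)\<close> and \<open>u\<^sup>t(X) = t\<^sup>\<alpha> u(t X)\<close>. By scaling, \<open>E(u, t)\<close> is an energy of
  \<open>u\<^sup>t\<close> on the unit half-ball plus boundary terms on the unit half-sphere. The bulk part is
  differentiated without any regularity of \<open>\<partial>\<^sub>t u\<^sup>t\<close> up to the boundary: Green's identity for the pair
  \<open>\<Delta>\<^sub>b u\<^sup>l\<close>, \<open>u\<^sup>k\<close> with independent \<open>l\<close>, \<open>k\<close> expresses the symmetric pairing \<open>\<integral> y\<^sup>b \<Delta>\<^sub>b u\<^sup>l \<Delta>\<^sub>b u\<^sup>k\<close> by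
  boundary integrals, so its diagonal derivative is twice the derivative in \<open>k\<close>. The
  flux through small half-spheres around the origin vanishes because \<open>n + b > 1\<close>. Eliminating
  \<open>\<Delta>\<^sub>b u\<^sup>t\<close> on the half-sphere in favour of its spherical part and integrating by parts there turns
  \<open>dE/dt\<close> into a sum of squares, in which the coefficient of \<open>(\<partial>\<^sub>t u\<^sup>t)\<^sup>2\<close> is positive exactly under
  the assumption on \<open>n\<close>.\<close>

section \<open>Partial derivatives on the half-space\<close>

text \<open>Differentiating the square of \<open>Delta_b b u\<close> after rescaling under the
  integral would bring in its radial derivative, for which the regularity assumption gives no bound
  near the origin. In Green's identity the derivative in k falls on \<open>u\<close> alone, and only
  on integrals over the unit half-sphere and on the trace of \<open>u\<close>. The nonlinearity
  drops out: half of the derivative of the bulk term contains C times the integral of |x|^a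
  |v|^(p-1) v v', where v is the rescaled trace and v' its t-derivative, and the derivative of the
  potential term is the same number. The constant comes from the radial part of the operator. Put m
  = n + b. In the variable t this part reads t^2 U'' + cA t U' + cB U with cA = m - 2 \<alpha> and
  cB = \<alpha> (\<alpha> + 1 - m). What remains of dE/dt is the integral of 2 t (t U'' + U')^2 + 2
  (cA - cB - 1) t U'^2 plus 2 t times the squared tangential gradient of U'. Here cA - cB - 1 = (1 +
  \<alpha>) m - (1 + 3 \<alpha> + \<alpha>^2), and its positivity is the assumption on n multiplied
  by 1 + \<alpha>.\<close>

lemma partial_eq:
  assumes "(f has_derivative D) (at X)"
  shows "partial e f X = D e"
  using frechet_derivative_at[OF assms] by (simp add: partial_def)

lemma grad_inner:
  assumes "f differentiable (at X)"
  shows "grad f X \<bullet> v = frechet_derivative f (at X) v"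
proof -
  have lin: "linear (frechet_derivative f (at X))"
    using assms by (rule linear_frechet_derivative)
  have "frechet_derivative f (at X) v = frechet_derivative f (at X) (\<Sum>e\<in>Basis. (v \<bullet> e) *\<^sub>R e)"
    by (simp add: euclidean_representation)
  also have "\<dots> = (\<Sum>e\<in>Basis. (v \<bullet> e) * frechet_derivative f (at X) e)"
    using lin by (simp add: linear_sum linear_cmul)
  also have "\<dots> = grad f X \<bullet> v"
    by (simp add: grad_def partial_def inner_sum_left inner_commute[of v] mult.commute)
  finally show ?thesis ..
qed

lemma has_derivative_grad:
  assumes "f differentiable (at X)"
  shows "(f has_derivative (\<lambda>v. grad f X \<bullet> v)) (at X)"
  using assms by (simp add: grad_inner[OF assms] frechet_derivative_works)

lemma grad_Basis: "e \<in> Basis \<Longrightarrow> grad f X \<bullet> e = partial e f X"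
  by (simp add: grad_def inner_sum_left inner_Basis if_distrib sum.delta cong: if_cong)

lemma radial_deriv_eq_sum:
  "radial_deriv f X = (\<Sum>e\<in>Basis. (X \<bullet> e) / norm X * partial e f X)"
  by (simp add: radial_deriv_def grad_def inner_sum_left inner_commute[of X] sum_distrib_left
      divide_inverse mult_ac)

lemma has_real_derivative_along:
  assumes "f differentiable (at (X + t *\<^sub>R e))"
  shows "((\<lambda>t. f (X + t *\<^sub>R e)) has_real_derivative grad f (X + t *\<^sub>R e) \<bullet> e) (at t)"
proof -
  have "((\<lambda>t. f (X + t *\<^sub>R e)) has_derivative (\<lambda>h. grad f (X + t *\<^sub>R e) \<bullet> (h *\<^sub>R e))) (at t)"
    by (rule has_derivative_compose[of "\<lambda>t. X + t *\<^sub>R e" _ _ _ f,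
          OF _ has_derivative_grad[OF assms]])
      (auto intro!: derivative_eq_intros)
  then show ?thesis
    by (simp add: has_field_derivative_def mult.commute[of _ "grad _ _ \<bullet> _"])
qed

lemma has_real_derivative_ray:
  assumes "f differentiable (at (t *\<^sub>R \<theta>))" "norm \<theta> = 1" "0 < t"
  shows "((\<lambda>t. f (t *\<^sub>R \<theta>)) has_real_derivative radial_deriv f (t *\<^sub>R \<theta>)) (at t)"
  using has_real_derivative_along[of f 0 t \<theta>] assms
  by (simp add: radial_deriv_def)

section \<open>Stability of the class \<open>C_k\<close> on open sets\<close>

lemma differentiable_on_cong:
  assumes "f differentiable_on S" "\<And>x. x \<in> S \<Longrightarrow> f x = g x"
  shows "g differentiable_on S"
  unfolding differentiable_on_def
proof
  fix x assume "x \<in> S"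
  then obtain D where "(f has_derivative D) (at x within S)"
    using assms(1) by (auto simp: differentiable_on_def differentiable_def)
  then have "(g has_derivative D) (at x within S)"
    by (rule has_derivative_transform[rotated 2]) (use \<open>x \<in> S\<close> assms(2) in auto)
  then show "g differentiable at x within S"
    by (auto simp: differentiable_def)
qed

lemma partial_cong:
  assumes "open S" "X \<in> S" "\<And>x. x \<in> S \<Longrightarrow> f x = g x"
  shows "partial e f X = partial e g X"
proof -
  have "\<And>D. (f has_derivative D) (at X) \<longleftrightarrow> (g has_derivative D) (at X)"
    using assms has_derivative_transform_within_open[of f _ X UNIV S g]
      has_derivative_transform_within_open[of g _ X UNIV S f] by auto
  then show ?thesis
    by (simp add: partial_def frechet_derivative_def)
qed

text \<open>\<open>partial\<close> is local, so at each stage of the recursion only values on the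
  open set matter. The sum, product and dilation formulas for \<open>partial\<close> hold on
  \<open>S\<close> only; this lemma transfers each of them to the actual partial derivative.\<close>

lemma C_k_cong:
  assumes "open S" "\<And>x. x \<in> S \<Longrightarrow> f x = g x" "C_k k S f"
  shows "C_k k S g"
  using assms(2,3)
proof (induction k arbitrary: f g)
  case 0
  then show ?case using continuous_on_cong by (metis C_k.simps(1))
next
  case (Suc k)
  have "C_k k S (partial e g)" if "e \<in> Basis" for e
    using Suc.IH[of "partial e f" "partial e g"] Suc.prems that partial_cong[OF assms(1)]
    by (metis C_k.simps(2))
  then show ?case using Suc.prems differentiable_on_cong[of f S g] by auto
qed

lemma C_k_Suc_imp: "C_k (Suc k) S f \<Longrightarrow> C_k k S f"
proof (induction k arbitrary: f)
  case 0
  then show ?case by (auto intro: differentiable_imp_continuous_on)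
next
  case (Suc k)
  then show ?case by (metis C_k.simps(2))
qed

lemma C_k_mono:
  assumes "C_k k S f" "j \<le> k"
  shows "C_k j S f"
  using assms(2,1) by (induction rule: dec_induct) (auto dest: C_k_Suc_imp simp del: C_k.simps)

lemma C_k_Suc_differentiable: "C_k (Suc k) S f \<Longrightarrow> open S \<Longrightarrow> X \<in> S \<Longrightarrow> f differentiable (at X)"
  by (metis C_k.simps(2) differentiable_on_eq_differentiable_at)

lemma C_k_partial: "C_k (Suc k) S f \<Longrightarrow> e \<in> Basis \<Longrightarrow> C_k k S (partial e f)"
  by simp

lemma C_k_continuous_on: "C_k k S f \<Longrightarrow> continuous_on S f"
  using C_k_mono[of k S f 0] by simp

lemma partial_add:
  assumes "f differentiable (at X)" "g differentiable (at X)"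
  shows "partial e (\<lambda>x. f x + g x) X = partial e f X + partial e g X"
  using partial_eq[OF has_derivative_add[OF assms[THEN has_derivative_grad]], of e]
    partial_eq[OF assms(1)[THEN has_derivative_grad], of e]
    partial_eq[OF assms(2)[THEN has_derivative_grad], of e] by simp

lemma partial_mult:
  assumes "f differentiable (at X)" "g differentiable (at X)"
  shows "partial e (\<lambda>x. f x * g x) X = f X * partial e g X + partial e f X * g X"
  using partial_eq[OF has_derivative_mult[OF assms[THEN has_derivative_grad]], of e]
    partial_eq[OF assms(1)[THEN has_derivative_grad], of e]
    partial_eq[OF assms(2)[THEN has_derivative_grad], of e] by simp

lemma partial_const [simp]: "partial e (\<lambda>x. c) X = 0"
  by (simp add: partial_eq[OF has_derivative_const])

lemma C_k_const: "C_k k S (\<lambda>x. c)"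
proof (induction k arbitrary: c)
  case (Suc k)
  have "partial e (\<lambda>x. c) = (\<lambda>x. 0)" for e :: 'a by (simp add: fun_eq_iff)
  then show ?case using Suc by simp
qed simp

lemma C_k_add:
  assumes "open S" "C_k k S f" "C_k k S g"
  shows "C_k k S (\<lambda>x. f x + g x)"
  using assms(2,3)
proof (induction k arbitrary: f g)
  case 0
  then show ?case by (auto intro: continuous_intros)
next
  case (Suc k)
  have "C_k k S (partial e (\<lambda>x. f x + g x))" if "e \<in> Basis" for e
  proof (rule C_k_cong[OF assms(1)])
    show "C_k k S (\<lambda>x. partial e f x + partial e g x)"
      using Suc that by auto
    show "partial e f x + partial e g x = partial e (\<lambda>x. f x + g x) x" if "x \<in> S" for x
      using C_k_Suc_differentiable[OF _ assms(1) that] Suc.prems partial_add by metis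
  qed
  then show ?case using Suc.prems by (auto intro: differentiable_on_add)
qed

lemma C_k_mult:
  assumes "open S" "C_k k S f" "C_k k S g"
  shows "C_k k S (\<lambda>x. f x * g x)"
  using assms(2,3)
proof (induction k arbitrary: f g)
  case 0
  then show ?case by (auto intro: continuous_intros)
next
  case (Suc k)
  have "C_k k S (partial e (\<lambda>x. f x * g x))" if "e \<in> Basis" for e
  proof (rule C_k_cong[OF assms(1)])
    show "C_k k S (\<lambda>x. f x * partial e g x + partial e f x * g x)"
      using Suc.IH[of f "partial e g"] Suc.IH[of "partial e f" g] C_k_Suc_imp[of k] Suc.prems that
      by (auto intro!: C_k_add[OF assms(1)] simp del: C_k.simps intro: C_k_partial)
    show "f x * partial e g x + partial e f x * g x = partial e (\<lambda>x. f x * g x) x" if "x \<in> S" for x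
      using C_k_Suc_differentiable[OF _ assms(1) that] Suc.prems partial_mult by metis
  qed
  then show ?case using Suc.prems by (auto intro: differentiable_on_mult)
qed

lemma C_k_sum:
  assumes "open S" "finite I" "\<And>i. i \<in> I \<Longrightarrow> C_k k S (f i)"
  shows "C_k k S (\<lambda>x. \<Sum>i\<in>I. f i x)"
  using assms(2,3)
  by (induction rule: finite_induct) (auto intro: C_k_const C_k_add[OF assms(1)] simp del: C_k.simps)

lemma partial_dilate:
  assumes "f differentiable (at (c *\<^sub>R X))"
  shows "partial e (\<lambda>x. f (c *\<^sub>R x)) X = c * partial e f (c *\<^sub>R X)"
proof -
  have "((\<lambda>x. f (c *\<^sub>R x)) has_derivative (\<lambda>h. grad f (c *\<^sub>R X) \<bullet> (c *\<^sub>R h))) (at X)"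
    by (rule has_derivative_compose[of "\<lambda>x. c *\<^sub>R x" _ _ _ f,
          OF _ has_derivative_grad[OF assms]])
      (auto intro!: derivative_eq_intros)
  from partial_eq[OF this, of e] show ?thesis
    by (simp add: grad_inner[OF assms] partial_def)
qed

lemma C_k_dilate:
  assumes "open S" "\<And>X. X \<in> S \<Longrightarrow> c *\<^sub>R X \<in> S" "C_k k S f"
  shows "C_k k S (\<lambda>X. f (c *\<^sub>R X))"
  using assms(3)
proof (induction k arbitrary: f)
  case 0
  then show ?case
    using assms(2) by (auto intro!: continuous_on_compose2[of S f] continuous_intros)
next
  case (Suc k)
  have df: "f differentiable (at (c *\<^sub>R X))" if "X \<in> S" for X
    using C_k_Suc_differentiable[OF Suc.prems assms(1)] assms(2) that by blast
  have "C_k k S (partial e (\<lambda>X. f (c *\<^sub>R X)))" if "e \<in> Basis" for e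
  proof (rule C_k_cong[OF assms(1)])
    show "C_k k S (\<lambda>X. c * partial e f (c *\<^sub>R X))"
      using Suc that by (intro C_k_mult[OF assms(1)] C_k_const) auto
    show "c * partial e f (c *\<^sub>R X) = partial e (\<lambda>X. f (c *\<^sub>R X)) X" if "X \<in> S" for X
      using partial_dilate[OF df[OF that]] by simp
  qed
  moreover have "(\<lambda>X. f (c *\<^sub>R X)) differentiable_on S"
    using df differentiable_compose[of f "\<lambda>X. c *\<^sub>R X"]
    by (auto simp: differentiable_on_def differentiable_at_withinI
        intro!: differentiable_at_withinI bounded_linear_imp_differentiable bounded_linear_scaleR_right)
  ultimately show ?case by simp
qed

section \<open>The half-space under dilations, and \<open>Delta_b\<close> on it\<close>

lemma open_upper_half: "open (upper_half :: ((real^'n) \<times> real) set)"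
proof -
  have "upper_half = (snd :: (real^'n) \<times> real \<Rightarrow> real) -` {0<..}"
    by (auto simp: upper_half_def)
  then show ?thesis
    by (metis open_greaterThan open_vimage_snd vimage_snd)
qed

lemma closed_closed_upper_half: "closed (closed_upper_half :: ((real^'n) \<times> real) set)"
proof -
  have "closed_upper_half = (snd :: (real^'n) \<times> real \<Rightarrow> real) -` {0..}"
    by (auto simp: closed_upper_half_def)
  then show ?thesis
    by (metis closed_atLeast closed_vimage_snd vimage_snd)
qed

lemma upper_half_scaleR: "c > 0 \<Longrightarrow> c *\<^sub>R X \<in> upper_half \<longleftrightarrow> X \<in> upper_half"
  by (auto simp: upper_half_def zero_less_mult_iff)

lemma closed_upper_half_scaleR: "c > 0 \<Longrightarrow> c *\<^sub>R X \<in> closed_upper_half \<longleftrightarrow> X \<in> closed_upper_half"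
  by (auto simp: closed_upper_half_def zero_le_mult_iff)

lemma upper_half_subset_closed: "upper_half \<subseteq> closed_upper_half"
  by (auto simp: upper_half_def closed_upper_half_def)

lemma upper_half_not_0: "X \<in> upper_half \<Longrightarrow> X \<noteq> 0"
  by (auto simp: upper_half_def)

lemma has_derivative_inverse_snd:
  assumes "X \<in> upper_half"
  shows "((\<lambda>X. inverse (snd X)) has_derivative
    (\<lambda>v. - (inverse (snd X) * snd v * inverse (snd X)))) (at X)"
  using assms by (auto simp: upper_half_def intro!: derivative_eq_intros)

lemma C_k_inverse_snd: "C_k k (upper_half :: ((real^'n) \<times> real) set) (\<lambda>X. inverse (snd X))"
proof (induction k)
  case 0
  show ?case by (auto intro!: continuous_intros simp: upper_half_def)
next
  case (Suc k)
  have "C_k k upper_half (partial e (\<lambda>X :: (real^'n) \<times> real. inverse (snd X)))" for e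
  proof (rule C_k_cong[OF open_upper_half])
    show "C_k k upper_half (\<lambda>X :: (real^'n) \<times> real. - snd e * (inverse (snd X) * inverse (snd X)))"
      by (intro C_k_mult[OF open_upper_half] C_k_const Suc)
    show "- snd e * (inverse (snd X) * inverse (snd X)) = partial e (\<lambda>X. inverse (snd X)) X"
      if "X \<in> upper_half" for X :: "(real^'n) \<times> real"
      using partial_eq[OF has_derivative_inverse_snd[OF that], of e] by simp
  qed
  moreover have "(\<lambda>X :: (real^'n) \<times> real. inverse (snd X)) differentiable_on upper_half"
    using has_derivative_inverse_snd
    by (auto simp: differentiable_on_def differentiable_def intro: has_derivative_at_withinI)
  ultimately show ?case by simp
qed

lemma Basis_snd: "(0, 1) \<in> (Basis :: ((real^'n) \<times> real) set)"
  by (simp add: Basis_prod_def)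

text \<open>Two derivatives are lost, so four derivatives of \<open>u\<close> leave two for
  \<open>Delta_b b u\<close>. Both functions can then serve in Green's identity with classical
  derivatives.\<close>

lemma C_k_Delta_b:
  assumes "C_k (Suc (Suc k)) upper_half u"
  shows "C_k k upper_half (Delta_b b u)"
proof -
  have "C_k k upper_half (\<lambda>X. (\<Sum>e\<in>Basis. partial e (partial e u) X)
      + (b * inverse (snd X)) * partial (0, 1) u X)"
    using assms Basis_snd C_k_partial[OF assms Basis_snd]
    by (intro C_k_add C_k_sum C_k_mult C_k_const C_k_inverse_snd open_upper_half)
      (auto intro: C_k_Suc_imp simp del: C_k.simps(1))
  then show ?thesis
    by (rule C_k_cong[OF open_upper_half, rotated])
      (simp add: Delta_b_def laplacian_def partial_y_def divide_inverse)
qed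

text \<open>The coefficient b / y is homogeneous of degree -1, so the first-order term scales like
  the second derivatives.\<close>

lemma Delta_b_dilate:
  assumes "C_k 2 upper_half u" "X \<in> upper_half" "c > 0"
  shows "Delta_b b (\<lambda>X. u (c *\<^sub>R X)) X = c\<^sup>2 * Delta_b b u (c *\<^sub>R X)"
proof -
  have c: "C_k (Suc (Suc 0)) upper_half u" using assms(1) by (simp add: numeral_2_eq_2)
  have du: "u differentiable (at (c *\<^sub>R Y))" "\<And>e. e \<in> Basis \<Longrightarrow> partial e u differentiable (at (c *\<^sub>R Y))"
    if "Y \<in> upper_half" for Y
    using C_k_Suc_differentiable[OF c open_upper_half] C_k_Suc_differentiable[OF _ open_upper_half] C_k_partial[OF c]
      upper_half_scaleR[OF assms(3)] that by blast+
  have 1: "partial e (\<lambda>X. u (c *\<^sub>R X)) Y = c * partial e u (c *\<^sub>R Y)" if "Y \<in> upper_half" for Y e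
    using partial_dilate[OF du(1)[OF that]] .
  have 2: "partial e (partial e (\<lambda>X. u (c *\<^sub>R X))) X = c\<^sup>2 * partial e (partial e u) (c *\<^sub>R X)"
    if "e \<in> Basis" for e
  proof -
    have d: "(\<lambda>X. partial e u (c *\<^sub>R X)) differentiable (at X)"
      using differentiable_chain_at[of "\<lambda>X. c *\<^sub>R X" X "partial e u"] du(2)[OF assms(2) that]
      by (simp add: o_def)
    have "partial e (partial e (\<lambda>X. u (c *\<^sub>R X))) X = partial e (\<lambda>Y. c * partial e u (c *\<^sub>R Y)) X"
      by (rule partial_cong[OF open_upper_half assms(2) 1])
    also have "\<dots> = c * partial e (\<lambda>Y. partial e u (c *\<^sub>R Y)) X"
      using partial_mult[of "\<lambda>_. c", OF _ d] by simp
    also have "\<dots> = c\<^sup>2 * partial e (partial e u) (c *\<^sub>R X)"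
      using partial_dilate[OF du(2)[OF assms(2) that]] by (simp add: power2_eq_square)
    finally show ?thesis .
  qed
  show ?thesis
    using assms(2,3)
    by (simp add: Delta_b_def laplacian_def 2 partial_y_def 1 sum_distrib_left upper_half_def
        field_simps power2_eq_square)
qed

text \<open>The divergence of the field \<open>y\<^sup>b g \<nabla>h\<close> is \<open>y\<^sup>b (\<nabla>g \<bullet> \<nabla>h + g \<Delta>\<^sub>b h)\<close>.\<close>

definition flux_diag :: "real \<Rightarrow> ((real^'n) \<times> real \<Rightarrow> real) \<Rightarrow> ((real^'n) \<times> real \<Rightarrow> real)
    \<Rightarrow> (real^'n) \<times> real \<Rightarrow> (real^'n) \<times> real \<Rightarrow> real" where
  "flux_diag b g h e X = b * snd X powr (b - 1) * snd e * (g X * partial e h X)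
     + snd X powr b * (partial e g X * partial e h X + g X * partial e (partial e h) X)"

text \<open>A divergence needs only the derivative of each component in its own direction, so the
  field is never differentiated as a vector-valued map.\<close>

lemma has_real_derivative_flux:
  assumes "C_k 1 upper_half g" "C_k 2 upper_half h" "X \<in> upper_half" "e \<in> Basis"
  shows "((\<lambda>t. snd (X + t *\<^sub>R e) powr b * (g (X + t *\<^sub>R e) * partial e h (X + t *\<^sub>R e)))
    has_real_derivative flux_diag b g h e X) (at 0)"
proof -
  have c: "C_k (Suc (Suc 0)) upper_half h" "C_k (Suc 0) upper_half g"
    using assms(1,2) by (simp_all add: numeral_2_eq_2)
  have 1: "((\<lambda>t. partial e h (X + t *\<^sub>R e)) has_real_derivative partial e (partial e h) X) (at 0)"
    using has_real_derivative_along[of "partial e h" X 0 e]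
      C_k_Suc_differentiable[OF C_k_partial[OF c(1) assms(4)] open_upper_half assms(3)]
    by (simp add: grad_Basis[OF assms(4)])
  have 2: "((\<lambda>t. g (X + t *\<^sub>R e)) has_real_derivative partial e g X) (at 0)"
    using has_real_derivative_along[of g X 0 e]
      C_k_Suc_differentiable[OF c(2) open_upper_half assms(3)]
    by (simp add: grad_Basis[OF assms(4)])
  have 3: "((\<lambda>t. snd (X + t *\<^sub>R e) powr b) has_real_derivative
      b * snd X powr (b - 1) * snd e) (at 0)"
    using assms(3) by (auto intro!: derivative_eq_intros simp: upper_half_def powr_diff)
  show ?thesis
    using DERIV_mult[OF 3 DERIV_mult[OF 2 1]] by (simp add: flux_diag_def algebra_simps)
qed

lemma continuous_on_flux_diag:
  assumes "C_k 1 upper_half g" "C_k 2 upper_half h" "e \<in> Basis"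
  shows "continuous_on upper_half (flux_diag b g h e)"
proof -
  have c: "C_k (Suc (Suc 0)) upper_half h" "C_k (Suc 0) upper_half g"
    using assms(1,2) by (simp_all add: numeral_2_eq_2)
  note [continuous_intros] = C_k_continuous_on[OF c(2)] C_k_continuous_on[OF C_k_partial[OF c(2) assms(3)]]
    C_k_continuous_on[OF C_k_partial[OF c(1) assms(3)]]
    C_k_continuous_on[OF C_k_partial[OF C_k_partial[OF c(1) assms(3)] assms(3)]]
  show ?thesis
    unfolding flux_diag_def[abs_def]
    by (intro continuous_intros) (auto simp: upper_half_def)
qed

text \<open>The weight varies in y only. Its derivative contributes b y^(b-1) g times the
  y-derivative of h, which is y^b g times the first-order term of
  \<open>Delta_b b h\<close>.\<close>

lemma sum_flux_diag:
  fixes X :: "(real^'n) \<times> real"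
  assumes "X \<in> upper_half"
  shows "(\<Sum>e\<in>Basis. flux_diag b g h e X) = snd X powr b * (grad g X \<bullet> grad h X + g X * Delta_b b h X)"
proof -
  have y: "snd X > 0" using assms by (simp add: upper_half_def)
  have "(\<Sum>e\<in>Basis. flux_diag b g h e X) = b * snd X powr (b - 1) * g X * (\<Sum>e\<in>Basis. snd e * partial e h X)
      + snd X powr b * ((\<Sum>e\<in>Basis. partial e g X * partial e h X) + g X * laplacian h X)"
  proof -
    have "flux_diag b g h e X = (b * snd X powr (b - 1) * g X) * (snd e * partial e h X)
      + snd X powr b * (partial e g X * partial e h X) + (snd X powr b * g X) * partial e (partial e h) X"
      for e by (simp add: flux_diag_def algebra_simps)
    then show ?thesis
      by (simp add: sum.distrib sum_distrib_left[symmetric] laplacian_def distrib_left)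
  qed
  also have "(\<Sum>e\<in>Basis. partial e g X * partial e h X) = grad g X \<bullet> grad h X"
    by (subst euclidean_inner) (simp add: grad_Basis)
  also have "(\<Sum>e\<in>Basis. snd e * partial e h X) = partial_y h X"
  proof -
    have "(\<Sum>e\<in>Basis. snd e * partial e h X) = (\<Sum>e\<in>Basis. (grad h X \<bullet> e) * ((0, 1) \<bullet> e))"
    proof (rule sum.cong)
      fix e :: "(real^'n) \<times> real" assume "e \<in> Basis"
      moreover have "snd e = (0, 1) \<bullet> e" by (simp add: inner_prod_def)
      ultimately show "snd e * partial e h X = (grad h X \<bullet> e) * ((0, 1) \<bullet> e)"
        by (metis grad_Basis mult.commute)
    qed simp
    also have "\<dots> = grad h X \<bullet> (0, 1)"
      by (rule euclidean_inner[symmetric])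
    finally show ?thesis by (simp add: grad_Basis[OF Basis_snd] partial_y_def)
  qed
  finally show ?thesis
    using y by (simp add: Delta_b_def powr_diff field_simps)
qed

section \<open>Polar coordinates with the weight \<open>y\<^sup>b\<close>\<close>

lemma sets_sphere_measure [measurable_cong, simp]: "sets (sphere_measure r) = sets borel"
  by (simp add: sphere_measure_def)

lemma space_sphere_measure [simp]: "space (sphere_measure r) = UNIV"
  by (simp add: sphere_measure_def space_scale_measure)

lemma pred_ball [measurable]: "Measurable.pred borel (\<lambda>x :: 'a::euclidean_space. x \<in> ball c r)"
  by (simp add: pred_def)

lemma nn_integral_sphere_measure:
  fixes f :: "'a::euclidean_space \<Rightarrow> ennreal"
  assumes [measurable]: "f \<in> borel_measurable borel"
  shows "(\<integral>\<^sup>+\<theta>. f \<theta> \<partial>sphere_measure r) = ennreal (real DIM('a) / r)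
    * (\<integral>\<^sup>+X. f ((r / norm X) *\<^sub>R X) * indicator (ball 0 r) X \<partial>lborel)"
proof -
  have [measurable]: "(\<lambda>X. (r / norm X) *\<^sub>R X) \<in> restrict_space lborel (ball (0::'a) r) \<rightarrow>\<^sub>M borel"
    by (rule measurable_restrict_space1) simp
  show ?thesis
    by (simp add: sphere_measure_def nn_integral_scale_measure nn_integral_distr nn_integral_restrict_space)
qed

lemma nn_integral_lborel_scaleR:
  fixes f :: "'a::euclidean_space \<Rightarrow> ennreal"
  assumes [measurable]: "f \<in> borel_measurable borel" and c: "0 < c"
  shows "(\<integral>\<^sup>+X. f X \<partial>lborel) = ennreal (c ^ DIM('a)) * (\<integral>\<^sup>+X. f (c *\<^sub>R X) \<partial>lborel)"
  using c by (subst lborel_affine[of c 0])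
    (simp_all add: nn_integral_density nn_integral_distr nn_integral_cmult)

lemma integral_lborel_scaleR:
  fixes f :: "'a::euclidean_space \<Rightarrow> real"
  assumes [measurable]: "f \<in> borel_measurable borel" and c: "0 < c"
  shows "(\<integral>X. f X \<partial>lborel) = c ^ DIM('a) * (\<integral>X. f (c *\<^sub>R X) \<partial>lborel)"
  using c by (subst lborel_affine[of c 0])
    (simp_all add: integral_density integral_distr)

text \<open>Dilation by r multiplies Lebesgue measure by r^N, and the normalisation N / r of the
  cone measure takes one power away.\<close>

lemma sphere_measure_eq_distr:
  assumes r: "0 < r"
  shows "(sphere_measure r :: 'a::euclidean_space measure) =
    density (distr (sphere_measure 1) borel (\<lambda>\<theta>. r *\<^sub>R \<theta>)) (\<lambda>_. ennreal (r ^ (DIM('a) - 1)))"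
proof (rule measure_eqI)
  fix A :: "'a set" assume "A \<in> sets (sphere_measure r)"
  then have [measurable]: "A \<in> sets borel" by simp
  have D: "DIM('a) = Suc (DIM('a) - 1)" using DIM_positive[where 'a='a] by linarith
  have [measurable]: "(\<lambda>\<theta> :: 'a. r *\<^sub>R \<theta>) \<in> sphere_measure 1 \<rightarrow>\<^sub>M borel"
    by measurable
  let ?N = "real DIM('a)"
  have "emeasure (sphere_measure r) A = (\<integral>\<^sup>+\<theta>. indicator A \<theta> \<partial>sphere_measure r)"
    by simp
  also have "\<dots> = ennreal (?N / r)
    * (\<integral>\<^sup>+X. indicator A ((r / norm X) *\<^sub>R X) * indicator (ball 0 r) X \<partial>lborel)"
    by (rule nn_integral_sphere_measure) simp
  also have "\<dots> = ennreal (?N / r) * (ennreal (r ^ DIM('a)) *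
      (\<integral>\<^sup>+X. indicator A ((r / norm (r *\<^sub>R X)) *\<^sub>R r *\<^sub>R X) * indicator (ball 0 r) (r *\<^sub>R X) \<partial>lborel))"
    by (rule arg_cong[OF nn_integral_lborel_scaleR[OF _ r]]) measurable
  also have "(\<lambda>X :: 'a. indicator A ((r / norm (r *\<^sub>R X)) *\<^sub>R r *\<^sub>R X) * indicator (ball 0 r) (r *\<^sub>R X) :: ennreal)
      = (\<lambda>X. indicator A (r *\<^sub>R (1 / norm X) *\<^sub>R X) * indicator (ball 0 1) X)"
    using r by (auto simp: fun_eq_iff indicator_def)
  also have "ennreal (?N / r) * (ennreal (r ^ DIM('a)) *
      (\<integral>\<^sup>+X. indicator A (r *\<^sub>R (1 / norm X) *\<^sub>R X) * indicator (ball 0 1) X \<partial>lborel)) =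
      ennreal (r ^ (DIM('a) - 1)) * (ennreal (?N / 1) *
      (\<integral>\<^sup>+X. indicator A (r *\<^sub>R (1 / norm X) *\<^sub>R X) * indicator (ball 0 1) X \<partial>lborel))"
  proof -
    have "r ^ DIM('a) = r * r ^ (DIM('a) - 1)"
      by (subst D) (rule power_Suc)
    then have "?N / r * r ^ DIM('a) = r ^ (DIM('a) - 1) * (?N / 1)"
      using r by simp
    then have "ennreal (?N / r) * ennreal (r ^ DIM('a)) = ennreal (r ^ (DIM('a) - 1)) * ennreal (?N / 1)"
      using r by (subst (1 2) ennreal_mult[symmetric]) auto
    then show ?thesis by (simp only: mult.assoc[symmetric])
  qed
  also have "ennreal (?N / 1) *
      (\<integral>\<^sup>+X. indicator A (r *\<^sub>R (1 / norm X) *\<^sub>R X) * indicator (ball 0 1) X \<partial>lborel) =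
      (\<integral>\<^sup>+\<theta>. indicator A (r *\<^sub>R \<theta>) \<partial>sphere_measure 1)"
    by (rule nn_integral_sphere_measure[symmetric]) measurable
  also have "(\<integral>\<^sup>+\<theta>. indicator A (r *\<^sub>R \<theta>) \<partial>sphere_measure 1) =
      (\<integral>\<^sup>+\<theta>. indicator A \<theta> \<partial>distr (sphere_measure 1) borel (\<lambda>\<theta>. r *\<^sub>R \<theta>))"
    by (rule nn_integral_distr[symmetric]) measurable
  finally show "emeasure (sphere_measure r) A = emeasure (density (distr (sphere_measure 1) borel
      (\<lambda>\<theta>. r *\<^sub>R \<theta>)) (\<lambda>_. ennreal (r ^ (DIM('a) - 1)))) A"
    by (simp add: emeasure_density nn_integral_cmult)
qed simp

text \<open>This is the weight |Z|^(-N) that a point Z collects from all balls of radius t > |Z| in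
  the proof of polar coordinates.\<close>

lemma nn_integral_inverse_power_tail:
  assumes "0 < a"
  shows "(\<integral>\<^sup>+t. ennreal (real N * inverse (t ^ Suc N)) * indicator {a..} t \<partial>lborel)
    = ennreal (if N = 0 then 0 else inverse (a ^ N))"
proof (cases "N = 0")
  case False
  have "((\<lambda>t :: real. - inverse (t ^ N)) \<longlongrightarrow> - 0) at_top"
    by (intro tendsto_minus tendsto_inverse_0_at_top filterlim_pow_at_top filterlim_ident) (use False in auto)
  moreover have "DERIV (\<lambda>t. - inverse (t ^ N)) x :> real N * inverse (x ^ Suc N)" if "a \<le> x" for x
  proof -
    have x: "x > 0" using that assms by simp
    have N: "N = Suc (N - 1)" using False by simp
    have "x ^ N = x * x ^ (N - 1)" by (subst N) simp
    with x show ?thesis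
      by (auto intro!: derivative_eq_intros simp: field_simps power2_eq_square)
  qed
  ultimately have "(\<integral>\<^sup>+t. ennreal (real N * inverse (t ^ Suc N)) * indicator {a..} t \<partial>lborel)
      = ennreal (0 - - inverse (a ^ N))"
    using assms by (intro nn_integral_FTC_atLeast) auto
  then show ?thesis using False by simp
qed simp

text \<open>As the sphere measure is an average over a cone, dilations and Tonelli suffice. For
  fixed X, rescaling t by |X| produces a factor |X|^N. For fixed t, the substitution Z = t X
  produces the weight N t^(-N-1) on the ball |Z| < t. The integral of this weight over t > |Z| is
  |Z|^(-N), which cancels the first factor.\<close>

theorem nn_integral_polar:
  fixes f :: "'a::euclidean_space \<Rightarrow> ennreal"
  assumes [measurable]: "f \<in> borel_measurable borel"
  shows "(\<integral>\<^sup>+X. f X \<partial>lborel) = (\<integral>\<^sup>+t. indicator {0<..} t * ennreal (t ^ (DIM('a) - 1))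
    * (\<integral>\<^sup>+\<theta>. f (t *\<^sub>R \<theta>) \<partial>sphere_measure 1) \<partial>lborel)"
proof -
  let ?N = "DIM('a)"
  have D: "?N = Suc (?N - 1)" using DIM_positive[where 'a='a] by linarith
  have AE0: "AE X in lborel. X \<noteq> (0::'a)"
    by (rule AE_lborel_singleton)
  have [measurable]: "(\<lambda>\<theta>. f (t *\<^sub>R \<theta>)) \<in> borel_measurable borel" for t
    by measurable
  have "(\<integral>\<^sup>+t. indicator {0<..} t * ennreal (t ^ (?N - 1))
      * (\<integral>\<^sup>+\<theta>. f (t *\<^sub>R \<theta>) \<partial>sphere_measure 1) \<partial>lborel)
    = (\<integral>\<^sup>+t. \<integral>\<^sup>+X. indicator {0<..} t * ennreal (t ^ (?N - 1)) * (ennreal ?N *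
        (f (t *\<^sub>R (1 / norm X) *\<^sub>R X) * indicator (ball 0 1) X)) \<partial>lborel \<partial>lborel)"
    by (simp add: nn_integral_sphere_measure nn_integral_cmult)
  also have "\<dots> = (\<integral>\<^sup>+X. \<integral>\<^sup>+t. indicator {0<..} t * ennreal (t ^ (?N - 1)) * (ennreal ?N *
        (f (t *\<^sub>R (1 / norm X) *\<^sub>R X) * indicator (ball 0 1) X)) \<partial>lborel \<partial>lborel)"
    by (rule lborel_pair.Fubini') measurable
  also have "\<dots> = (\<integral>\<^sup>+X. \<integral>\<^sup>+t. indicator {0<..} t * ennreal (t ^ (?N - 1)) * (ennreal ?N *
        (ennreal (norm X ^ ?N) * f (t *\<^sub>R X) * indicator (ball 0 1) X)) \<partial>lborel \<partial>lborel)"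
  proof (rule nn_integral_cong_AE, use AE0 in eventually_elim)
    case (elim X)
    then have n: "norm X > 0" by simp
    have "(\<integral>\<^sup>+t. indicator {0<..} t * ennreal (t ^ (?N - 1)) * (ennreal ?N *
        (f (t *\<^sub>R (1 / norm X) *\<^sub>R X) * indicator (ball 0 1) X)) \<partial>lborel) =
        ennreal \<bar>norm X\<bar> * (\<integral>\<^sup>+t. indicator {0<..} (0 + norm X * t) * ennreal ((0 + norm X * t) ^ (?N - 1)) * (ennreal ?N *
        (f ((0 + norm X * t) *\<^sub>R (1 / norm X) *\<^sub>R X) * indicator (ball 0 1) X)) \<partial>lborel)"
      using n by (intro nn_integral_real_affine) auto
    also have "\<dots> = (\<integral>\<^sup>+t. ennreal \<bar>norm X\<bar> * (indicator {0<..} (0 + norm X * t) * ennreal ((0 + norm X * t) ^ (?N - 1)) * (ennreal ?N *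
        (f ((0 + norm X * t) *\<^sub>R (1 / norm X) *\<^sub>R X) * indicator (ball 0 1) X))) \<partial>lborel)"
      by (rule nn_integral_cmult[symmetric]) measurable
    also have "\<dots> = (\<integral>\<^sup>+t. indicator {0<..} t * ennreal (t ^ (?N - 1)) * (ennreal ?N *
        (ennreal (norm X ^ ?N) * f (t *\<^sub>R X) * indicator (ball 0 1) X)) \<partial>lborel)"
    proof (rule nn_integral_cong)
      fix t :: real
      show "ennreal \<bar>norm X\<bar> * (indicator {0<..} (0 + norm X * t) * ennreal ((0 + norm X * t) ^ (?N - 1)) * (ennreal ?N *
        (f ((0 + norm X * t) *\<^sub>R (1 / norm X) *\<^sub>R X) * indicator (ball 0 1) X))) =
        indicator {0<..} t * ennreal (t ^ (?N - 1)) * (ennreal ?N *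
        (ennreal (norm X ^ ?N) * f (t *\<^sub>R X) * indicator (ball 0 1) X))"
      proof (cases "t > 0")
        case True
        have "ennreal (norm X) * ennreal ((norm X * t) ^ (?N - 1)) = ennreal (t ^ (?N - 1)) * ennreal (norm X ^ ?N)"
        proof -
          have "norm X ^ ?N = norm X * norm X ^ (?N - 1)"
            by (subst D) (rule power_Suc)
          then show ?thesis
            using True n by (simp add: ennreal_mult[symmetric] power_mult_distrib mult_ac)
        qed
        moreover have "x * (1 * y * (k * (g * i))) = v * (k * (w * g * i))" if "x * y = v * w"
          for x y v w k g i :: ennreal
        proof -
          have "x * (1 * y * (k * (g * i))) = (x * y) * (k * (g * i))" by (simp add: mult_ac)
          also have "\<dots> = v * (k * (w * g * i))" unfolding that by (simp add: mult_ac)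
          finally show ?thesis .
        qed
        ultimately show ?thesis
          using True n by simp
      next
        case False
        then show ?thesis using n by (simp add: zero_less_mult_iff)
      qed
    qed
    finally show ?case .
  qed
  also have "\<dots> = (\<integral>\<^sup>+t. \<integral>\<^sup>+X. indicator {0<..} t * ennreal (t ^ (?N - 1)) * (ennreal ?N *
        (ennreal (norm X ^ ?N) * f (t *\<^sub>R X) * indicator (ball 0 1) X)) \<partial>lborel \<partial>lborel)"
    by (rule lborel_pair.Fubini') measurable
  also have "\<dots> = (\<integral>\<^sup>+t. \<integral>\<^sup>+Z. ennreal (?N * inverse (t ^ Suc ?N)) * indicator {0<..} t
        * (ennreal (norm Z ^ ?N) * f Z * indicator (ball 0 t) Z) \<partial>lborel \<partial>lborel)"
  proof (rule nn_integral_cong)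
    fix t :: real
    show "(\<integral>\<^sup>+X. indicator {0<..} t * ennreal (t ^ (?N - 1)) * (ennreal ?N *
        (ennreal (norm X ^ ?N) * f (t *\<^sub>R X) * indicator (ball 0 1) X)) \<partial>lborel) =
      (\<integral>\<^sup>+Z. ennreal (?N * inverse (t ^ Suc ?N)) * indicator {0<..} t
        * (ennreal (norm Z ^ ?N) * f Z * indicator (ball 0 t) Z) \<partial>lborel)"
    proof (cases "t > 0")
      case True
      have "(\<integral>\<^sup>+Z. ennreal (?N * inverse (t ^ Suc ?N)) * indicator {0<..} t
          * (ennreal (norm Z ^ ?N) * f Z * indicator (ball 0 t) Z) \<partial>lborel) =
        ennreal (t ^ ?N) * (\<integral>\<^sup>+Z. ennreal (?N * inverse (t ^ Suc ?N)) * indicator {0<..} t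
          * (ennreal (norm (t *\<^sub>R Z) ^ ?N) * f (t *\<^sub>R Z) * indicator (ball 0 t) (t *\<^sub>R Z)) \<partial>lborel)"
        by (rule nn_integral_lborel_scaleR[OF _ True]) measurable
      also have "\<dots> = (\<integral>\<^sup>+Z. ennreal (t ^ ?N) * (ennreal (?N * inverse (t ^ Suc ?N)) * indicator {0<..} t
          * (ennreal (norm (t *\<^sub>R Z) ^ ?N) * f (t *\<^sub>R Z) * indicator (ball 0 t) (t *\<^sub>R Z))) \<partial>lborel)"
        by (rule nn_integral_cmult[symmetric]) measurable
      also have "\<dots> = (\<integral>\<^sup>+X. indicator {0<..} t * ennreal (t ^ (?N - 1)) * (ennreal ?N *
        (ennreal (norm X ^ ?N) * f (t *\<^sub>R X) * indicator (ball 0 1) X)) \<partial>lborel)"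
      proof (rule nn_integral_cong)
        fix X :: 'a
        have i: "indicator (ball 0 t) (t *\<^sub>R X) = (indicator (ball 0 1) X :: ennreal)"
          using True by (auto simp: indicator_def)
        have "t ^ ?N * ((?N * inverse (t ^ Suc ?N)) * norm (t *\<^sub>R X) ^ ?N) = t ^ (?N - 1) * (?N * norm X ^ ?N)"
        proof -
          have "t ^ ?N = t * t ^ (?N - 1)"
            by (subst D) (rule power_Suc)
          then show ?thesis
            using True by (simp add: power_mult_distrib field_simps)
        qed
        moreover have em: "ennreal (x * (y * z)) = ennreal x * (ennreal y * ennreal z)"
          if "0 \<le> x" "0 \<le> y" "0 \<le> z" for x y z
          using that by (simp add: ennreal_mult)
        have "ennreal (t ^ ?N * ((?N * inverse (t ^ Suc ?N)) * norm (t *\<^sub>R X) ^ ?N)) =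
          ennreal (t ^ ?N) * (ennreal (?N * inverse (t ^ Suc ?N)) * ennreal (norm (t *\<^sub>R X) ^ ?N))"
          by (rule em) (use True in auto)
        moreover have "ennreal (t ^ (?N - 1) * (?N * norm X ^ ?N)) =
          ennreal (t ^ (?N - 1)) * (ennreal ?N * ennreal (norm X ^ ?N))"
          by (rule em) (use True in auto)
        ultimately have "ennreal (t ^ ?N) * (ennreal (?N * inverse (t ^ Suc ?N)) * ennreal (norm (t *\<^sub>R X) ^ ?N))
          = ennreal (t ^ (?N - 1)) * (ennreal ?N * ennreal (norm X ^ ?N))"
          by metis
        then show "ennreal (t ^ ?N) * (ennreal (?N * inverse (t ^ Suc ?N)) * indicator {0<..} t
          * (ennreal (norm (t *\<^sub>R X) ^ ?N) * f (t *\<^sub>R X) * indicator (ball 0 t) (t *\<^sub>R X))) =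
          indicator {0<..} t * ennreal (t ^ (?N - 1)) * (ennreal ?N *
          (ennreal (norm X ^ ?N) * f (t *\<^sub>R X) * indicator (ball 0 1) X))"
          unfolding i using True by (simp add: mult.assoc[symmetric])
      qed
      finally show ?thesis ..
    qed simp
  qed
  also have "\<dots> = (\<integral>\<^sup>+Z. \<integral>\<^sup>+t. ennreal (?N * inverse (t ^ Suc ?N)) * indicator {0<..} t
        * (ennreal (norm Z ^ ?N) * f Z * indicator (ball 0 t) Z) \<partial>lborel \<partial>lborel)"
  proof (rule lborel_pair.Fubini', goal_cases)
    case 1
    \<comment> \<open>The ball varies with \<open>t\<close>, so joint measurability is read off from
      the set \<open>norm (snd x) < fst x\<close> in the product space.\<close>
    have "(\<lambda>(t, Z). ennreal (?N * inverse (t ^ Suc ?N)) * indicator {0<..} t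
        * (ennreal (norm Z ^ ?N) * f Z * indicator {x. norm (snd x) < fst x} (t, Z)))
      \<in> borel_measurable (lborel \<Otimes>\<^sub>M (lborel :: 'a measure))"
      by measurable
    then show ?case
      by (simp add: indicator_def cong: if_cong)
  qed
  also have "\<dots> = (\<integral>\<^sup>+Z. f Z \<partial>lborel)"
  proof (rule nn_integral_cong_AE, use AE0 in eventually_elim)
    case (elim Z)
    have "(\<integral>\<^sup>+t. ennreal (?N * inverse (t ^ Suc ?N)) * indicator {0<..} t
        * (ennreal (norm Z ^ ?N) * f Z * indicator (ball 0 t) Z) \<partial>lborel) =
      (\<integral>\<^sup>+t. ennreal (?N * inverse (t ^ Suc ?N)) * indicator {norm Z..} t
        * (ennreal (norm Z ^ ?N) * f Z) \<partial>lborel)"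
    \<comment> \<open>The open ball excludes \<open>t = norm Z\<close>, which the tail integral
      includes; a single point is null.\<close>
    proof (rule nn_integral_cong_AE, use AE_lborel_singleton[of "norm Z"] in eventually_elim)
      case (elim t)
      have "norm Z > 0" using \<open>Z \<noteq> 0\<close> by simp
      then have "norm Z \<le> t \<Longrightarrow> 0 < t" by linarith
      with elim show ?case
        by (auto simp: indicator_def)
    qed
    also have "\<dots> = (\<integral>\<^sup>+t. ennreal (?N * inverse (t ^ Suc ?N)) * indicator {norm Z..} t \<partial>lborel)
        * (ennreal (norm Z ^ ?N) * f Z)"
      by (rule nn_integral_multc) measurable
    also have "\<dots> = ennreal (inverse (norm Z ^ ?N)) * (ennreal (norm Z ^ ?N) * f Z)"
      using elim by (subst nn_integral_inverse_power_tail) auto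
    also have "\<dots> = f Z"
      using elim by (simp add: mult.assoc[symmetric] ennreal_mult[symmetric])
    finally show ?case .
  qed
  finally show ?thesis ..
qed

section \<open>The unit half-sphere with the weight y^b\<close>

definition half_sphere :: "((real^'n) \<times> real) set" where
  "half_sphere = {\<theta> \<in> upper_half. norm \<theta> = 1}"

text \<open>For b < 0 the weight is unbounded at the equator. Carried by the measure, which is
  finite for b > -1, it leaves integrands that are bounded and extend continuously to the
  equator.\<close>

definition weighted_half_sphere :: "real \<Rightarrow> ((real^'n) \<times> real) measure" where
  "weighted_half_sphere b =
     restrict_space (density (sphere_measure 1) (\<lambda>\<theta>. ennreal (snd \<theta> powr b))) half_sphere"

lemma upper_half_borel [measurable]: "upper_half \<in> sets borel"
  using open_upper_half by (rule borel_open)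

lemma half_sphere_borel [measurable]: "half_sphere \<in> sets borel"
proof -
  have "half_sphere = upper_half \<inter> (sphere 0 1 :: ((real^'n) \<times> real) set)"
    by (auto simp: half_sphere_def)
  moreover have "sphere 0 1 \<in> sets (borel :: ((real^'n) \<times> real) measure)"
    by (rule borel_closed[OF closed_sphere])
  ultimately show ?thesis using sets.Int[OF upper_half_borel] by metis
qed

lemma pred_cball [measurable]: "Measurable.pred borel (\<lambda>x :: 'a::euclidean_space. x \<in> cball c r)"
  using borel_closed[OF closed_cball[of c r]] by (simp add: pred_def)

lemma snd_borel [measurable]: "(snd :: (real^'n) \<times> real \<Rightarrow> real) \<in> borel_measurable borel"
  by (intro borel_measurable_continuous_onI continuous_intros)

lemma space_weighted_half_sphere [simp]: "space (weighted_half_sphere b) = half_sphere"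
  by (simp add: weighted_half_sphere_def space_restrict_space)

lemma sets_weighted_half_sphere [measurable_cong, simp]:
  "sets (weighted_half_sphere b) = sets (restrict_space borel half_sphere)"
  by (simp add: weighted_half_sphere_def sets_restrict_space)

text \<open>The measure lives on the whole space as an image under X / |X|. The origin is the only
  point not sent to the unit sphere, and it is a null set.\<close>

lemma AE_sphere_measure_norm: "AE \<theta> in sphere_measure 1. norm (\<theta> :: 'a::euclidean_space) = 1"
proof -
  have "(\<integral>\<^sup>+\<theta>. indicator {\<theta> :: 'a. norm \<theta> \<noteq> 1} \<theta> \<partial>sphere_measure 1) =
    ennreal (real DIM('a) / 1) * (\<integral>\<^sup>+X. indicator {\<theta> :: 'a. norm \<theta> \<noteq> 1} ((1 / norm X) *\<^sub>R X)
      * indicator (ball 0 1) X \<partial>lborel)"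
    by (rule nn_integral_sphere_measure) measurable
  also have "(\<integral>\<^sup>+X. indicator {\<theta> :: 'a. norm \<theta> \<noteq> 1} ((1 / norm X) *\<^sub>R X)
      * indicator (ball 0 1) X \<partial>lborel) = (\<integral>\<^sup>+X. 0 \<partial>(lborel :: 'a measure))"
    by (rule nn_integral_cong_AE, use AE_lborel_singleton[of "0::'a"] in eventually_elim) auto
  finally have "emeasure (sphere_measure 1) {\<theta> :: 'a. norm \<theta> \<noteq> 1} = 0"
    by simp
  then show ?thesis
    by (intro AE_I[of _ _ "{\<theta> :: 'a. norm \<theta> \<noteq> 1}"]) auto
qed

lemma nn_integral_weighted_half_sphere:
  assumes [measurable]: "f \<in> borel_measurable borel"
  shows "(\<integral>\<^sup>+\<theta>. f \<theta> \<partial>weighted_half_sphere b) =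
    (\<integral>\<^sup>+\<theta>. ennreal (snd \<theta> powr b) * (indicator upper_half \<theta> * f \<theta>) \<partial>sphere_measure 1)"
proof -
  have "(\<integral>\<^sup>+\<theta>. f \<theta> \<partial>weighted_half_sphere b) =
    (\<integral>\<^sup>+\<theta>. ennreal (snd \<theta> powr b) * (f \<theta> * indicator half_sphere \<theta>) \<partial>sphere_measure 1)"
    unfolding weighted_half_sphere_def
    by (subst nn_integral_restrict_space) (simp_all add: nn_integral_density)
  also have "\<dots> = (\<integral>\<^sup>+\<theta>. ennreal (snd \<theta> powr b) * (indicator upper_half \<theta> * f \<theta>) \<partial>sphere_measure 1)"
    by (rule nn_integral_cong_AE, use AE_sphere_measure_norm in eventually_elim)
      (auto simp: half_sphere_def indicator_def)
  finally show ?thesis .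
qed

lemma indicator_upper_half_scaleR:
  "0 < r \<Longrightarrow> indicator upper_half (r *\<^sub>R X) = indicator upper_half X"
  by (simp add: indicator_def upper_half_scaleR)

text \<open>Measurability is asked of the product with the indicator, because derivatives of
  \<open>u\<close> are controlled on the open half-space only.\<close>

lemma integral_weighted_half_sphere:
  fixes f :: "(real^'n) \<times> real \<Rightarrow> real"
  assumes [measurable]: "(\<lambda>\<theta>. indicator upper_half \<theta> * f \<theta>) \<in> borel_measurable borel"
  shows "(\<integral>\<theta>. f \<theta> \<partial>weighted_half_sphere b) =
    (\<integral>\<theta>. snd \<theta> powr b * (indicator upper_half \<theta> * f \<theta>) \<partial>sphere_measure 1)"
proof -
  let ?g = "\<lambda>\<theta>. indicator upper_half \<theta> * f \<theta>"
  have "(\<integral>\<theta>. f \<theta> \<partial>weighted_half_sphere b) = (\<integral>\<theta>. ?g \<theta> \<partial>weighted_half_sphere b)"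
    by (rule Bochner_Integration.integral_cong) (auto simp: half_sphere_def)
  also have "\<dots> = (\<integral>\<theta>. snd \<theta> powr b * (indicator half_sphere \<theta> * ?g \<theta>) \<partial>sphere_measure 1)"
    unfolding weighted_half_sphere_def
    by (subst integral_restrict_space) (simp_all add: integral_density)
  also have "\<dots> = (\<integral>\<theta>. snd \<theta> powr b * ?g \<theta> \<partial>sphere_measure 1)"
  proof (rule integral_cong_AE)
    show "AE \<theta> in sphere_measure 1. snd \<theta> powr b * (indicator half_sphere \<theta> * ?g \<theta>) = snd \<theta> powr b * ?g \<theta>"
      using AE_sphere_measure_norm by eventually_elim (auto simp: half_sphere_def indicator_def)
  qed measurable
  finally show ?thesis .
qed

text \<open>The exponent collects n from the surface measure and b from the homogeneity of the
  weight.\<close>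

lemma half_sphere_integral_eq:
  fixes f :: "(real^'n) \<times> real \<Rightarrow> real"
  assumes f [measurable]: "(\<lambda>X. indicator upper_half X * f X) \<in> borel_measurable borel" and r: "0 < r"
  shows "half_sphere_integral (\<lambda>X. snd X powr b * f X) r =
    r powr (real CARD('n) + b) * (\<integral>\<theta>. f (r *\<^sub>R \<theta>) \<partial>weighted_half_sphere b)"
proof -
  have scale [measurable]: "(\<lambda>\<theta> :: (real^'n) \<times> real. r *\<^sub>R \<theta>) \<in> sphere_measure 1 \<rightarrow>\<^sub>M borel"
    by measurable
  have m [measurable]: "(\<lambda>X. indicator upper_half (r *\<^sub>R X) * f (r *\<^sub>R X)) \<in> borel_measurable borel"
    using measurable_compose[OF _ f, of "\<lambda>X. r *\<^sub>R X" borel] by simp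
  then have m': "(\<lambda>X. indicator upper_half X * f (r *\<^sub>R X)) \<in> borel_measurable borel"
    using r by (simp add: indicator_upper_half_scaleR)
  have "half_sphere_integral (\<lambda>X. snd X powr b * f X) r =
      (\<integral>X. snd X powr b * (indicator upper_half X * f X) \<partial>sphere_measure r)"
    by (simp add: half_sphere_integral_def set_lebesgue_integral_def mult_ac)
  also have "\<dots> = r ^ CARD('n) * (\<integral>\<theta>. snd (r *\<^sub>R \<theta>) powr b *
      (indicator upper_half (r *\<^sub>R \<theta>) * f (r *\<^sub>R \<theta>)) \<partial>sphere_measure 1)"
    using r by (subst sphere_measure_eq_distr[OF r]) (simp add: integral_density integral_distr)
  also have "(\<integral>\<theta>. snd (r *\<^sub>R \<theta>) powr b *
      (indicator upper_half (r *\<^sub>R \<theta>) * f (r *\<^sub>R \<theta>)) \<partial>sphere_measure 1) =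
      (\<integral>\<theta>. r powr b * (snd \<theta> powr b * (indicator upper_half \<theta> * f (r *\<^sub>R \<theta>))) \<partial>sphere_measure 1)"
    using r by (intro Bochner_Integration.integral_cong)
      (auto simp: indicator_upper_half_scaleR powr_mult upper_half_def zero_less_mult_iff split: split_indicator)
  also have "\<dots> = r powr b * (\<integral>\<theta>. f (r *\<^sub>R \<theta>) \<partial>weighted_half_sphere b)"
    by (simp add: integral_weighted_half_sphere[OF m'])
  finally show ?thesis
    using r by (simp add: powr_add powr_realpow mult.assoc)
qed

text \<open>The half-ball lies in a cylinder of radius and height |R|, and y^b is integrable at 0
  since b > -1.\<close>

lemma nn_integral_powr_ball:
  assumes b: "-1 < b"
  shows "(\<integral>\<^sup>+X. ennreal (snd X powr b) * indicator (upper_half \<inter> ball 0 R) X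
    \<partial>(lborel :: ((real^'n) \<times> real) measure)) < \<infinity>"
proof -
  let ?f = "\<lambda>y. if y \<in> {0..\<bar>R\<bar>} then y powr b else (0::real)"
  have le: "ennreal (snd X powr b) * indicator (upper_half \<inter> ball 0 R) X
      \<le> indicator (cball 0 \<bar>R\<bar>) (fst X) * ennreal (?f (snd X))" for X :: "(real^'n) \<times> real"
  proof (cases "X \<in> upper_half \<inter> ball 0 R")
    case True
    then have "norm (fst X) \<le> \<bar>R\<bar>" "snd X \<le> \<bar>R\<bar>" "0 \<le> snd X"
      using norm_fst_le[of "fst X" "snd X"] norm_snd_le[of "snd X" "fst X"]
      by (auto simp: upper_half_def)
    then show ?thesis by (simp add: indicator_def)
  qed simp
  have hi: "(?f has_integral (\<bar>R\<bar> powr (b + 1) / (b + 1))) UNIV"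
    unfolding has_integral_restrict_UNIV by (rule has_integral_powr_from_0[OF b]) simp
  have "(\<integral>\<^sup>+X. ennreal (snd X powr b) * indicator (upper_half \<inter> ball 0 R) X \<partial>(lborel :: ((real^'n) \<times> real) measure))
    \<le> (\<integral>\<^sup>+X. indicator (cball 0 \<bar>R\<bar>) (fst X) * ennreal (?f (snd X)) \<partial>(lborel :: ((real^'n) \<times> real) measure))"
    by (rule nn_integral_mono) (rule le)
  also have "\<dots> = (\<integral>\<^sup>+X. indicator (cball 0 \<bar>R\<bar>) (fst X) * ennreal (?f (snd X)) \<partial>((lborel :: (real^'n) measure) \<Otimes>\<^sub>M lborel))"
    by (simp add: lborel_prod)
  also have "\<dots> = (\<integral>\<^sup>+x. \<integral>\<^sup>+y. indicator (cball 0 \<bar>R\<bar>) x * ennreal (?f y) \<partial>lborel \<partial>(lborel :: (real^'n) measure))"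
  proof (subst lborel.nn_integral_fst[symmetric])
    have "(\<lambda>y. ennreal (?f y)) \<in> borel_measurable lborel"
      by measurable
    moreover have "(indicator (cball 0 \<bar>R\<bar>) :: _ \<Rightarrow> ennreal) \<in> borel_measurable (lborel :: (real^'n) measure)"
      using borel_measurable_indicator[of "cball 0 \<bar>R\<bar>" "borel :: (real^'n) measure"] by (simp add: borel_closed)
    ultimately show "(\<lambda>X. indicator (cball 0 \<bar>R\<bar>) (fst X) * ennreal (?f (snd X))) \<in> borel_measurable ((lborel :: (real^'n) measure) \<Otimes>\<^sub>M lborel)"
      by (intro borel_measurable_times_ennreal measurable_compose[OF measurable_fst]
          measurable_compose[OF measurable_snd])
  qed (simp only: fst_conv snd_conv)
  also have "\<dots> = (\<integral>\<^sup>+y. ennreal (?f y) \<partial>lborel) * emeasure lborel (cball (0 :: real^'n) \<bar>R\<bar>)"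
    by (simp add: nn_integral_cmult nn_integral_multc mult.commute)
  also have "(\<integral>\<^sup>+y. ennreal (?f y) \<partial>lborel) = ennreal (\<bar>R\<bar> powr (b + 1) / (b + 1))"
    by (rule nn_integral_has_integral_lborel[OF _ _ hi]) auto
  also have "\<dots> * emeasure lborel (cball (0 :: real^'n) \<bar>R\<bar>) < \<infinity>"
    using emeasure_lborel_cball_finite[of "0 :: real^'n" "\<bar>R\<bar>"] by (simp add: ennreal_mult_less_top)
  finally show ?thesis .
qed

lemma integrable_powr_ball:
  assumes "-1 < b"
  shows "integrable (lborel :: ((real^'n) \<times> real) measure)
    (\<lambda>X. indicator (upper_half \<inter> ball 0 R) X * snd X powr b)"
proof (rule integrableI_bounded)
  have "(\<integral>\<^sup>+X. ennreal (norm (indicator (upper_half \<inter> ball 0 R) X * snd X powr b)) \<partial>(lborel :: ((real^'n) \<times> real) measure)) =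
    (\<integral>\<^sup>+X. ennreal (snd X powr b) * indicator (upper_half \<inter> ball 0 R) X \<partial>(lborel :: ((real^'n) \<times> real) measure))"
    by (rule nn_integral_cong) (simp split: split_indicator)
  then show "(\<integral>\<^sup>+X. ennreal (norm (indicator (upper_half \<inter> ball 0 R) X * snd X powr b)) \<partial>(lborel :: ((real^'n) \<times> real) measure)) < \<infinity>"
    using nn_integral_powr_ball[OF assms, of R] by simp
qed measurable

text \<open>Pulled back to the cone, the weight is (y / |X|)^b with y <= |X| < 1. It is at most 1 if
  b >= 0 and at most y^b if b < 0, so integrability of y^b over the half-ball suffices.\<close>

lemma finite_weighted_half_sphere:
  assumes b: "-1 < b"
  shows "finite_measure (weighted_half_sphere b :: ((real^'n) \<times> real) measure)"
proof (rule finite_measureI)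
  let ?U = "upper_half :: ((real^'n) \<times> real) set"
  have le: "ennreal (snd ((1 / norm X) *\<^sub>R X) powr b) * (indicator ?U ((1 / norm X) *\<^sub>R X) * 1) * indicator (ball 0 1) X
      \<le> indicator (ball 0 1) X + ennreal (snd X powr b) * indicator (?U \<inter> ball 0 1) X" for X
  proof (cases "X \<in> ?U \<inter> ball 0 1")
    case True
    then have y: "0 < snd X" and n: "0 < norm X" "norm X < 1" and le: "snd X \<le> norm X"
      using norm_snd_le[of "snd X" "fst X"] by (auto simp: upper_half_def)
    show ?thesis
    proof (cases "b \<ge> 0")
      case b0: True
      have "(snd X / norm X) powr b \<le> 1"
        using y n le b0 by (intro powr_le1) auto
      then have "ennreal ((snd X / norm X) powr b) \<le> 1" by simp
      then show ?thesis
        using True by (simp add: indicator_def add_increasing2)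
    next
      case b0: False
      have "(snd X / norm X) powr b \<le> snd X powr b"
        using y n b0 by (intro powr_mono2') (auto simp: field_simps)
      then have "ennreal ((snd X / norm X) powr b) \<le> 1 + ennreal (snd X powr b)"
        by (simp add: add_increasing ennreal_leI)
      then show ?thesis
        using True by (simp add: indicator_def)
    qed
  next
    case False
    then show ?thesis
      by (cases "X \<in> ball 0 1") (auto simp: indicator_def upper_half_def zero_less_divide_iff)
  qed
  have "emeasure (weighted_half_sphere b :: ((real^'n) \<times> real) measure) half_sphere =
      (\<integral>\<^sup>+\<theta>. 1 \<partial>(weighted_half_sphere b :: ((real^'n) \<times> real) measure))"
    by simp
  also have "\<dots> = (\<integral>\<^sup>+\<theta>. ennreal (snd \<theta> powr b) * (indicator ?U \<theta> * 1) \<partial>sphere_measure 1)"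
    by (rule nn_integral_weighted_half_sphere) simp
  also have "\<dots> = ennreal (real DIM((real^'n) \<times> real) / 1) * (\<integral>\<^sup>+X. ennreal (snd ((1 / norm X) *\<^sub>R X) powr b) *
      (indicator ?U ((1 / norm X) *\<^sub>R X) * 1) * indicator (ball 0 1) X \<partial>lborel)"
    by (rule nn_integral_sphere_measure) measurable
  also have "\<dots> \<le> ennreal (real DIM((real^'n) \<times> real) / 1) *
      (\<integral>\<^sup>+X. indicator (ball 0 1) X + ennreal (snd X powr b) * indicator (?U \<inter> ball 0 1) X \<partial>lborel)"
    by (intro mult_left_mono nn_integral_mono le) simp
  also have "(\<integral>\<^sup>+X. indicator (ball 0 1) X + ennreal (snd X powr b) * indicator (?U \<inter> ball 0 1) X \<partial>lborel) =
      emeasure lborel (ball (0 :: (real^'n) \<times> real) 1) + (\<integral>\<^sup>+X. ennreal (snd X powr b) * indicator (?U \<inter> ball 0 1) X \<partial>lborel)"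
    by (subst nn_integral_add) auto
  also have "ennreal (real DIM((real^'n) \<times> real) / 1) * \<dots> < \<infinity>"
    using nn_integral_powr_ball[OF b, of 1, where 'n='n] emeasure_lborel_ball_finite[of "0 :: (real^'n) \<times> real" 1]
    by (simp add: ennreal_mult_less_top)
  finally show "emeasure (weighted_half_sphere b :: ((real^'n) \<times> real) measure) (space (weighted_half_sphere b)) \<noteq> \<infinity>"
    by simp
qed

lemma nn_integral_polar_upper_half:
  fixes g :: "(real^'n) \<times> real \<Rightarrow> ennreal"
  assumes [measurable]: "g \<in> borel_measurable borel"
  shows "(\<integral>\<^sup>+X. indicator upper_half X * ennreal (snd X powr b) * g X \<partial>lborel) =
    (\<integral>\<^sup>+t. indicator {0<..} t * ennreal (t powr (real CARD('n) + b)) *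
      (\<integral>\<^sup>+\<theta>. g (t *\<^sub>R \<theta>) \<partial>weighted_half_sphere b) \<partial>lborel)"
proof -
  have "(\<integral>\<^sup>+X. indicator upper_half X * ennreal (snd X powr b) * g X \<partial>lborel) =
    (\<integral>\<^sup>+t. indicator {0<..} t * ennreal (t ^ (DIM((real^'n) \<times> real) - 1)) *
      (\<integral>\<^sup>+\<theta>. indicator upper_half (t *\<^sub>R \<theta>) * ennreal (snd (t *\<^sub>R \<theta>) powr b) * g (t *\<^sub>R \<theta>) \<partial>sphere_measure 1) \<partial>lborel)"
    by (rule nn_integral_polar) measurable
  also have "\<dots> = (\<integral>\<^sup>+t. indicator {0<..} t * ennreal (t powr (real CARD('n) + b)) *
      (\<integral>\<^sup>+\<theta>. g (t *\<^sub>R \<theta>) \<partial>weighted_half_sphere b) \<partial>lborel)"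
  proof (rule nn_integral_cong)
    fix t :: real
    show "indicator {0<..} t * ennreal (t ^ (DIM((real^'n) \<times> real) - 1)) *
        (\<integral>\<^sup>+\<theta>. indicator upper_half (t *\<^sub>R \<theta>) * ennreal (snd (t *\<^sub>R \<theta>) powr b) * g (t *\<^sub>R \<theta>) \<partial>sphere_measure 1) =
      indicator {0<..} t * ennreal (t powr (real CARD('n) + b)) *
        (\<integral>\<^sup>+\<theta>. g (t *\<^sub>R \<theta>) \<partial>weighted_half_sphere b)"
    proof (cases "t > 0")
      case True
      have [measurable]: "(\<lambda>\<theta>. g (t *\<^sub>R \<theta>)) \<in> borel_measurable borel"
        by measurable
      have "(\<integral>\<^sup>+\<theta>. indicator upper_half (t *\<^sub>R \<theta>) * ennreal (snd (t *\<^sub>R \<theta>) powr b) * g (t *\<^sub>R \<theta>) \<partial>sphere_measure 1) =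
        (\<integral>\<^sup>+\<theta>. ennreal (t powr b) * (ennreal (snd \<theta> powr b) * (indicator upper_half \<theta> * g (t *\<^sub>R \<theta>))) \<partial>sphere_measure 1)"
        using True by (intro nn_integral_cong)
          (auto simp: indicator_upper_half_scaleR powr_mult upper_half_def zero_less_mult_iff ennreal_mult mult_ac
            split: split_indicator)
      also have "\<dots> = ennreal (t powr b) * (\<integral>\<^sup>+\<theta>. g (t *\<^sub>R \<theta>) \<partial>weighted_half_sphere b)"
        by (subst nn_integral_weighted_half_sphere) (auto intro!: nn_integral_cmult)
      finally show ?thesis
        using True by (simp add: powr_add powr_realpow ennreal_mult mult_ac)
    qed simp
  qed
  finally show ?thesis .
qed

text \<open>For signed functions the nonnegative formula is read as an equality of measures: the
  measure y^b dX on the half-space is the image, under multiplication of t and theta, of the product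
  of t^(n+b) dt and the weighted half-sphere. Integrability then passes to the product, and Fubini
  applies.\<close>

lemma integral_polar_upper_half:
  fixes f :: "(real^'n) \<times> real \<Rightarrow> real"
  assumes b: "-1 < b"
    and f [measurable]: "(\<lambda>X. indicator upper_half X * f X) \<in> borel_measurable borel"
    and int: "integrable lborel (\<lambda>X. indicator upper_half X * (snd X powr b * f X))"
  shows "(\<integral>X. indicator upper_half X * (snd X powr b * f X) \<partial>lborel) =
    (\<integral>t. indicator {0<..} t * (t powr (real CARD('n) + b) *
      (\<integral>\<theta>. f (t *\<^sub>R \<theta>) \<partial>weighted_half_sphere b)) \<partial>lborel)"
proof -
  let ?H = "weighted_half_sphere b :: ((real^'n) \<times> real) measure"
  let ?p = "\<lambda>t :: real. indicator {0<..} t * t powr (real CARD('n) + b)"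
  let ?P = "density lborel (\<lambda>t. ennreal (?p t))"
  let ?g = "\<lambda>X. indicator upper_half X * f X"
  let ?\<mu> = "density lborel (\<lambda>X :: (real^'n) \<times> real. ennreal (indicator upper_half X * snd X powr b))"
  interpret H: finite_measure ?H by (rule finite_weighted_half_sphere[OF b])
  have sP: "sigma_finite_measure ?P"
    by (subst sigma_finite_measure.sigma_finite_iff_density_finite[OF sigma_finite_lborel]) auto
  interpret PH: pair_sigma_finite ?P ?H
    by (intro pair_sigma_finite.intro sP) unfold_locales
  have id [measurable]: "(\<lambda>\<theta>. \<theta>) \<in> ?H \<rightarrow>\<^sub>M borel"
    by (simp add: measurable_cong_sets[OF sets_weighted_half_sphere refl] measurable_restrict_space1)
  have T [measurable]: "(\<lambda>(t, \<theta>). t *\<^sub>R \<theta>) \<in> ?P \<Otimes>\<^sub>M ?H \<rightarrow>\<^sub>M borel"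
    unfolding split_beta'
    by (intro borel_measurable_scaleR measurable_compose[OF measurable_fst] measurable_compose[OF measurable_snd] id) simp
  have eq: "distr (?P \<Otimes>\<^sub>M ?H) borel (\<lambda>(t, \<theta>). t *\<^sub>R \<theta>) = ?\<mu>"
  proof (rule measure_eqI)
    fix A :: "((real^'n) \<times> real) set"
    assume "A \<in> sets (distr (?P \<Otimes>\<^sub>M ?H) borel (\<lambda>(t, \<theta>). t *\<^sub>R \<theta>))"
    then have A [measurable]: "A \<in> sets borel" by simp
    have "emeasure (distr (?P \<Otimes>\<^sub>M ?H) borel (\<lambda>(t, \<theta>). t *\<^sub>R \<theta>)) A =
        (\<integral>\<^sup>+X. indicator A X \<partial>distr (?P \<Otimes>\<^sub>M ?H) borel (\<lambda>(t, \<theta>). t *\<^sub>R \<theta>))"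
      by simp
    also have "\<dots> = (\<integral>\<^sup>+x. indicator A (case x of (t, \<theta>) \<Rightarrow> t *\<^sub>R \<theta>) \<partial>(?P \<Otimes>\<^sub>M ?H))"
      by (rule nn_integral_distr[OF T]) (simp add: measurable_distr_eq1)
    also have "\<dots> = (\<integral>\<^sup>+t. \<integral>\<^sup>+\<theta>. indicator A (t *\<^sub>R \<theta>) \<partial>?H \<partial>?P)"
      by (subst H.nn_integral_fst[symmetric]) auto
    also have "\<dots> = (\<integral>\<^sup>+t. ennreal (?p t) * (\<integral>\<^sup>+\<theta>. indicator A (t *\<^sub>R \<theta>) \<partial>?H) \<partial>lborel)"
      by (rule nn_integral_density) measurable
    also have "\<dots> = (\<integral>\<^sup>+t. indicator {0<..} t * ennreal (t powr (real CARD('n) + b)) *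
      (\<integral>\<^sup>+\<theta>. indicator A (t *\<^sub>R \<theta>) \<partial>?H) \<partial>lborel)"
      by (rule nn_integral_cong) (simp split: split_indicator)
    also have "\<dots> = (\<integral>\<^sup>+X. indicator upper_half X * ennreal (snd X powr b) * indicator A X \<partial>lborel)"
      by (rule nn_integral_polar_upper_half[symmetric]) simp
    also have "\<dots> = (\<integral>\<^sup>+X. ennreal (indicator upper_half X * snd X powr b) * indicator A X \<partial>lborel)"
      by (rule nn_integral_cong) (simp split: split_indicator)
    also have "\<dots> = emeasure ?\<mu> A"
      by (simp add: emeasure_density)
    finally show "emeasure (distr (?P \<Otimes>\<^sub>M ?H) borel (\<lambda>(t, \<theta>). t *\<^sub>R \<theta>)) A = emeasure ?\<mu> A" .
  qed simp
  have w: "(indicator upper_half X * snd X powr b) *\<^sub>R ?g X = indicator upper_half X * (snd X powr b * f X)" for X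
    by (simp split: split_indicator)
  have int\<mu>: "integrable ?\<mu> ?g"
    by (subst integrable_density) (use int in \<open>simp_all only: w, auto\<close>)
  then have intPH: "integrable (?P \<Otimes>\<^sub>M ?H) (\<lambda>x. ?g (case x of (t, \<theta>) \<Rightarrow> t *\<^sub>R \<theta>))"
    unfolding eq[symmetric] by (subst (asm) integrable_distr_eq) auto
  have "(\<integral>X. indicator upper_half X * (snd X powr b * f X) \<partial>lborel) = (\<integral>X. ?g X \<partial>?\<mu>)"
    by (subst integral_density) (simp_all only: w, auto)
  also have "\<dots> = (\<integral>x. ?g (case x of (t, \<theta>) \<Rightarrow> t *\<^sub>R \<theta>) \<partial>(?P \<Otimes>\<^sub>M ?H))"
    unfolding eq[symmetric] by (rule integral_distr) measurable
  also have "\<dots> = (\<integral>t. (\<integral>\<theta>. ?g (t *\<^sub>R \<theta>) \<partial>?H) \<partial>?P)"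
    using PH.integral_fst'[OF intPH] by simp
  also have "\<dots> = (\<integral>t. ?p t * (\<integral>\<theta>. ?g (t *\<^sub>R \<theta>) \<partial>?H) \<partial>lborel)"
    by (subst integral_density) auto
  also have "\<dots> = (\<integral>t. indicator {0<..} t * (t powr (real CARD('n) + b) *
      (\<integral>\<theta>. f (t *\<^sub>R \<theta>) \<partial>?H)) \<partial>lborel)"
  proof (rule Bochner_Integration.integral_cong[OF refl])
    fix t :: real
    have "(\<integral>\<theta>. ?g (t *\<^sub>R \<theta>) \<partial>?H) = (\<integral>\<theta>. f (t *\<^sub>R \<theta>) \<partial>?H)" if "t > 0"
      using that by (intro Bochner_Integration.integral_cong)
        (auto simp: half_sphere_def indicator_upper_half_scaleR)
    then show "?p t * (\<integral>\<theta>. ?g (t *\<^sub>R \<theta>) \<partial>?H) =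
      indicator {0<..} t * (t powr (real CARD('n) + b) * (\<integral>\<theta>. f (t *\<^sub>R \<theta>) \<partial>?H))"
      by (simp split: split_indicator)
  qed
  finally show ?thesis .
qed

section \<open>Divergences of compactly supported fields\<close>

lemma integrable_continuous_bounded_support:
  fixes g :: "'a::euclidean_space \<Rightarrow> real"
  assumes "continuous_on UNIV g" "\<And>X. R < norm X \<Longrightarrow> g X = 0"
  shows "integrable lborel g"
proof -
  have "integrable lborel (\<lambda>X. indicator (cball 0 R) X *\<^sub>R g X)"
    using continuous_on_subset[OF assms(1)] by (intro borel_integrable_compact compact_cball) auto
  moreover have "(\<lambda>X. indicator (cball 0 R) X *\<^sub>R g X) = g"
    using assms(2) by (auto simp: fun_eq_iff indicator_def not_le)
  ultimately show ?thesis by simp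
qed

lemma integrable_indicator_cball:
  "integrable lborel (indicator (cball (c :: 'a::euclidean_space) r) :: 'a \<Rightarrow> real)"
  using emeasure_lborel_cball_finite[of c r] by (intro integrable_real_indicator) (auto intro: borel_closed)

lemma bounded_continuous_bounded_support:
  fixes g :: "'a::euclidean_space \<Rightarrow> real"
  assumes "continuous_on UNIV g" "\<And>X. R < norm X \<Longrightarrow> g X = 0"
  obtains C where "0 \<le> C" "\<And>X. \<bar>g X\<bar> \<le> C"
proof -
  have "bounded (g ` cball 0 R)"
    using assms(1) by (intro compact_imp_bounded compact_continuous_image compact_cball)
      (auto intro: continuous_on_subset)
  then obtain C where C: "\<forall>X\<in>cball 0 R. \<bar>g X\<bar> \<le> C"
    by (auto simp: bounded_iff)
  have "\<bar>g X\<bar> \<le> max C 0" for X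
    using C[rule_format, of X] assms(2)[of X] by (cases "norm X \<le> R") auto
  then show thesis by (intro that[of "max C 0"]) auto
qed

lemma integral_lborel_translation:
  fixes f :: "'a::euclidean_space \<Rightarrow> real"
  assumes "f \<in> borel_measurable borel"
  shows "(\<integral>X. f (v + X) \<partial>lborel) = (\<integral>X. f X \<partial>lborel)"
  using assms by (subst (2) lborel_distr_plus[of v, symmetric]) (simp add: integral_distr)

text \<open>By translation invariance the difference quotients integrate to zero.\<close>

lemma has_integral_directional_derivative:
  fixes f g :: "'a::euclidean_space \<Rightarrow> real"
  assumes f: "continuous_on UNIV f" and g: "continuous_on UNIV g"
    and d: "\<And>X. ((\<lambda>t. f (X + t *\<^sub>R e)) has_real_derivative g X) (at 0)"
    and supp: "\<And>X. R < norm X \<Longrightarrow> f X = 0"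
  shows "has_bochner_integral lborel g 0"
proof -
  have suppg: "g X = 0" if "R < norm X" for X
  proof -
    have op: "open {t. R < norm (X + t *\<^sub>R e)}"
      by (intro open_Collect_less continuous_intros)
    have "((\<lambda>t. f (X + t *\<^sub>R e)) has_real_derivative 0) (at 0)"
      by (rule has_field_derivative_transform_within_open[OF DERIV_const op]) (use that in \<open>simp_all add: supp\<close>)
    then show ?thesis using DERIV_unique[OF d] by blast
  qed
  have dt: "((\<lambda>t. f (X + t *\<^sub>R e)) has_real_derivative g (X + t *\<^sub>R e)) (at t)" for X t
    using d[of "X + t *\<^sub>R e"] DERIV_shift[of "\<lambda>t. f (X + t *\<^sub>R e)" "g (X + t *\<^sub>R e)" 0 t]
    by (simp add: algebra_simps)
  obtain C where C: "0 \<le> C" "\<And>X. \<bar>g X\<bar> \<le> C"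
    using bounded_continuous_bounded_support[OF g suppg] by blast
  define q where "q = (\<lambda>k X. real (Suc k) * (f ((1 / real (Suc k)) *\<^sub>R e + X) - f X))"
  have fint: "integrable lborel f"
    by (rule integrable_continuous_bounded_support[OF f supp])
  have fm: "f \<in> borel_measurable borel"
    using f by (rule borel_measurable_continuous_onI)
  have far: "R < norm (v + X)" if "R + norm v < norm X" for v X :: 'a
    using norm_diff_ineq[of X v] that by (simp add: add.commute)
  have fint': "integrable lborel (\<lambda>X. f (v + X))" for v
    by (rule integrable_continuous_bounded_support[of _ "R + norm v"])
      (auto intro!: continuous_on_compose2[OF f] continuous_intros supp far)
  have q0: "(\<integral>X. q k X \<partial>lborel) = 0" for k
    by (simp add: q_def fint fint' integral_lborel_translation[OF fm])
  have qlim: "(\<lambda>k. q k X) \<longlonglongrightarrow> g X" for X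
  proof -
    have "((\<lambda>h. (f (X + (0 + h) *\<^sub>R e) - f (X + 0 *\<^sub>R e)) / h) \<longlongrightarrow> g X) (at 0)"
      using d[of X] unfolding DERIV_def .
    moreover have "filterlim (\<lambda>k. 1 / real (Suc k)) (at 0) sequentially"
      by (intro filterlim_atI) (use LIMSEQ_inverse_real_of_nat in \<open>simp_all add: divide_inverse\<close>)
    ultimately have "(\<lambda>k. (f (X + (0 + 1 / real (Suc k)) *\<^sub>R e) - f (X + 0 *\<^sub>R e)) / (1 / real (Suc k))) \<longlonglongrightarrow> g X"
      by (rule filterlim_compose)
    then show ?thesis by (simp add: q_def mult.commute add.commute)
  qed
  have qbound: "norm (q k X) \<le> indicator (cball 0 (R + norm e)) X * C" for k X
  proof (cases "norm X \<le> R + norm e")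
    case True
    \<comment> \<open>By the mean value theorem the quotient is a value of \<open>g\<close>, so the
      bound on \<open>g\<close> dominates all quotients at once.\<close>
    have "\<exists>z. 0 < z \<and> z < 1 / real (Suc k) \<and>
      f (X + (1 / real (Suc k)) *\<^sub>R e) - f (X + 0 *\<^sub>R e) = (1 / real (Suc k) - 0) * g (X + z *\<^sub>R e)"
      by (rule MVT2) (auto intro: dt)
    then obtain z where "f (X + (1 / real (Suc k)) *\<^sub>R e) - f X = 1 / real (Suc k) * g (X + z *\<^sub>R e)"
      by auto
    then have "q k X = g (X + z *\<^sub>R e)"
      by (simp add: q_def add.commute)
    then show ?thesis using C(2)[of "X + z *\<^sub>R e"] True by simp
  next
    case False
    have "norm ((1 / real (Suc k)) *\<^sub>R e) \<le> norm e"
      by (simp add: divide_le_eq algebra_simps)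
    then have "R < norm ((1 / real (Suc k)) *\<^sub>R e + X)"
      using False by (intro far) linarith
    moreover have "R < norm X" using False norm_ge_zero[of e] by linarith
    ultimately show ?thesis using C(1) by (simp add: q_def supp)
  qed
  have gm: "g \<in> borel_measurable borel"
    using g by (rule borel_measurable_continuous_onI)
  have qm: "q k \<in> borel_measurable borel" for k
    unfolding q_def using fint fint' by (intro borel_measurable_times borel_measurable_diff) auto
  have "(\<lambda>k. \<integral>X. q k X \<partial>lborel) \<longlonglongrightarrow> (\<integral>X. g X \<partial>lborel)"
  proof (rule integral_dominated_convergence[where w = "\<lambda>X. indicator (cball 0 (R + norm e)) X * C"])
    show "integrable lborel (\<lambda>X :: 'a. indicator (cball 0 (R + norm e)) X * C)"
      by (intro integrable_mult_left integrable_indicator_cball)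
  qed (use gm qm qlim qbound in auto)
  then have "(\<integral>X. g X \<partial>lborel) = 0"
    using q0 LIMSEQ_unique[OF _ tendsto_const] by simp
  then show ?thesis
    using integrable_continuous_bounded_support[OF g suppg] by (simp add: has_bochner_integral_iff)
qed

text \<open>A \<open>C\<^sup>1\<close> function rising from 0 on \<open>{..0}\<close> to 1 on \<open>{1..}\<close>.\<close>

definition ramp :: "real \<Rightarrow> real" where
  "ramp z = 2 * ((max 0 z)\<^sup>2 - 2 * (max 0 (z - 1 / 2))\<^sup>2 + (max 0 (z - 1))\<^sup>2)"

text \<open>The hat function on [0, 1] with peak 2 at 1/2, hence of integral 1; rescaled, it is an
  approximate identity.\<close>

definition ramp' :: "real \<Rightarrow> real" where
  "ramp' z = 4 * (max 0 z - 2 * max 0 (z - 1 / 2) + max 0 (z - 1))"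

text \<open>At the kink the difference quotient is at most |h|. Truncated squares are therefore
  continuously differentiable, which is why \<open>ramp\<close> is built from them.\<close>

lemma DERIV_max_square: "((\<lambda>z::real. (max 0 (z - c))\<^sup>2) has_real_derivative 2 * max 0 (z - c)) (at z)"
proof -
  consider "z < c" | "c < z" | "z = c" by linarith
  then show ?thesis
  proof cases
    case 1
    have "((\<lambda>z. 0) has_real_derivative 2 * max 0 (z - c)) (at z)"
      using 1 by simp
    then show ?thesis
      by (rule has_field_derivative_transform_within_open[of _ _ z "{..<c}"]) (use 1 in auto)
  next
    case 2
    have "((\<lambda>z. (z - c)\<^sup>2) has_real_derivative 2 * max 0 (z - c)) (at z)"
      using 2 by (auto intro!: derivative_eq_intros)
    then show ?thesis
      by (rule has_field_derivative_transform_within_open[of _ _ z "{c<..}"]) (use 2 in auto)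
  next
    case 3
    have "((\<lambda>h. (max 0 h)\<^sup>2 / h) \<longlongrightarrow> 0) (at (0::real))"
    proof (rule Lim_null_comparison[where g = "\<lambda>h. \<bar>h\<bar>"])
      show "\<forall>\<^sub>F h in at (0::real). norm ((max 0 h)\<^sup>2 / h) \<le> \<bar>h\<bar>"
        by (rule eventuallyI) (auto simp: max_def power2_eq_square)
      show "((\<lambda>h. \<bar>h\<bar>) \<longlongrightarrow> 0) (at (0::real))"
        by (rule tendsto_rabs_zero) (rule tendsto_ident_at)
    qed
    with 3 show ?thesis by (simp add: DERIV_def)
  qed
qed

lemma DERIV_ramp: "(ramp has_real_derivative ramp' z) (at z)"
  unfolding ramp_def[abs_def] ramp'_def
  using DERIV_cmult[OF DERIV_add[OF DERIV_diff[OF DERIV_max_square[of 0 z]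
        DERIV_cmult[OF DERIV_max_square[of "1 / 2" z], of 2]] DERIV_max_square[of 1 z]], of 2]
  by (simp add: algebra_simps)

lemma continuous_on_ramp': "continuous_on S ramp'"
  unfolding ramp'_def[abs_def] by (intro continuous_intros)

lemma continuous_on_ramp: "continuous_on S ramp"
  unfolding ramp_def[abs_def] by (intro continuous_intros)

lemma ramp_eq_0: "z \<le> 0 \<Longrightarrow> ramp z = 0"
  by (simp add: ramp_def)

lemma ramp_eq_1: "1 \<le> z \<Longrightarrow> ramp z = 1"
  by (simp add: ramp_def max_def power2_eq_square algebra_simps)

lemma ramp'_nonneg: "0 \<le> ramp' z"
  by (auto simp: ramp'_def max_def)

lemma ramp'_le: "ramp' z \<le> 2 * indicator {0..1} z"
  by (auto simp: ramp'_def max_def indicator_def)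

lemma ramp'_eq_0: "z \<notin> {0<..<1} \<Longrightarrow> ramp' z = 0"
  by (auto simp: ramp'_def max_def)

lemma mono_ramp: "mono ramp"
  using DERIV_nonneg_imp_nondecreasing[of _ _ ramp] DERIV_ramp ramp'_nonneg by (metis monoI)

lemma ramp_nonneg: "0 \<le> ramp z"
  using monoD[OF mono_ramp, of "min z 0" z] by (simp add: ramp_eq_0)

lemma ramp_le_1: "ramp z \<le> 1"
  using monoD[OF mono_ramp, of z "max z 1"] by (simp add: ramp_eq_1)

lemma ramp'_borel [measurable]: "ramp' \<in> borel_measurable borel"
  by (intro borel_measurable_continuous_onI continuous_on_ramp')

lemma ramp_borel [measurable]: "ramp \<in> borel_measurable borel"
  by (intro borel_measurable_continuous_onI continuous_on_ramp)

lemma integral_ramp': "(\<integral>z. ramp' z \<partial>lborel) = 1"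
proof -
  have "(\<integral>z. ramp' z * indicator {0..1} z \<partial>lborel) = ramp 1 - ramp 0"
    by (rule integral_FTC_Icc_real)
      (use DERIV_ramp continuous_on_ramp'[of UNIV] in \<open>auto simp: continuous_on_eq_continuous_at\<close>)
  moreover have "ramp' z * indicator {0..1} z = ramp' z" for z
    by (cases "z \<in> {0<..<1}") (auto simp: ramp'_eq_0)
  ultimately show ?thesis by (simp add: ramp_eq_0 ramp_eq_1)
qed

text \<open>The substitution z = \<kappa> (t - r) turns the kernel into a fixed probability density.
  Limit and bound are asked for z in (0, 1) only, where \<open>ramp'\<close> is nonzero, and the
  starting points \<open>r k\<close> may move with \<open>k\<close>.\<close>

lemma ramp_kernel:
  fixes B :: "real \<Rightarrow> real"
  assumes [measurable]: "B \<in> borel_measurable borel"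
    and \<kappa>: "\<And>k. 0 < \<kappa> k"
    and lim: "\<And>z. z \<in> {0<..<1} \<Longrightarrow> (\<lambda>k. B (r k + z / \<kappa> k)) \<longlonglongrightarrow> L"
    and bound: "\<And>z k. z \<in> {0<..<1} \<Longrightarrow> \<bar>B (r k + z / \<kappa> k)\<bar> \<le> C"
  shows "(\<lambda>k. \<integral>t. \<kappa> k * ramp' (\<kappa> k * (t - r k)) * B t \<partial>lborel) \<longlonglongrightarrow> L"
proof -
  have eq: "(\<integral>t. \<kappa> k * ramp' (\<kappa> k * (t - r k)) * B t \<partial>lborel) =
      (\<integral>z. ramp' z * B (r k + z / \<kappa> k) \<partial>lborel)" for k
    using \<kappa>[of k] by (subst lborel_integral_real_affine[where c="1 / \<kappa> k" and t="r k"]) (auto simp: mult.assoc)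
  have "(\<lambda>k. \<integral>z. ramp' z * B (r k + z / \<kappa> k) \<partial>lborel) \<longlonglongrightarrow> (\<integral>z. ramp' z * L \<partial>lborel)"
  proof (rule integral_dominated_convergence[where w = "\<lambda>z. 2 * \<bar>C\<bar> * indicator {0..1} z"])
    show "AE z in lborel. (\<lambda>k. ramp' z * B (r k + z / \<kappa> k)) \<longlonglongrightarrow> ramp' z * L"
    proof (rule AE_I2)
      fix z
      show "(\<lambda>k. ramp' z * B (r k + z / \<kappa> k)) \<longlonglongrightarrow> ramp' z * L"
        by (cases "z \<in> {0<..<1}") (auto intro!: tendsto_mult tendsto_const lim simp: ramp'_eq_0)
    qed
    show "AE z in lborel. norm (ramp' z * B (r k + z / \<kappa> k)) \<le> 2 * \<bar>C\<bar> * indicator {0..1} z" for k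
    proof (rule AE_I2)
      fix z
      show "norm (ramp' z * B (r k + z / \<kappa> k)) \<le> 2 * \<bar>C\<bar> * indicator {0..1} z"
      proof (cases "z \<in> {0<..<1}")
        case True
        have "\<bar>ramp' z\<bar> * \<bar>B (r k + z / \<kappa> k)\<bar> \<le> (2 * indicator {0..1} z) * \<bar>C\<bar>"
          using ramp'_nonneg[of z] ramp'_le[of z] bound[OF True, of k] by (intro mult_mono) auto
        then show ?thesis by (simp add: abs_mult mult_ac)
      qed (simp add: ramp'_eq_0)
    qed
  qed auto
  then show ?thesis by (simp add: eq integral_ramp')
qed

section \<open>Parameter integrals\<close>

text \<open>Families of functions on a finite measure space inside a compact set, depending on a parameter
  \<open>t > 0\<close> and extending continuously to the compact set. Such families need not be defined
  sensibly outside the space of the measure.\<close>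

locale param_measure = finite_measure M for M :: "'a::euclidean_space measure" +
  fixes K :: "'a set"
  assumes compact_K: "compact K" and space_subset: "space M \<subseteq> K"
    and sets_eq: "sets M = sets (restrict_space borel (space M))"
begin

definition adm :: "(real \<Rightarrow> 'a \<Rightarrow> real) \<Rightarrow> bool" where
  "adm f \<longleftrightarrow> (\<exists>g. continuous_on ({0<..} \<times> K) g \<and> (\<forall>t>0. \<forall>\<theta>\<in>space M. f t \<theta> = g (t, \<theta>)))"

lemma admI:
  assumes "continuous_on ({0<..} \<times> K) g" "\<And>t \<theta>. 0 < t \<Longrightarrow> \<theta> \<in> space M \<Longrightarrow> f t \<theta> = g (t, \<theta>)"
  shows "adm f"
  using assms by (auto simp: adm_def)

lemma adm_bound:
  assumes "adm f" "0 < r1"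
  shows "\<exists>C\<ge>0. \<forall>t\<in>{r1..r2}. \<forall>\<theta>\<in>space M. \<bar>f t \<theta>\<bar> \<le> C"
proof -
  obtain g where g: "continuous_on ({0<..} \<times> K) g" "\<forall>t>0. \<forall>\<theta>\<in>space M. f t \<theta> = g (t, \<theta>)"
    using assms(1) by (auto simp: adm_def)
  have "compact (g ` ({r1..r2} \<times> K))"
    using assms(2) by (intro compact_continuous_image compact_Times compact_K compact_Icc
        continuous_on_subset[OF g(1)]) auto
  then obtain C where C: "\<forall>x\<in>{r1..r2} \<times> K. \<bar>g x\<bar> \<le> C"
    using compact_imp_bounded by (fastforce simp: bounded_iff)
  show ?thesis
  proof (intro exI[of _ "max C 0"] conjI ballI)
    fix t \<theta> assume *: "t \<in> {r1..r2}" "\<theta> \<in> space M"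
    then have "(t, \<theta>) \<in> {r1..r2} \<times> K" using space_subset by blast
    then have "\<bar>g (t, \<theta>)\<bar> \<le> C" using C by blast
    moreover have "f t \<theta> = g (t, \<theta>)" using * g(2) assms(2) by simp
    ultimately show "\<bar>f t \<theta>\<bar> \<le> max C 0" by (metis max.coboundedI1)
  qed simp
qed

lemma adm_measurable:
  assumes "adm f" "0 < t"
  shows "f t \<in> borel_measurable M"
proof -
  obtain g where g: "continuous_on ({0<..} \<times> K) g" "\<forall>t>0. \<forall>\<theta>\<in>space M. f t \<theta> = g (t, \<theta>)"
    using assms(1) by (auto simp: adm_def)
  have "continuous_on (space M) (\<lambda>\<theta>. g (t, \<theta>))"
    using assms(2) space_subset by (intro continuous_on_compose2[OF g(1)] continuous_intros) auto
  then have "(\<lambda>\<theta>. g (t, \<theta>)) \<in> borel_measurable (restrict_space borel (space M))"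
    by (rule borel_measurable_continuous_on_restrict)
  then have "(\<lambda>\<theta>. g (t, \<theta>)) \<in> borel_measurable M"
    using measurable_cong_sets[OF sets_eq refl] by blast
  then show ?thesis
    using g(2) assms(2) by (subst measurable_cong[of M "f t" "\<lambda>\<theta>. g (t, \<theta>)"]) auto
qed

lemma adm_integrable:
  assumes "adm f" "0 < t"
  shows "integrable M (f t)"
proof -
  obtain C where C: "0 \<le> C" "\<forall>s\<in>{t..t}. \<forall>\<theta>\<in>space M. \<bar>f s \<theta>\<bar> \<le> C"
    using adm_bound[OF assms, of t] by blast
  then show ?thesis
    by (intro integrable_const_bound[of _ C] adm_measurable assms) (use C(2) in auto)
qed

lemma adm_tendsto:
  assumes "adm f" "0 < t" "\<theta> \<in> space M"
  shows "((\<lambda>s. f s \<theta>) \<longlongrightarrow> f t \<theta>) (at t)"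
proof -
  obtain g where g: "continuous_on ({0<..} \<times> K) g" "\<forall>t>0. \<forall>\<theta>\<in>space M. f t \<theta> = g (t, \<theta>)"
    using assms(1) by (auto simp: adm_def)
  have "continuous_on {0<..} (\<lambda>s. g (s, \<theta>))"
    using assms(3) space_subset by (intro continuous_on_compose2[OF g(1)] continuous_intros) auto
  then have "((\<lambda>s. g (s, \<theta>)) \<longlongrightarrow> g (t, \<theta>)) (at t)"
    using assms(2) unfolding continuous_on_def by (metis at_within_open greaterThan_iff open_greaterThan)
  moreover have "\<forall>\<^sub>F s in at t. g (s, \<theta>) = f s \<theta>"
    using g(2) assms
    by (intro eventually_at_in_open'[of "{0<..}" t, THEN eventually_mono]) auto
  ultimately show ?thesis
    using g(2) assms by (auto intro: Lim_transform_eventually)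
qed

text \<open>Dominated convergence along sequences tending to t. The bound is asked near t but not at
  t itself, so that difference quotients are covered.\<close>

lemma tendsto_integral:
  fixes F :: "real \<Rightarrow> 'a \<Rightarrow> real"
  assumes F: "\<And>s. 0 < s \<Longrightarrow> F s \<in> borel_measurable M" and G: "G \<in> borel_measurable M" and t: "0 < t"
    and lim: "\<And>\<theta>. \<theta> \<in> space M \<Longrightarrow> ((\<lambda>s. F s \<theta>) \<longlongrightarrow> G \<theta>) (at t)"
    and bound: "\<And>s \<theta>. s \<in> {t / 2..2 * t} \<Longrightarrow> s \<noteq> t \<Longrightarrow> \<theta> \<in> space M \<Longrightarrow> \<bar>F s \<theta>\<bar> \<le> C"
  shows "((\<lambda>s. \<integral>\<theta>. F s \<theta> \<partial>M) \<longlongrightarrow> (\<integral>\<theta>. G \<theta> \<partial>M)) (at t)"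
  unfolding tendsto_at_iff_sequentially
proof (intro allI impI)
  fix X :: "nat \<Rightarrow> real"
  assume X: "\<forall>i. X i \<in> UNIV - {t}" "X \<longlonglongrightarrow> t"
  have "\<forall>\<^sub>F n in sequentially. X n \<in> {t / 2<..<2 * t}"
    using X(2) t by (intro topological_tendstoD) auto
  then obtain N where N': "\<forall>n\<ge>N. X n \<in> {t / 2<..<2 * t}"
    unfolding eventually_sequentially by blast
  then have N: "X (n + N) \<in> {t / 2<..<2 * t}" for n
    by simp
  have "(\<lambda>n. \<integral>\<theta>. F (X (n + N)) \<theta> \<partial>M) \<longlonglongrightarrow> (\<integral>\<theta>. G \<theta> \<partial>M)"
  proof (rule integral_dominated_convergence[where w = "\<lambda>_. C"])
    show "F (X (n + N)) \<in> borel_measurable M" for n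
      using N[of n] t by (intro F) auto
    show "AE \<theta> in M. norm (F (X (n + N)) \<theta>) \<le> C" for n
      using N[of n] X(1) by (intro AE_I2) (auto intro!: bound)
    show "AE \<theta> in M. (\<lambda>n. F (X (n + N)) \<theta>) \<longlonglongrightarrow> G \<theta>"
    proof (rule AE_I2)
      fix \<theta> assume "\<theta> \<in> space M"
      then have "(\<lambda>n. F (X n) \<theta>) \<longlonglongrightarrow> G \<theta>"
        using lim X unfolding tendsto_at_iff_sequentially comp_def by blast
      then show "(\<lambda>n. F (X (n + N)) \<theta>) \<longlonglongrightarrow> G \<theta>"
        by (rule LIMSEQ_ignore_initial_segment)
    qed
  qed (use G in auto)
  then show "((\<lambda>s. \<integral>\<theta>. F s \<theta> \<partial>M) \<circ> X) \<longlonglongrightarrow> (\<integral>\<theta>. G \<theta> \<partial>M)"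
    unfolding comp_def by (rule LIMSEQ_offset)
qed

lemma isCont_integral:
  assumes "adm f" "0 < t"
  shows "isCont (\<lambda>s. \<integral>\<theta>. f s \<theta> \<partial>M) t"
proof -
  obtain C where "0 \<le> C" "\<forall>s\<in>{t / 2..2 * t}. \<forall>\<theta>\<in>space M. \<bar>f s \<theta>\<bar> \<le> C"
    using adm_bound[OF assms(1) half_gt_zero[OF assms(2)], of "2 * t"] by blast
  then show ?thesis
    unfolding isCont_def
    by (intro tendsto_integral[where C=C] adm_measurable adm_tendsto assms) auto
qed

lemma adm_const: "adm (\<lambda>t \<theta>. c)"
  by (rule admI[of "\<lambda>_. c"]) auto

lemma adm_fst: "continuous_on {0<..} h \<Longrightarrow> adm (\<lambda>t \<theta>. h t)"
  by (rule admI[of "\<lambda>x. h (fst x)"]) (auto intro!: continuous_on_compose2[of "{0<..}" h] continuous_intros)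

lemma adm_id: "adm (\<lambda>t \<theta>. t)"
  by (intro adm_fst continuous_intros)

lemma adm_powr: "adm (\<lambda>t \<theta>. t powr \<beta>)"
  by (intro adm_fst continuous_intros) auto

lemma adm_snd: "continuous_on K h \<Longrightarrow> adm (\<lambda>t \<theta>. h \<theta>)"
  by (rule admI[of "\<lambda>x. h (snd x)"]) (auto intro!: continuous_on_compose2[of K h] continuous_intros)

lemma adm_add: "adm f \<Longrightarrow> adm g \<Longrightarrow> adm (\<lambda>t \<theta>. f t \<theta> + g t \<theta>)"
  unfolding adm_def
proof (elim exE conjE)
  fix F G assume "continuous_on ({0<..} \<times> K) F" "continuous_on ({0<..} \<times> K) G"
    "\<forall>t>0. \<forall>\<theta>\<in>space M. f t \<theta> = F (t, \<theta>)" "\<forall>t>0. \<forall>\<theta>\<in>space M. g t \<theta> = G (t, \<theta>)"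
  then show "\<exists>H. continuous_on ({0<..} \<times> K) H \<and> (\<forall>t>0. \<forall>\<theta>\<in>space M. f t \<theta> + g t \<theta> = H (t, \<theta>))"
    by (intro exI[of _ "\<lambda>x. F x + G x"]) (auto intro: continuous_intros)
qed

lemma adm_mult: "adm f \<Longrightarrow> adm g \<Longrightarrow> adm (\<lambda>t \<theta>. f t \<theta> * g t \<theta>)"
  unfolding adm_def
proof (elim exE conjE)
  fix F G assume "continuous_on ({0<..} \<times> K) F" "continuous_on ({0<..} \<times> K) G"
    "\<forall>t>0. \<forall>\<theta>\<in>space M. f t \<theta> = F (t, \<theta>)" "\<forall>t>0. \<forall>\<theta>\<in>space M. g t \<theta> = G (t, \<theta>)"
  then show "\<exists>H. continuous_on ({0<..} \<times> K) H \<and> (\<forall>t>0. \<forall>\<theta>\<in>space M. f t \<theta> * g t \<theta> = H (t, \<theta>))"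
    by (intro exI[of _ "\<lambda>x. F x * G x"]) (auto intro: continuous_intros)
qed

lemma adm_diff: "adm f \<Longrightarrow> adm g \<Longrightarrow> adm (\<lambda>t \<theta>. f t \<theta> - g t \<theta>)"
  using adm_add[of f "\<lambda>t \<theta>. - 1 * g t \<theta>"] adm_mult[OF adm_const[of "- 1"], of g] by simp

lemma adm_uminus: "adm f \<Longrightarrow> adm (\<lambda>t \<theta>. - f t \<theta>)"
  using adm_mult[OF adm_const[of "- 1"], of f] by simp

lemma adm_power: "adm f \<Longrightarrow> adm (\<lambda>t \<theta>. f t \<theta> ^ k)"
  by (induction k) (auto intro: adm_const adm_mult)

lemma adm_sum: "finite I \<Longrightarrow> (\<And>i. i \<in> I \<Longrightarrow> adm (f i)) \<Longrightarrow> adm (\<lambda>t \<theta>. \<Sum>i\<in>I. f i t \<theta>)"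
  by (induction I rule: finite_induct) (auto intro: adm_const adm_add)

text \<open>Freezing one parameter makes products of two families with independent parameters
  admissible in the other one; all two-parameter identities below rely on this.\<close>

lemma adm_freeze:
  assumes "adm f" "0 < c"
  shows "adm (\<lambda>t. f c)"
proof -
  obtain g where g: "continuous_on ({0<..} \<times> K) g" "\<forall>t>0. \<forall>\<theta>\<in>space M. f t \<theta> = g (t, \<theta>)"
    using assms(1) by (auto simp: adm_def)
  then show ?thesis
    using assms(2) by (intro admI[of "\<lambda>x. g (c, snd x)"])
      (auto intro!: continuous_on_compose2[OF g(1)] continuous_intros)
qed

lemma adm_dilate:
  assumes "adm f" "0 < c"
  shows "adm (\<lambda>t. f (c * t))"
proof -
  obtain g where g: "continuous_on ({0<..} \<times> K) g" "\<forall>t>0. \<forall>\<theta>\<in>space M. f t \<theta> = g (t, \<theta>)"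
    using assms(1) by (auto simp: adm_def)
  then show ?thesis
    using assms(2) by (intro admI[of "\<lambda>x. g (c * fst x, snd x)"])
      (auto intro!: continuous_on_compose2[OF g(1)] continuous_intros)
qed

lemmas adm_intros = adm_const adm_id adm_powr adm_add adm_mult adm_diff adm_uminus adm_power adm_sum

section \<open>Differentiation under the integral sign\<close>

definition adm_deriv :: "(real \<Rightarrow> 'a \<Rightarrow> real) \<Rightarrow> (real \<Rightarrow> 'a \<Rightarrow> real) \<Rightarrow> bool" where
  "adm_deriv f f' \<longleftrightarrow> adm f \<and> adm f' \<and>
     (\<forall>t>0. \<forall>\<theta>\<in>space M. ((\<lambda>t. f t \<theta>) has_real_derivative f' t \<theta>) (at t))"

lemma adm_derivD:
  assumes "adm_deriv f f'"
  shows "adm f" "adm f'"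
    "0 < t \<Longrightarrow> \<theta> \<in> space M \<Longrightarrow> ((\<lambda>t. f t \<theta>) has_real_derivative f' t \<theta>) (at t)"
  using assms by (auto simp: adm_deriv_def)

text \<open>The mean value theorem bounds the quotient by the supremum of \<open>c'\<close> near t.
  The factor \<open>a\<close> may move together with \<open>s\<close>; this serves the derivative of
  a symmetric two-parameter form along its diagonal.\<close>

lemma integral_diff_quotient:
  assumes a: "adm a" and c: "adm_deriv c c'" and t: "0 < t"
  shows "((\<lambda>s. \<integral>\<theta>. a s \<theta> * ((c s \<theta> - c t \<theta>) / (s - t)) \<partial>M) \<longlongrightarrow> (\<integral>\<theta>. a t \<theta> * c' t \<theta> \<partial>M)) (at t)"
proof -
  note c = adm_derivD[OF c]
  obtain A where A: "0 \<le> A" "\<forall>s\<in>{t / 2..2 * t}. \<forall>\<theta>\<in>space M. \<bar>a s \<theta>\<bar> \<le> A"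
    using adm_bound[OF a half_gt_zero[OF t], of "2 * t"] by blast
  obtain C where C: "0 \<le> C" "\<forall>s\<in>{t / 2..2 * t}. \<forall>\<theta>\<in>space M. \<bar>c' s \<theta>\<bar> \<le> C"
    using adm_bound[OF c(2) half_gt_zero[OF t], of "2 * t"] by blast
  show ?thesis
  proof (rule tendsto_integral[where C = "A * C"])
    show "(\<lambda>\<theta>. a s \<theta> * ((c s \<theta> - c t \<theta>) / (s - t))) \<in> borel_measurable M" if "0 < s" for s
      using adm_measurable[OF a that] adm_measurable[OF c(1) that] adm_measurable[OF c(1) t] by measurable
    show "(\<lambda>\<theta>. a t \<theta> * c' t \<theta>) \<in> borel_measurable M"
      using adm_measurable[OF a t] adm_measurable[OF c(2) t] by measurable
    show "((\<lambda>s. a s \<theta> * ((c s \<theta> - c t \<theta>) / (s - t))) \<longlongrightarrow> a t \<theta> * c' t \<theta>) (at t)" if "\<theta> \<in> space M" for \<theta>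
      using c(3)[OF t that] by (intro tendsto_mult adm_tendsto a t that) (simp add: has_field_derivative_iff)
    show "\<bar>a s \<theta> * ((c s \<theta> - c t \<theta>) / (s - t))\<bar> \<le> A * C"
      if s: "s \<in> {t / 2..2 * t}" "s \<noteq> t" and \<theta>: "\<theta> \<in> space M" for s \<theta>
    proof -
      have "norm (c s \<theta> - c t \<theta>) \<le> C * norm (s - t)"
      proof (rule field_differentiable_bound[of "{t / 2..2 * t}" "\<lambda>s. c s \<theta>" "\<lambda>s. c' s \<theta>"])
        show "((\<lambda>s. c s \<theta>) has_field_derivative c' z \<theta>) (at z within {t / 2..2 * t})"
          if "z \<in> {t / 2..2 * t}" for z
          using that t c(3)[OF _ \<theta>, of z] by (auto intro: DERIV_subset)
      qed (use C(2) \<theta> s t in auto)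
      then have "\<bar>(c s \<theta> - c t \<theta>) / (s - t)\<bar> \<le> C"
        using s(2) by (simp add: abs_divide divide_le_eq)
      then show ?thesis
        using A(2)[rule_format, OF s(1) \<theta>] A(1) by (simp only: abs_mult) (intro mult_mono; simp)
    qed
  qed (rule t)
qed

lemma has_real_derivative_integral:
  assumes c: "adm_deriv c c'" and t: "0 < t"
  shows "((\<lambda>s. \<integral>\<theta>. c s \<theta> \<partial>M) has_real_derivative (\<integral>\<theta>. c' t \<theta> \<partial>M)) (at t)"
proof -
  have "((\<lambda>s. \<integral>\<theta>. 1 * ((c s \<theta> - c t \<theta>) / (s - t)) \<partial>M) \<longlongrightarrow> (\<integral>\<theta>. 1 * c' t \<theta> \<partial>M)) (at t)"
    by (rule integral_diff_quotient[OF adm_const c t])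
  moreover have "\<forall>\<^sub>F s in at t. (\<integral>\<theta>. 1 * ((c s \<theta> - c t \<theta>) / (s - t)) \<partial>M) =
      ((\<integral>\<theta>. c s \<theta> \<partial>M) - (\<integral>\<theta>. c t \<theta> \<partial>M)) / (s - t)"
    using eventually_at_in_open'[of "{0<..}" t]
  proof (rule eventually_mono)
    fix s :: real assume "s \<in> {0<..}"
    then show "(\<integral>\<theta>. 1 * ((c s \<theta> - c t \<theta>) / (s - t)) \<partial>M) =
      ((\<integral>\<theta>. c s \<theta> \<partial>M) - (\<integral>\<theta>. c t \<theta> \<partial>M)) / (s - t)"
      using adm_integrable[OF adm_derivD(1)[OF c]] t by simp
  qed (use t in auto)
  ultimately show ?thesis
    unfolding has_field_derivative_iff by (auto elim: Lim_transform_eventually)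
qed

lemma adm_deriv_add: "adm_deriv f f' \<Longrightarrow> adm_deriv g g' \<Longrightarrow> adm_deriv (\<lambda>t \<theta>. f t \<theta> + g t \<theta>) (\<lambda>t \<theta>. f' t \<theta> + g' t \<theta>)"
  by (auto simp: adm_deriv_def intro: adm_add intro!: derivative_eq_intros)

lemma adm_deriv_diff: "adm_deriv f f' \<Longrightarrow> adm_deriv g g' \<Longrightarrow> adm_deriv (\<lambda>t \<theta>. f t \<theta> - g t \<theta>) (\<lambda>t \<theta>. f' t \<theta> - g' t \<theta>)"
  by (auto simp: adm_deriv_def intro: adm_diff intro!: derivative_eq_intros)

lemma adm_deriv_mult: "adm_deriv f f' \<Longrightarrow> adm_deriv g g' \<Longrightarrow>
    adm_deriv (\<lambda>t \<theta>. f t \<theta> * g t \<theta>) (\<lambda>t \<theta>. f' t \<theta> * g t \<theta> + f t \<theta> * g' t \<theta>)"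
  by (auto simp: adm_deriv_def intro: adm_mult adm_add intro!: derivative_eq_intros)

lemma adm_deriv_const: "adm f \<Longrightarrow> 0 < c \<Longrightarrow> adm_deriv (\<lambda>t. f c) (\<lambda>t \<theta>. 0)"
  by (auto simp: adm_deriv_def intro: adm_const adm_freeze)

lemma adm_deriv_fst:
  assumes "\<And>t. 0 < t \<Longrightarrow> (h has_real_derivative h' t) (at t)" "continuous_on {0<..} h'"
  shows "adm_deriv (\<lambda>t \<theta>. h t) (\<lambda>t \<theta>. h' t)"
proof -
  have "continuous_on {0<..} h"
    using assms(1) by (intro continuous_at_imp_continuous_on) (auto intro: DERIV_isCont)
  then show ?thesis
    using assms by (simp add: adm_deriv_def adm_fst)
qed

lemma adm_deriv_cmult:
  assumes "adm_deriv f f'"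
  shows "adm_deriv (\<lambda>t \<theta>. k * f t \<theta>) (\<lambda>t \<theta>. k * f' t \<theta>)"
  using adm_deriv_mult[OF adm_deriv_fst[of "\<lambda>_. k" "\<lambda>_. 0"] assms] by simp

lemma adm_deriv_snd:
  assumes "continuous_on K h" "adm_deriv f f'"
  shows "adm_deriv (\<lambda>t \<theta>. h \<theta> * f t \<theta>) (\<lambda>t \<theta>. h \<theta> * f' t \<theta>)"
  using assms adm_snd[OF assms(1)] by (simp add: adm_deriv_def adm_mult DERIV_cmult)

lemma adm_deriv_sum:
  "finite I \<Longrightarrow> (\<And>i. i \<in> I \<Longrightarrow> adm_deriv (f i) (f' i)) \<Longrightarrow>
    adm_deriv (\<lambda>t \<theta>. \<Sum>i\<in>I. f i t \<theta>) (\<lambda>t \<theta>. \<Sum>i\<in>I. f' i t \<theta>)"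
proof (induction I rule: finite_induct)
  case empty
  show ?case using adm_deriv_fst[of "\<lambda>_. 0" "\<lambda>_. 0"] by simp
next
  case (insert i I)
  then show ?case using adm_deriv_add[of "f i" "f' i"] by simp
qed

text \<open>Pulling out the power keeps the remaining factor polynomial in t, so that iterating
  gives closed formulas for the second and third derivatives.\<close>

lemma adm_deriv_powr:
  assumes "adm_deriv f f'"
  shows "adm_deriv (\<lambda>t \<theta>. t powr \<beta> * f t \<theta>) (\<lambda>t \<theta>. t powr (\<beta> - 1) * (\<beta> * f t \<theta> + t * f' t \<theta>))"
proof -
  note f = adm_derivD[OF assms]
  show ?thesis
    unfolding adm_deriv_def
  proof (intro conjI allI impI ballI)
    fix t \<theta> assume t: "(0::real) < t" "\<theta> \<in> space M"
    have "((\<lambda>t. t powr \<beta> * f t \<theta>) has_real_derivative \<beta> * t powr (\<beta> - 1) * f t \<theta> + f' t \<theta> * t powr \<beta>) (at t)"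
      by (rule DERIV_mult[OF has_real_derivative_powr[OF t(1)] f(3)[OF t]])
    moreover have "t powr \<beta> = t * t powr (\<beta> - 1)"
      using t by (simp add: powr_diff)
    ultimately show "((\<lambda>t. t powr \<beta> * f t \<theta>) has_real_derivative t powr (\<beta> - 1) * (\<beta> * f t \<theta> + t * f' t \<theta>)) (at t)"
      by (simp add: algebra_simps)
  qed (intro adm_intros f)+
qed

lemma adm_deriv_id: "adm_deriv (\<lambda>t \<theta>. t) (\<lambda>t \<theta>. 1)"
  by (rule adm_deriv_fst) (auto intro!: continuous_intros)

lemma adm_deriv_eqI: "adm_deriv f g \<Longrightarrow> (\<And>t \<theta>. g t \<theta> = h t \<theta>) \<Longrightarrow> adm_deriv f h"
  by (subgoal_tac "g = h") (auto simp: fun_eq_iff)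

lemma adm_deriv_powr2:
  assumes "adm_deriv f f1" "adm_deriv f1 f2"
  shows "adm_deriv (\<lambda>t \<theta>. t powr (\<beta> - 1) * (\<beta> * f t \<theta> + t * f1 t \<theta>))
    (\<lambda>t \<theta>. t powr (\<beta> - 2) * (\<beta> * (\<beta> - 1) * f t \<theta> + 2 * \<beta> * t * f1 t \<theta> + t\<^sup>2 * f2 t \<theta>))"
proof -
  have "adm_deriv (\<lambda>t \<theta>. \<beta> * f t \<theta> + t * f1 t \<theta>) (\<lambda>t \<theta>. \<beta> * f1 t \<theta> + (1 * f1 t \<theta> + t * f2 t \<theta>))"
    by (intro adm_deriv_add adm_deriv_cmult adm_deriv_mult adm_deriv_id assms)
  from adm_deriv_powr[OF this, of "\<beta> - 1"] show ?thesis
    by (rule adm_deriv_eqI) (simp add: algebra_simps power2_eq_square)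
qed

lemma adm_deriv_powr3:
  assumes "adm_deriv f f1" "adm_deriv f1 f2" "adm_deriv f2 f3"
  shows "adm_deriv (\<lambda>t \<theta>. t powr (\<beta> - 2) * (\<beta> * (\<beta> - 1) * f t \<theta> + 2 * \<beta> * t * f1 t \<theta> + t\<^sup>2 * f2 t \<theta>))
    (\<lambda>t \<theta>. t powr (\<beta> - 3) * (\<beta> * (\<beta> - 1) * (\<beta> - 2) * f t \<theta> + 3 * \<beta> * (\<beta> - 1) * t * f1 t \<theta>
      + 3 * \<beta> * t\<^sup>2 * f2 t \<theta> + t ^ 3 * f3 t \<theta>))"
proof -
  have "adm_deriv (\<lambda>t \<theta>. \<beta> * (\<beta> - 1) * f t \<theta> + (2 * \<beta>) * (t * f1 t \<theta>) + (t * t) * f2 t \<theta>)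
    (\<lambda>t \<theta>. \<beta> * (\<beta> - 1) * f1 t \<theta> + (2 * \<beta>) * (1 * f1 t \<theta> + t * f2 t \<theta>) + ((1 * t + t * 1) * f2 t \<theta> + (t * t) * f3 t \<theta>))"
    by (intro adm_deriv_add adm_deriv_cmult adm_deriv_mult adm_deriv_id assms)
  from adm_deriv_powr[OF this, of "\<beta> - 2"]
  have "adm_deriv (\<lambda>t \<theta>. t powr (\<beta> - 2) * (\<beta> * (\<beta> - 1) * f t \<theta> + (2 * \<beta>) * (t * f1 t \<theta>) + (t * t) * f2 t \<theta>))
    (\<lambda>t \<theta>. t powr (\<beta> - 3) * (\<beta> * (\<beta> - 1) * (\<beta> - 2) * f t \<theta> + 3 * \<beta> * (\<beta> - 1) * t * f1 t \<theta>
      + 3 * \<beta> * t\<^sup>2 * f2 t \<theta> + t ^ 3 * f3 t \<theta>))"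
    by (rule adm_deriv_eqI) (simp add: algebra_simps power2_eq_square power3_eq_cube)
  then show ?thesis
    by (simp add: power2_eq_square mult.assoc)
qed

text \<open>An integral identity valid for all t > 0 may be differentiated in t. In this way one
  integration by parts on the half-sphere yields those for the t-derivatives.\<close>

lemma integral_derivative_eq_0:
  assumes "adm_deriv c c'" "\<And>t. 0 < t \<Longrightarrow> (\<integral>\<theta>. c t \<theta> \<partial>M) = 0" "0 < t"
  shows "(\<integral>\<theta>. c' t \<theta> \<partial>M) = 0"
proof -
  have "((\<lambda>t. 0) has_real_derivative (\<integral>\<theta>. c' t \<theta> \<partial>M)) (at t)"
    using has_real_derivative_integral[OF assms(1,3)]
    by (rule has_field_derivative_transform_within_open[of _ _ t "{0<..}"]) (use assms in auto)
  then show ?thesis using DERIV_unique DERIV_const by blast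
qed

lemma adm_compose:
  assumes "continuous_on UNIV \<phi>" "adm f"
  shows "adm (\<lambda>t \<theta>. \<phi> (f t \<theta>))"
proof -
  obtain g where g: "continuous_on ({0<..} \<times> K) g" "\<forall>t>0. \<forall>\<theta>\<in>space M. f t \<theta> = g (t, \<theta>)"
    using assms(2) by (auto simp: adm_def)
  have "continuous_on ({0<..} \<times> K) (\<lambda>x. \<phi> (g x))"
    by (rule continuous_on_compose2[OF assms(1) g(1)]) simp
  then show ?thesis using g(2) by (intro admI[of "\<lambda>x. \<phi> (g x)"]) simp_all
qed

end

section \<open>The weighted divergence theorem on half-annuli\<close>

lemma sum_Basis_snd: "(\<Sum>e\<in>Basis. snd e * (v \<bullet> e)) = snd (v :: (real^'n) \<times> real)"
proof -
  have "snd e = (0, 1) \<bullet> e" for e :: "(real^'n) \<times> real" by (simp add: inner_prod_def)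
  then have "(\<Sum>e\<in>Basis. snd e * (v \<bullet> e)) = (\<Sum>e\<in>Basis. (v \<bullet> e) * ((0, 1) \<bullet> e))"
    by (metis mult.commute)
  also have "\<dots> = v \<bullet> (0, 1)" by (rule euclidean_inner[symmetric])
  finally show ?thesis by (simp add: inner_prod_def)
qed

text \<open>A function that vanishes for y < c has no jump when extended by zero: the open sets y >
  0 and y < c cover the space.\<close>

lemma continuous_on_indicator_upper_half:
  fixes h :: "(real^'n) \<times> real \<Rightarrow> real"
  assumes "continuous_on upper_half h" "0 < c" "\<And>X. X \<in> upper_half \<Longrightarrow> snd X < c \<Longrightarrow> h X = 0"
  shows "continuous_on UNIV (\<lambda>X. indicator upper_half X * h X)"
proof -
  have "continuous_on upper_half (\<lambda>X. indicator upper_half X * h X)"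
    by (rule continuous_on_eq[OF assms(1)]) simp
  moreover have "continuous_on {X. snd X < c} (\<lambda>X. indicator upper_half X * h X)"
    by (rule continuous_on_eq[OF continuous_on_const[of _ 0]]) (use assms(3) in \<open>auto simp: indicator_def\<close>)
  moreover have "open {X :: (real^'n) \<times> real. snd X < c}"
    by (intro open_Collect_less continuous_intros)
  ultimately have "continuous_on (upper_half \<union> {X. snd X < c}) (\<lambda>X. indicator upper_half X * h X)"
    using open_upper_half by (intro continuous_on_open_Un)
  moreover have "upper_half \<union> {X :: (real^'n) \<times> real. snd X < c} = UNIV"
    using assms(2) by (auto simp: upper_half_def)
  ultimately show ?thesis by metis
qed

lemma DERIV_indicator_upper_half:
  fixes h :: "(real^'n) \<times> real \<Rightarrow> real"
  assumes "0 < c" "\<And>X. X \<in> upper_half \<Longrightarrow> snd X < c \<Longrightarrow> h X = 0 \<and> g X = 0"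
    and d: "\<And>X. X \<in> upper_half \<Longrightarrow> ((\<lambda>t. h (X + t *\<^sub>R e)) has_real_derivative g X) (at 0)"
  shows "((\<lambda>t. indicator upper_half (X + t *\<^sub>R e) * h (X + t *\<^sub>R e)) has_real_derivative
    indicator upper_half X * g X) (at 0)"
proof (cases "X \<in> upper_half")
  case True
  have op: "open {t. 0 < snd (X + t *\<^sub>R e)}"
    by (intro open_Collect_less continuous_intros)
  have "((\<lambda>t. h (X + t *\<^sub>R e)) has_real_derivative indicator upper_half X * g X) (at 0)"
    using d[OF True] True by simp
  then show ?thesis
    by (rule has_field_derivative_transform_within_open[OF _ op]) (use True in \<open>auto simp: upper_half_def\<close>)
next
  case False
  have op: "open {t. snd (X + t *\<^sub>R e) < c}"
    by (intro open_Collect_less continuous_intros)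
  have "((\<lambda>t. 0) has_real_derivative indicator upper_half X * g X) (at 0)"
    using False by simp
  then show ?thesis
  proof (rule has_field_derivative_transform_within_open[OF _ op])
    show "0 \<in> {t. snd (X + t *\<^sub>R e) < c}" using False assms(1) by (auto simp: upper_half_def)
    fix t assume "t \<in> {t. snd (X + t *\<^sub>R e) < c}"
    then show "0 = indicator upper_half (X + t *\<^sub>R e) * h (X + t *\<^sub>R e)"
      using assms(2)[of "X + t *\<^sub>R e"] by (auto simp: indicator_def)
  qed
qed

lemma DERIV_norm_along:
  assumes "X \<noteq> 0"
  shows "((\<lambda>t. norm (X + t *\<^sub>R e)) has_real_derivative (X \<bullet> e) / norm X) (at 0)"
proof -
  have "(norm has_derivative (\<lambda>h. h \<bullet> sgn X)) (at (X + 0 *\<^sub>R e))"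
    using has_derivative_norm[OF assms] by simp
  moreover have "((\<lambda>t. X + t *\<^sub>R e) has_derivative (\<lambda>t. t *\<^sub>R e)) (at 0)"
    by (auto intro!: derivative_eq_intros)
  ultimately have "((\<lambda>t. norm (X + t *\<^sub>R e)) has_derivative (\<lambda>t. (t *\<^sub>R e) \<bullet> sgn X)) (at 0)"
    using has_derivative_compose[of "\<lambda>t. X + t *\<^sub>R e" "\<lambda>t. t *\<^sub>R e" 0 UNIV norm] by blast
  moreover have "(\<lambda>t. (t *\<^sub>R e) \<bullet> sgn X) = (*) ((X \<bullet> e) / norm X)"
    by (auto simp: fun_eq_iff sgn_div_norm inner_commute divide_inverse)
  ultimately show ?thesis by (simp add: has_field_derivative_def)
qed

text \<open>The two cutoffs let the field be extended by zero, with bounded support, and each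
  derivative of a component in its own direction then integrates to 0. The cutoff in y is 0 for y <=
  1 / \<kappa> and 1 for y >= 2 / \<kappa>. Its derivative gives the last term, a layer that moves
  to the flat boundary as \<kappa> grows.\<close>

lemma divergence_cutoff:
  fixes F :: "(real^'n) \<times> real \<Rightarrow> (real^'n) \<times> real"
  assumes F: "continuous_on upper_half F"
    and DF: "\<And>e. e \<in> Basis \<Longrightarrow> continuous_on upper_half (DF e)"
    and D: "\<And>X e. X \<in> upper_half \<Longrightarrow> e \<in> Basis \<Longrightarrow>
      ((\<lambda>t. F (X + t *\<^sub>R e) \<bullet> e) has_real_derivative DF e X) (at 0)"
    and \<phi>: "\<And>t. (\<phi> has_real_derivative \<phi>' t) (at t)" and \<phi>': "continuous_on UNIV \<phi>'"
    and supp: "\<And>t. R \<le> t \<Longrightarrow> \<phi> t = 0" and \<kappa>: "0 < \<kappa>"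
  shows "has_bochner_integral lborel (\<lambda>X. indicator upper_half X *
    (ramp (\<kappa> * snd X - 1) * (\<phi> (norm X) * (\<Sum>e\<in>Basis. DF e X) + \<phi>' (norm X) * (F X \<bullet> (X /\<^sub>R norm X)))
      + \<kappa> * ramp' (\<kappa> * snd X - 1) * \<phi> (norm X) * snd (F X))) 0"
proof -
  define f where "f = (\<lambda>e X. ramp (\<kappa> * snd X - 1) * (\<phi> (norm X) * (F X \<bullet> e)))"
  define g where "g = (\<lambda>e X. ramp (\<kappa> * snd X - 1) * (\<phi> (norm X) * DF e X + \<phi>' (norm X) * ((X \<bullet> e) / norm X) * (F X \<bullet> e))
      + \<kappa> * ramp' (\<kappa> * snd X - 1) * snd e * (\<phi> (norm X) * (F X \<bullet> e)))"
  have c: "0 < 1 / \<kappa>" using \<kappa> by simp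
  have low: "ramp (\<kappa> * snd X - 1) = 0 \<and> ramp' (\<kappa> * snd X - 1) = 0" if "snd X < 1 / \<kappa>" for X :: "(real^'n) \<times> real"
    using that \<kappa> by (simp add: field_simps ramp_eq_0 ramp'_eq_0)
  have cont\<phi>: "continuous_on UNIV \<phi>"
    using \<phi> by (intro continuous_at_imp_continuous_on) (auto intro: DERIV_isCont)
  note cs = continuous_on_compose2[OF cont\<phi>] continuous_on_compose2[OF \<phi>'] F DF
    continuous_on_compose2[OF continuous_on_ramp[of UNIV]] continuous_on_compose2[OF continuous_on_ramp'[of UNIV]]
    continuous_intros
  have nz: "\<forall>X\<in>upper_half. norm X \<noteq> 0" using upper_half_not_0 by auto
  have "has_bochner_integral lborel (\<lambda>X. indicator upper_half X * g e X) 0" if e: "e \<in> Basis" for e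
  proof (rule has_integral_directional_derivative)
    show "continuous_on UNIV (\<lambda>X. indicator upper_half X * f e X)"
      by (rule continuous_on_indicator_upper_half[OF _ c]) (auto simp: f_def low intro!: cs)
    show "continuous_on UNIV (\<lambda>X. indicator upper_half X * g e X)"
      by (rule continuous_on_indicator_upper_half[OF _ c])
        (use nz in \<open>auto simp: g_def low intro!: cs e\<close>)
    show "((\<lambda>t. indicator upper_half (X + t *\<^sub>R e) * f e (X + t *\<^sub>R e)) has_real_derivative
        indicator upper_half X * g e X) (at 0)" for X
    proof (rule DERIV_indicator_upper_half[OF c])
      show "f e X = 0 \<and> g e X = 0" if "snd X < 1 / \<kappa>" for X
        using low[OF that] by (simp add: f_def g_def)
      fix X :: "(real^'n) \<times> real" assume X: "X \<in> upper_half"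
      have 1: "((\<lambda>t. \<phi> (norm (X + t *\<^sub>R e))) has_real_derivative \<phi>' (norm X) * ((X \<bullet> e) / norm X)) (at 0)"
        using DERIV_chain2[OF _ DERIV_norm_along[OF upper_half_not_0[OF X]], of \<phi> "\<phi>' (norm X)" e] \<phi>[of "norm X"]
        by simp
      have 2: "((\<lambda>t. ramp (\<kappa> * snd (X + t *\<^sub>R e) - 1)) has_real_derivative ramp' (\<kappa> * snd X - 1) * (\<kappa> * snd e)) (at 0)"
        by (rule DERIV_chain2[where f=ramp])
          (use DERIV_ramp[of "\<kappa> * snd X - 1"] in \<open>auto intro!: derivative_eq_intros\<close>)
      show "((\<lambda>t. f e (X + t *\<^sub>R e)) has_real_derivative g e X) (at 0)"
        unfolding f_def g_def
        using DERIV_mult[OF 2 DERIV_mult[OF 1 D[OF X e]]] by (simp add: algebra_simps)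
    qed
    show "indicator upper_half X * f e X = 0" if "R < norm X" for X
      using supp[of "norm X"] that by (simp add: f_def)
  qed
  then have "has_bochner_integral lborel (\<lambda>X. \<Sum>e\<in>Basis. indicator upper_half X * g e X) (\<Sum>e\<in>(Basis :: ((real^'n) \<times> real) set). 0)"
    by (intro has_bochner_integral_sum)
  moreover have "(\<Sum>e\<in>Basis. g e X) =
    ramp (\<kappa> * snd X - 1) * (\<phi> (norm X) * (\<Sum>e\<in>Basis. DF e X) + \<phi>' (norm X) * (F X \<bullet> (X /\<^sub>R norm X)))
      + \<kappa> * ramp' (\<kappa> * snd X - 1) * \<phi> (norm X) * snd (F X)" for X
  proof -
    have "g e X = ramp (\<kappa> * snd X - 1) * \<phi> (norm X) * DF e X
      + ramp (\<kappa> * snd X - 1) * \<phi>' (norm X) / norm X * ((F X \<bullet> e) * (X \<bullet> e))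
      + \<kappa> * ramp' (\<kappa> * snd X - 1) * \<phi> (norm X) * (snd e * (F X \<bullet> e))" for e
      by (simp add: g_def algebra_simps)
    then have "(\<Sum>e\<in>Basis. g e X) = ramp (\<kappa> * snd X - 1) * \<phi> (norm X) * (\<Sum>e\<in>Basis. DF e X)
      + ramp (\<kappa> * snd X - 1) * \<phi>' (norm X) / norm X * (\<Sum>e\<in>Basis. (F X \<bullet> e) * (X \<bullet> e))
      + \<kappa> * ramp' (\<kappa> * snd X - 1) * \<phi> (norm X) * (\<Sum>e\<in>Basis. snd e * (F X \<bullet> e))"
      by (simp only: sum.distrib sum_distrib_left)
    also have "(\<Sum>e\<in>Basis. (F X \<bullet> e) * (X \<bullet> e)) = F X \<bullet> X"
      by (rule euclidean_inner[symmetric])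
    finally show ?thesis
      by (simp add: sum_Basis_snd distrib_left divide_inverse)
  qed
  ultimately show ?thesis
    by (simp add: sum_distrib_left[symmetric])
qed

lemma bounded_half_annulus:
  fixes g :: "(real^'n) \<times> real \<Rightarrow> real"
  assumes "continuous_on (closed_upper_half - {0}) g" "0 < r"
  obtains C where "0 \<le> C" "\<And>X. X \<in> closed_upper_half \<Longrightarrow> r \<le> norm X \<Longrightarrow> norm X \<le> R \<Longrightarrow> \<bar>g X\<bar> \<le> C"
proof -
  let ?K = "closed_upper_half \<inter> (cball 0 R \<inter> {X :: (real^'n) \<times> real. r \<le> norm X})"
  have "compact ?K"
    by (intro closed_Int_compact closed_closed_upper_half compact_Int_closed compact_cball
        closed_Collect_le continuous_intros)
  moreover have "continuous_on ?K g"
    using assms(2) by (intro continuous_on_subset[OF assms(1)]) auto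
  ultimately have "bounded (g ` ?K)"
    by (intro compact_imp_bounded compact_continuous_image)
  then obtain C where C: "\<forall>X\<in>?K. \<bar>g X\<bar> \<le> C"
    by (auto simp: bounded_iff)
  show thesis
  proof (rule that[of "max C 0"])
    fix X :: "(real^'n) \<times> real" assume "X \<in> closed_upper_half" "r \<le> norm X" "norm X \<le> R"
    then have "\<bar>g X\<bar> \<le> C" using C by simp
    then show "\<bar>g X\<bar> \<le> max C 0" by (rule max.coboundedI1)
  qed simp
qed

lemma measurable_on_upper_half:
  fixes g :: "(real^'n) \<times> real \<Rightarrow> real"
  assumes "continuous_on (closed_upper_half - {0}) g"
  shows "(\<lambda>X. indicator upper_half X * g X) \<in> borel_measurable borel"
proof -
  have "continuous_on upper_half g"
    by (rule continuous_on_subset[OF assms]) (use upper_half_subset_closed upper_half_not_0 in auto)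
  then show ?thesis
    using borel_measurable_continuous_on_indicator[OF upper_half_borel] by fastforce
qed

lemma integrable_weighted_upper_half:
  fixes g :: "(real^'n) \<times> real \<Rightarrow> real"
  assumes b: "-1 < b" and m: "(\<lambda>X. indicator upper_half X * g X) \<in> borel_measurable borel"
    and bound: "\<And>X. X \<in> upper_half \<Longrightarrow> \<bar>g X\<bar> \<le> C" and supp: "\<And>X. X \<in> upper_half \<Longrightarrow> R \<le> norm X \<Longrightarrow> g X = 0"
  shows "integrable lborel (\<lambda>X. indicator upper_half X * (snd X powr b * g X))"
proof (rule Bochner_Integration.integrable_bound[OF integrable_mult_right[OF integrable_powr_ball[OF b, of R], of "\<bar>C\<bar>"]])
  have "(\<lambda>X. snd X powr b * (indicator upper_half X * g X)) \<in> borel_measurable borel"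
    using m by measurable
  then show "(\<lambda>X. indicator upper_half X * (snd X powr b * g X)) \<in> borel_measurable lborel"
    by (simp add: mult.left_commute)
  show "AE X in lborel. norm (indicator upper_half X * (snd X powr b * g X))
      \<le> norm (\<bar>C\<bar> * (indicator (upper_half \<inter> ball 0 R) X * snd X powr b))"
  proof (rule AE_I2)
    fix X :: "(real^'n) \<times> real"
    show "norm (indicator upper_half X * (snd X powr b * g X))
      \<le> norm (\<bar>C\<bar> * (indicator (upper_half \<inter> ball 0 R) X * snd X powr b))"
    proof (cases "X \<in> upper_half \<and> norm X < R")
      case True
      then have "\<bar>g X\<bar> \<le> \<bar>C\<bar>" using bound[of X] by linarith
      then show ?thesis using True by (simp add: abs_mult mult.commute mult_right_mono)
    next
      case False
      then show ?thesis using supp[of X] by (cases "X \<in> upper_half") auto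
    qed
  qed
qed

definition closed_half_sphere :: "((real^'n) \<times> real) set" where
  "closed_half_sphere = {\<theta> \<in> closed_upper_half. norm \<theta> = 1}"

lemma param_measure_half_sphere:
  assumes "-1 < b"
  shows "param_measure (weighted_half_sphere b :: ((real^'n) \<times> real) measure) closed_half_sphere"
proof -
  interpret finite_measure "weighted_half_sphere b :: ((real^'n) \<times> real) measure"
    by (rule finite_weighted_half_sphere[OF assms])
  have "closed_half_sphere = closed_upper_half \<inter> (sphere 0 1 :: ((real^'n) \<times> real) set)"
    by (auto simp: closed_half_sphere_def)
  then have "compact (closed_half_sphere :: ((real^'n) \<times> real) set)"
    by (metis closed_Int_compact closed_closed_upper_half compact_sphere)
  then show ?thesis
    by unfold_locales (use upper_half_subset_closed in \<open>auto simp: half_sphere_def closed_half_sphere_def\<close>)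
qed

text \<open>For t > 0 and theta on the closed half-sphere the point t theta is never the origin, so
  continuity up to y = 0 away from the origin suffices.\<close>

lemma adm_ray:
  fixes f g :: "(real^'n) \<times> real \<Rightarrow> real"
  assumes b: "-1 < b" and g: "continuous_on (closed_upper_half - {0}) g"
    and eq: "\<And>X. X \<in> upper_half \<Longrightarrow> f X = g X"
  shows "param_measure.adm (weighted_half_sphere b) closed_half_sphere (\<lambda>t \<theta>. f (t *\<^sub>R \<theta>))"
proof -
  interpret param_measure "weighted_half_sphere b :: ((real^'n) \<times> real) measure" closed_half_sphere
    by (rule param_measure_half_sphere[OF b])
  have "continuous_on ({0<..} \<times> closed_half_sphere) (\<lambda>x. g (fst x *\<^sub>R snd x))"
    proof (rule continuous_on_compose2[OF g])
      show "(\<lambda>x. fst x *\<^sub>R snd x) ` ({0<..} \<times> closed_half_sphere) \<subseteq> closed_upper_half - {0 :: (real^'n) \<times> real}"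
      proof (intro image_subsetI)
        fix x :: "real \<times> ((real^'n) \<times> real)" assume "x \<in> {0<..} \<times> closed_half_sphere"
        then have "0 < fst x" "snd x \<in> closed_upper_half" "snd x \<noteq> 0"
          by (auto simp: closed_half_sphere_def mem_Times_iff)
        then show "fst x *\<^sub>R snd x \<in> closed_upper_half - {0}"
          by (simp add: closed_upper_half_scaleR)
      qed
    qed (intro continuous_intros)
  moreover have "f (t *\<^sub>R \<theta>) = g (fst (t, \<theta>) *\<^sub>R snd (t, \<theta>))"
    if "0 < t" "\<theta> \<in> half_sphere" for t \<theta>
    using that eq[of "t *\<^sub>R \<theta>"] upper_half_scaleR[of t \<theta>] by (simp add: half_sphere_def)
  ultimately show ?thesis
    unfolding adm_def by (intro exI[of _ "\<lambda>x. g (fst x *\<^sub>R snd x)"]) simp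
qed

lemma tendsto_ramp_cut:
  assumes "0 < y"
  shows "(\<lambda>k. ramp (real (Suc k) * y - 1)) \<longlonglongrightarrow> 1"
proof (rule tendsto_eventually)
  obtain N where N: "2 / y < real N" using reals_Archimedean2 by blast
  show "\<forall>\<^sub>F k in sequentially. ramp (real (Suc k) * y - 1) = 1"
    using eventually_ge_at_top[of N]
  proof (rule eventually_mono)
    fix k assume "N \<le> k"
    then have "2 / y < real (Suc k)" using N by linarith
    then have "2 < real (Suc k) * y" using assms by (simp add: field_simps)
    then show "ramp (real (Suc k) * y - 1) = 1" by (intro ramp_eq_1) simp
  qed
qed

text \<open>This is the limit \<kappa> to infinity in \<open>divergence_cutoff\<close>. The bulk
  terms converge dominatedly. The layer term is integrated over horizontal slices, and
  \<open>ramp_kernel\<close> turns it into the trace at y = 0. The radial cutoff, supported in (r,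
  R) with r > 0, keeps everything away from the origin.\<close>

lemma divergence_radial:
  fixes F :: "(real^'n) \<times> real \<Rightarrow> (real^'n) \<times> real"
  assumes b: "-1 < b" and F: "continuous_on upper_half F"
    and DF: "\<And>e. e \<in> Basis \<Longrightarrow> continuous_on upper_half (DF e)"
    and D: "\<And>X e. X \<in> upper_half \<Longrightarrow> e \<in> Basis \<Longrightarrow>
      ((\<lambda>t. F (X + t *\<^sub>R e) \<bullet> e) has_real_derivative DF e X) (at 0)"
    and d: "continuous_on (closed_upper_half - {0}) d"
      "\<And>X. X \<in> upper_half \<Longrightarrow> (\<Sum>e\<in>Basis. DF e X) = snd X powr b * d X"
    and f: "continuous_on (closed_upper_half - {0}) f"
      "\<And>X. X \<in> upper_half \<Longrightarrow> F X \<bullet> (X /\<^sub>R norm X) = snd X powr b * f X"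
    and h: "continuous_on (closed_upper_half - {0}) h" "\<And>X. X \<in> upper_half \<Longrightarrow> snd (F X) = h X"
    and \<phi>: "\<And>t. (\<phi> has_real_derivative \<phi>' t) (at t)" and \<phi>': "continuous_on UNIV \<phi>'"
    and supp: "\<And>t. t \<notin> {r<..<R} \<Longrightarrow> \<phi> t = 0" "\<And>t. t \<notin> {r<..<R} \<Longrightarrow> \<phi>' t = 0" and r: "0 < r"
  shows "(\<integral>X. indicator upper_half X * (snd X powr b * (\<phi> (norm X) * d X)) \<partial>lborel)
    + (\<integral>X. indicator upper_half X * (snd X powr b * (\<phi>' (norm X) * f X)) \<partial>lborel)
    + (\<integral>x. \<phi> (norm x) * h (x, 0) \<partial>lborel) = 0"
proof -
  have cont\<phi>: "continuous_on UNIV \<phi>"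
    using \<phi> by (intro continuous_at_imp_continuous_on) (auto intro: DERIV_isCont)
  have far: "\<phi> t = 0" "\<phi>' t = 0" if "\<bar>r\<bar> + \<bar>R\<bar> < norm t" for t
    using that by (auto intro!: supp)
  obtain Cp where Cp: "0 \<le> Cp" "\<And>t. \<bar>\<phi> t\<bar> \<le> Cp"
    using bounded_continuous_bounded_support[OF cont\<phi> far(1)] by blast
  obtain Cp' where Cp': "0 \<le> Cp'" "\<And>t. \<bar>\<phi>' t\<bar> \<le> Cp'"
    using bounded_continuous_bounded_support[OF \<phi>' far(2)] by blast
  define P where "P = (\<lambda>X. \<phi> (norm X) * d X + \<phi>' (norm X) * f X)"
  define Q where "Q = (\<lambda>X. \<phi> (norm X) * h X)"
  have supp': "\<forall>t. t \<notin> {r<..<R} \<longrightarrow> \<phi> t = 0" "\<forall>t. t \<notin> {r<..<R} \<longrightarrow> \<phi>' t = 0"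
    using supp by blast+
  have bound: "\<exists>C\<ge>0. \<forall>X\<in>closed_upper_half. \<bar>\<psi> (norm X) * g X\<bar> \<le> C"
    if g: "continuous_on (closed_upper_half - {0}) g" and \<psi>: "\<forall>t. t \<notin> {r<..<R} \<longrightarrow> \<psi> t = 0"
      and B: "0 \<le> B" "\<And>t. \<bar>\<psi> t\<bar> \<le> B" for g :: "(real^'n) \<times> real \<Rightarrow> real" and \<psi> B
  proof -
    obtain C where C: "0 \<le> C" "\<And>X. X \<in> closed_upper_half \<Longrightarrow> r \<le> norm X \<Longrightarrow> norm X \<le> R \<Longrightarrow> \<bar>g X\<bar> \<le> C"
      using bounded_half_annulus[OF g r, of R] by blast
    have "\<bar>\<psi> (norm X) * g X\<bar> \<le> B * C" if X: "X \<in> closed_upper_half" for X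
    proof (cases "norm X \<in> {r<..<R}")
      case True
      then have "\<bar>g X\<bar> \<le> C" using C(2)[OF X] by simp
      then show ?thesis using B(2)[of "norm X"] B(1) by (simp add: abs_mult mult_mono)
    next
      case False
      then show ?thesis using \<psi>[rule_format, OF False] B(1) C(1) by simp
    qed
    then show ?thesis using B(1) C(1) by (intro exI[of _ "B * C"]) simp
  qed
  obtain Cd where Cd: "0 \<le> Cd" "\<forall>X\<in>closed_upper_half. \<bar>\<phi> (norm X) * d X\<bar> \<le> Cd"
    using bound[where g=d and \<psi>=\<phi> and B=Cp, OF d(1) supp'(1) Cp] by (elim exE conjE) (rule that; assumption)
  obtain Cf where Cf: "0 \<le> Cf" "\<forall>X\<in>closed_upper_half. \<bar>\<phi>' (norm X) * f X\<bar> \<le> Cf"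
    using bound[where g=f and \<psi>=\<phi>' and B=Cp', OF f(1) supp'(2) Cp'] by (elim exE conjE) (rule that; assumption)
  obtain Ch where Ch': "0 \<le> Ch" "\<forall>X\<in>closed_upper_half. \<bar>\<phi> (norm X) * h X\<bar> \<le> Ch"
    using bound[where g=h and \<psi>=\<phi> and B=Cp, OF h(1) supp'(1) Cp]
    by (elim exE conjE) (rule that; assumption)
  have Ch: "0 \<le> Ch" "\<forall>X\<in>closed_upper_half. \<bar>Q X\<bar> \<le> Ch"
    using Ch' by (simp_all add: Q_def)
  have contd: "continuous_on (closed_upper_half - {0}) (\<lambda>X. \<phi> (norm X) * d X)"
    by (intro continuous_intros d continuous_on_compose2[OF cont\<phi>]) auto
  have contf: "continuous_on (closed_upper_half - {0}) (\<lambda>X. \<phi>' (norm X) * f X)"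
    by (intro continuous_intros f continuous_on_compose2[OF \<phi>']) auto
  have contQ: "continuous_on (closed_upper_half - {0}) Q"
    unfolding Q_def by (intro continuous_intros h continuous_on_compose2[OF cont\<phi>]) auto
  have intd: "integrable lborel (\<lambda>X. indicator upper_half X * (snd X powr b * (\<phi> (norm X) * d X)))"
    by (rule integrable_weighted_upper_half[OF b measurable_on_upper_half[OF contd], of Cd R])
      (use Cd upper_half_subset_closed supp(1) in auto)
  have intf: "integrable lborel (\<lambda>X. indicator upper_half X * (snd X powr b * (\<phi>' (norm X) * f X)))"
    by (rule integrable_weighted_upper_half[OF b measurable_on_upper_half[OF contf], of Cf R])
      (use Cf upper_half_subset_closed supp(2) in auto)
  have intP: "integrable lborel (\<lambda>X. indicator upper_half X * (snd X powr b * P X))"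
    using Bochner_Integration.integrable_add[OF intd intf] by (simp add: P_def distrib_left)
  define H where "H = (\<lambda>X. indicator upper_half X * Q X)"
  have Hm: "H \<in> borel_measurable borel"
    unfolding H_def by (rule measurable_on_upper_half[OF contQ])
  have Hb: "\<bar>H X\<bar> \<le> Ch * indicator (cball 0 R) (fst X)" for X
  proof (cases "X \<in> upper_half \<and> norm X < R")
    case True
    then have "norm (fst X) \<le> R" using norm_fst_le[of "fst X" "snd X"] by simp
    then show ?thesis using True Ch upper_half_subset_closed by (auto simp: H_def)
  next
    case False
    then show ?thesis using supp(1)[of "norm X"] Ch(1) by (auto simp: H_def Q_def indicator_def)
  qed
  let ?\<kappa> = "\<lambda>k. real (Suc k)"
  define A where "A = (\<lambda>k X. ramp (?\<kappa> k * snd X - 1) * (indicator upper_half X * (snd X powr b * P X)))"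
  define T where "T = (\<lambda>k X. ?\<kappa> k * ramp' (?\<kappa> k * snd X - 1) * H X)"
  have intA: "integrable lborel (A k)" for k
    unfolding A_def
  proof (rule Bochner_Integration.integrable_bound[OF intP])
    have "(\<lambda>X :: (real^'n) \<times> real. ramp (?\<kappa> k * snd X - 1)) \<in> borel_measurable borel"
      by measurable
    then show "(\<lambda>X. ramp (?\<kappa> k * snd X - 1) * (indicator upper_half X * (snd X powr b * P X))) \<in> borel_measurable lborel"
      using borel_measurable_integrable[OF intP] by (intro borel_measurable_times[of "\<lambda>X. ramp (?\<kappa> k * snd X - 1)"]) simp_all
    show "AE X in lborel. norm (ramp (?\<kappa> k * snd X - 1) * (indicator upper_half X * (snd X powr b * P X)))
      \<le> norm (indicator upper_half X * (snd X powr b * P X))"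
      using ramp_nonneg ramp_le_1 by (intro AE_I2) (simp add: abs_mult mult_left_le_one_le)
  qed
  have sum0: "has_bochner_integral lborel (\<lambda>X. A k X + T k X) 0" for k
  proof -
    have eq: "indicator upper_half X *
      (ramp (?\<kappa> k * snd X - 1) * (\<phi> (norm X) * (\<Sum>e\<in>Basis. DF e X) + \<phi>' (norm X) * (F X \<bullet> (X /\<^sub>R norm X)))
      + ?\<kappa> k * ramp' (?\<kappa> k * snd X - 1) * \<phi> (norm X) * snd (F X)) = A k X + T k X" for X
    proof (cases "X \<in> upper_half")
      case True
      show ?thesis
        using True unfolding d(2)[OF True] f(2)[OF True] h(2)[OF True] A_def T_def H_def P_def Q_def
        by (simp add: algebra_simps)
    qed (simp add: A_def T_def H_def)
    show ?thesis
      using divergence_cutoff[OF F DF D \<phi> \<phi>' supp(1)[of "_"], of R "?\<kappa> k"] supp(1)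
      unfolding eq by simp
  qed
  have intT: "integrable lborel (T k)" for k
    using Bochner_Integration.integrable_diff[OF integrable.intros[OF sum0[of k]] intA[of k]] by simp
  have eq0: "(\<integral>X. A k X \<partial>lborel) + (\<integral>X. T k X \<partial>lborel) = 0" for k
    using has_bochner_integral_integral_eq[OF sum0[of k]] Bochner_Integration.integral_add[OF intA intT, of k k] by simp
  have limA: "(\<lambda>k. \<integral>X. A k X \<partial>lborel) \<longlonglongrightarrow> (\<integral>X. indicator upper_half X * (snd X powr b * P X) \<partial>lborel)"
  proof (rule integral_dominated_convergence[where w = "\<lambda>X. \<bar>indicator upper_half X * (snd X powr b * P X)\<bar>"])
    show "AE X in lborel. (\<lambda>k. A k X) \<longlonglongrightarrow> indicator upper_half X * (snd X powr b * P X)"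
    proof (rule AE_I2)
      fix X :: "(real^'n) \<times> real"
      show "(\<lambda>k. A k X) \<longlonglongrightarrow> indicator upper_half X * (snd X powr b * P X)"
        using tendsto_mult[OF tendsto_ramp_cut[of "snd X"] tendsto_const[of "indicator upper_half X * (snd X powr b * P X)"]]
        by (cases "X \<in> upper_half") (auto simp: A_def upper_half_def)
    qed
    show "AE X in lborel. norm (A k X) \<le> \<bar>indicator upper_half X * (snd X powr b * P X)\<bar>" for k
      using ramp_nonneg ramp_le_1 by (intro AE_I2) (simp add: A_def abs_mult mult_left_le_one_le)
  qed (use intP intA in auto)
  \<comment> \<open>The kernel in the layer term depends on the height alone, so \<open>H\<close> is
    integrated over horizontal slices first.\<close>
  define B where "B = (\<lambda>y. \<integral>x. H (x, y) \<partial>(lborel :: (real^'n) measure))"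
  have HM: "(\<lambda>(y, x). H (x, y)) \<in> borel_measurable (lborel \<Otimes>\<^sub>M (lborel :: (real^'n) measure))"
  proof -
    have "H \<in> borel_measurable ((lborel :: (real^'n) measure) \<Otimes>\<^sub>M lborel)"
      using Hm by (simp add: lborel_prod)
    then show ?thesis by (rule measurable_pair_swap)
  qed
  have Bm: "B \<in> borel_measurable borel"
    using lborel.borel_measurable_lebesgue_integral[OF HM] by (simp add: B_def)
  have Teq: "(\<integral>X. T k X \<partial>lborel) = (\<integral>y. ?\<kappa> k * ramp' (?\<kappa> k * (y - 1 / ?\<kappa> k)) * B y \<partial>lborel)" for k
  proof -
    have i: "integrable ((lborel :: (real^'n) measure) \<Otimes>\<^sub>M lborel) (case_prod (\<lambda>x y. T k (x, y)))"
      using intT[of k] by (simp add: lborel_prod)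
    have "(\<integral>X. T k X \<partial>lborel) = (\<integral>y. (\<integral>x. T k (x, y) \<partial>lborel) \<partial>lborel)"
      using lborel_pair.integral_snd[OF i] by (simp add: lborel_prod)
    also have "\<dots> = (\<integral>y. ?\<kappa> k * ramp' (?\<kappa> k * (y - 1 / ?\<kappa> k)) * B y \<partial>lborel)"
      by (rule Bochner_Integration.integral_cong) (simp_all add: T_def B_def right_diff_distrib)
    finally show ?thesis .
  qed
  have xb: "integrable lborel (\<lambda>x :: real^'n. Ch * indicator (cball 0 R) x)"
    by (intro integrable_mult_right integrable_indicator_cball)
  have Hmx: "(\<lambda>x. H (x, y)) \<in> borel_measurable (borel :: (real^'n) measure)" for y
    using measurable_compose[OF _ Hm, of "\<lambda>x. (x, y)" borel] borel_measurable_continuous_onI[of "\<lambda>x :: real^'n. (x, y)"]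
    by (simp add: continuous_intros)
  have limT: "(\<lambda>k. \<integral>y. ?\<kappa> k * ramp' (?\<kappa> k * (y - 1 / ?\<kappa> k)) * B y \<partial>lborel) \<longlonglongrightarrow> (\<integral>x. Q (x, 0) \<partial>lborel)"
  proof (rule ramp_kernel[OF Bm, where C = "\<integral>x. Ch * indicator (cball 0 R) x \<partial>(lborel :: (real^'n) measure)"])
    fix z :: real assume z: "z \<in> {0<..<1}"
    \<comment> \<open>The cutoff begins to rise at height 1 / \<kappa>, so these heights are
      positive and \<open>H\<close> agrees with \<open>Q\<close> there.\<close>
    let ?y = "\<lambda>k. 1 / ?\<kappa> k + z / ?\<kappa> k"
    have ypos: "0 < ?y k" for k using z by (simp add: add_pos_pos)
    have "(\<lambda>k. (1 + z) * inverse (?\<kappa> k)) \<longlonglongrightarrow> (1 + z) * 0"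
      by (intro tendsto_mult tendsto_const LIMSEQ_inverse_real_of_nat)
    then have y0: "?y \<longlonglongrightarrow> 0" by (simp add: divide_inverse distrib_right)
    show "(\<lambda>k. B (?y k)) \<longlonglongrightarrow> (\<integral>x. Q (x, 0) \<partial>lborel)"
      unfolding B_def
    proof (rule integral_dominated_convergence[OF _ _ xb])
      \<comment> \<open>Continuity is known off the origin only; at the origin the radial cutoff
        vanishes.\<close>
      have "continuous_on (UNIV - {0 :: real^'n}) (\<lambda>x. Q (x, 0))"
        by (rule continuous_on_compose2[OF contQ]) (auto intro!: continuous_intros simp: closed_upper_half_def zero_prod_def)
      then have "(\<lambda>x. indicator (UNIV - {0}) x *\<^sub>R Q (x, 0)) \<in> borel_measurable (borel :: (real^'n) measure)"
        by (intro borel_measurable_continuous_on_indicator) auto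
      moreover have "(\<lambda>x :: real^'n. indicator (UNIV - {0}) x *\<^sub>R Q (x, 0)) = (\<lambda>x. Q (x, 0))"
        using supp(1)[of 0] r by (auto simp: fun_eq_iff Q_def indicator_def)
      ultimately show "(\<lambda>x. Q (x, 0)) \<in> borel_measurable (lborel :: (real^'n) measure)" by simp
      show "(\<lambda>x. H (x, ?y k)) \<in> borel_measurable (lborel :: (real^'n) measure)" for k
        using Hmx by simp
      show "AE x in lborel. norm (H (x, ?y k)) \<le> Ch * indicator (cball 0 R) x" for k
        using Hb[of "(_, ?y k)"] by (intro AE_I2) simp
      show "AE x in lborel. (\<lambda>k. H (x, ?y k)) \<longlonglongrightarrow> Q (x, 0)"
        using AE_lborel_singleton[of "0 :: real^'n"]
      proof eventually_elim
        fix x :: "real^'n" assume x: "x \<noteq> 0"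
        have "(\<lambda>k. Q (x, ?y k)) \<longlonglongrightarrow> Q (x, 0)"
        proof (rule continuous_on_tendsto_compose[OF contQ])
          show "(\<lambda>k. (x, ?y k)) \<longlonglongrightarrow> (x, 0)" by (intro tendsto_Pair tendsto_const y0)
          show "(x, 0) \<in> closed_upper_half - {0}" using x by (simp add: closed_upper_half_def zero_prod_def)
          show "\<forall>\<^sub>F k in sequentially. (x, ?y k) \<in> closed_upper_half - {0}"
            using x ypos by (intro eventuallyI) (simp add: closed_upper_half_def zero_prod_def less_imp_le)
        qed
        moreover have "H (x, ?y k) = Q (x, ?y k)" for k
          using ypos[of k] by (simp add: H_def upper_half_def)
        ultimately show "(\<lambda>k. H (x, ?y k)) \<longlonglongrightarrow> Q (x, 0)" by simp
      qed
    qed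
    show "\<bar>B (?y k)\<bar> \<le> (\<integral>x. Ch * indicator (cball 0 R) x \<partial>(lborel :: (real^'n) measure))" for k
    proof -
      have i: "integrable lborel (\<lambda>x :: real^'n. H (x, ?y k))"
        by (rule Bochner_Integration.integrable_bound[OF xb]) (use Hmx Hb[of "(_, ?y k)"] Ch(1) in auto)
      have "\<bar>B (?y k)\<bar> \<le> (\<integral>x. \<bar>H (x, ?y k)\<bar> \<partial>lborel)"
        unfolding B_def by (rule integral_abs_bound)
      also have "\<dots> \<le> (\<integral>x. Ch * indicator (cball 0 R) x \<partial>(lborel :: (real^'n) measure))"
        by (rule integral_mono[OF integrable_abs[OF i] xb]) (use Hb[of "(_, ?y k)"] in simp)
      finally show ?thesis .
    qed
  qed simp
  have "(\<lambda>k. (\<integral>X. A k X \<partial>lborel) + (\<integral>X. T k X \<partial>lborel)) \<longlonglongrightarrow>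
    (\<integral>X. indicator upper_half X * (snd X powr b * P X) \<partial>lborel) + (\<integral>x. Q (x, 0) \<partial>lborel)"
    unfolding Teq by (intro tendsto_add limA limT)
  then have "(\<integral>X. indicator upper_half X * (snd X powr b * P X) \<partial>lborel) + (\<integral>x. Q (x, 0) \<partial>lborel) = 0"
    unfolding eq0 using LIMSEQ_unique[OF _ tendsto_const] by blast
  moreover have "(\<integral>X. indicator upper_half X * (snd X powr b * P X) \<partial>lborel) =
     (\<integral>X. indicator upper_half X * (snd X powr b * (\<phi> (norm X) * d X)) \<partial>lborel)
    + (\<integral>X. indicator upper_half X * (snd X powr b * (\<phi>' (norm X) * f X)) \<partial>lborel)"
    unfolding Bochner_Integration.integral_add[OF intd intf, symmetric] by (simp add: P_def distrib_left)
  ultimately show ?thesis by (simp add: Q_def)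
qed

text \<open>The rise takes place just before r and is complete at t = r, so the convergence holds at
  every point, r included. The offset \<open>c\<close> allows all slopes to be large from the
  start.\<close>

lemma tendsto_ramp_step:
  fixes t r :: real
  shows "(\<lambda>k. ramp ((real (Suc k) + c) * (t - r) + 1)) \<longlonglongrightarrow> indicator {r..} t"
proof (cases "r \<le> t")
  case True
  obtain N where N: "\<bar>c\<bar> < real N" using reals_Archimedean2 by blast
  show ?thesis
  proof (rule tendsto_eventually, rule eventually_mono[OF eventually_ge_at_top[of N]])
    fix k assume "N \<le> k"
    then have "0 \<le> real (Suc k) + c" using N by linarith
    then have "0 \<le> (real (Suc k) + c) * (t - r)" using True by simp
    then show "ramp ((real (Suc k) + c) * (t - r) + 1) = indicator {r..} t"
      using True by (subst ramp_eq_1) auto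
  qed
next
  case False
  obtain N where N: "\<bar>c\<bar> + 1 / (r - t) < real N" using reals_Archimedean2 by blast
  show ?thesis
  proof (rule tendsto_eventually, rule eventually_mono[OF eventually_ge_at_top[of N]])
    fix k assume "N \<le> k"
    then have "1 / (r - t) \<le> real (Suc k) + c" using N by linarith
    then have "1 \<le> (real (Suc k) + c) * (r - t)" using False by (simp add: field_simps)
    then have "(real (Suc k) + c) * (t - r) + 1 \<le> 0" by (simp add: algebra_simps)
    then show "ramp ((real (Suc k) + c) * (t - r) + 1) = indicator {r..} t"
      using False by (simp add: ramp_eq_0)
  qed
qed

text \<open>The radial cutoff is a difference of two steps, rising up to r1 and falling up to r2. In
  polar coordinates its derivative is a difference of two approximate identities, which pick out the
  weighted fluxes at r1 and at r2.\<close>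

theorem divergence_half_annulus:
  fixes F :: "(real^'n) \<times> real \<Rightarrow> (real^'n) \<times> real"
  assumes b: "-1 < b" and F: "continuous_on upper_half F"
    and DF: "\<And>e. e \<in> Basis \<Longrightarrow> continuous_on upper_half (DF e)"
    and D: "\<And>X e. X \<in> upper_half \<Longrightarrow> e \<in> Basis \<Longrightarrow>
      ((\<lambda>t. F (X + t *\<^sub>R e) \<bullet> e) has_real_derivative DF e X) (at 0)"
    and d: "continuous_on (closed_upper_half - {0}) d"
      "\<And>X. X \<in> upper_half \<Longrightarrow> (\<Sum>e\<in>Basis. DF e X) = snd X powr b * d X"
    and f: "continuous_on (closed_upper_half - {0}) f"
      "\<And>X. X \<in> upper_half \<Longrightarrow> F X \<bullet> (X /\<^sub>R norm X) = snd X powr b * f X"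
    and h: "continuous_on (closed_upper_half - {0}) h" "\<And>X. X \<in> upper_half \<Longrightarrow> snd (F X) = h X"
    and r: "0 < r1" "r1 < r2"
  shows "r2 powr (real CARD('n) + b) * (\<integral>\<theta>. f (r2 *\<^sub>R \<theta>) \<partial>weighted_half_sphere b)
      - r1 powr (real CARD('n) + b) * (\<integral>\<theta>. f (r1 *\<^sub>R \<theta>) \<partial>weighted_half_sphere b)
    = (\<integral>X. indicator {X \<in> upper_half. r1 \<le> norm X \<and> norm X < r2} X * (snd X powr b * d X) \<partial>lborel)
      + (\<integral>x. indicator {x. r1 \<le> norm x \<and> norm x < r2} x * h (x, 0) \<partial>lborel)"
proof -
  let ?M = "weighted_half_sphere b :: ((real^'n) \<times> real) measure"
  interpret param_measure ?M closed_half_sphere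
    by (rule param_measure_half_sphere[OF b])
  \<comment> \<open>The offset 2 / r1 forces 1 / \<kappa> < r1 / 2, so the rise before r1 stays
    beyond radius r1 / 2.\<close>
  define \<kappa> where "\<kappa> = (\<lambda>k. real (Suc k) + 2 / r1)"
  define s where "s = (\<lambda>k r t. ramp (\<kappa> k * (t - r) + 1))"
  define s' where "s' = (\<lambda>k r t. \<kappa> k * ramp' (\<kappa> k * (t - r) + 1))"
  define \<phi> where "\<phi> = (\<lambda>k t. s k r1 t - s k r2 t)"
  define \<phi>' where "\<phi>' = (\<lambda>k t. s' k r1 t - s' k r2 t)"
  have \<kappa>pos: "0 < \<kappa> k" for k using r by (simp add: \<kappa>_def add_pos_pos)
  have \<kappa>big: "1 / \<kappa> k < r1 / 2" for k
  proof -
    have "2 / r1 < \<kappa> k" by (simp add: \<kappa>_def)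
    then show ?thesis using r \<kappa>pos[of k] by (simp add: field_simps)
  qed
  have ds: "(s k r has_real_derivative s' k r t) (at t)" for k r t
  proof -
    have "((\<lambda>t. \<kappa> k * (t - r) + 1) has_real_derivative \<kappa> k) (at t)"
      by (auto intro!: derivative_eq_intros)
    from DERIV_chain2[OF DERIV_ramp this] show ?thesis by (simp add: s_def s'_def mult.commute)
  qed
  have low: "\<kappa> k * (t - r) + 1 \<le> 0" if "t \<le> r1 / 2" "r1 \<le> r" for k t r
  proof -
    have "1 / \<kappa> k \<le> r - t" using \<kappa>big[of k] that by linarith
    then have "1 \<le> \<kappa> k * (r - t)" using \<kappa>pos[of k] by (simp add: field_simps)
    then show ?thesis by (simp add: algebra_simps)
  qed
  have high: "1 \<le> \<kappa> k * (t - r) + 1" if "r \<le> t" for k t r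
    using \<kappa>pos[of k] that by simp
  have supp: "\<phi> k t = 0" "\<phi>' k t = 0" if "t \<notin> {r1 / 2<..<r2 + 1}" for k t
  proof -
    have "t \<le> r1 / 2 \<or> r2 \<le> t" using that by auto
    then show "\<phi> k t = 0" "\<phi>' k t = 0"
      using low[of t r1 k] low[of t r2 k] high[of r1 t k] high[of r2 t k] r
      by (auto simp: \<phi>_def \<phi>'_def s_def s'_def ramp_eq_0 ramp_eq_1 ramp'_eq_0)
  qed
  have d\<phi>: "(\<phi> k has_real_derivative \<phi>' k t) (at t)" for k t
    unfolding \<phi>_def \<phi>'_def by (intro DERIV_diff ds)
  have c\<phi>': "continuous_on UNIV (\<phi>' k)" for k
    unfolding \<phi>'_def s'_def
    by (intro continuous_intros continuous_on_compose2[OF continuous_on_ramp'[of UNIV]]) auto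
  have \<phi>1: "\<bar>\<phi> k t\<bar> \<le> 1" for k t
    using ramp_nonneg[of "\<kappa> k * (t - r1) + 1"] ramp_le_1[of "\<kappa> k * (t - r1) + 1"]
      ramp_nonneg[of "\<kappa> k * (t - r2) + 1"] ramp_le_1[of "\<kappa> k * (t - r2) + 1"]
    by (auto simp: \<phi>_def s_def)
  have lim\<phi>: "(\<lambda>k. \<phi> k t) \<longlonglongrightarrow> indicator {r1..<r2} t" for t
  proof -
    have "(\<lambda>k. \<phi> k t) \<longlonglongrightarrow> indicator {r1..} t - indicator {r2..} t"
      unfolding \<phi>_def s_def \<kappa>_def by (intro tendsto_diff tendsto_ramp_step)
    also have "indicator {r1..} t - indicator {r2..} t = (indicator {r1..<r2} t :: real)"
      using r by (auto simp: indicator_def)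
    finally show ?thesis .
  qed
  have \<phi>m: "\<phi> k \<in> borel_measurable borel" for k
    using d\<phi> by (intro borel_measurable_continuous_onI continuous_at_imp_continuous_on) (auto intro: DERIV_isCont)
  have \<phi>'m: "\<phi>' k \<in> borel_measurable borel" for k
    using c\<phi>' by (rule borel_measurable_continuous_onI)
  define I1 where "I1 = (\<lambda>k. \<integral>X. indicator upper_half X * (snd X powr b * (\<phi> k (norm X) * d X)) \<partial>lborel)"
  define I2 where "I2 = (\<lambda>k. \<integral>X. indicator upper_half X * (snd X powr b * (\<phi>' k (norm X) * f X)) \<partial>lborel)"
  define I3 where "I3 = (\<lambda>k. \<integral>x. \<phi> k (norm x) * h (x, 0 :: real) \<partial>(lborel :: (real^'n) measure))"
  have eq0: "I1 k + I2 k + I3 k = 0" for k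
    unfolding I1_def I2_def I3_def
    by (rule divergence_radial[where r = "r1 / 2" and R = "r2 + 1" and \<phi> = "\<phi> k" and \<phi>' = "\<phi>' k",
          OF b F DF D d f h d\<phi> c\<phi>' supp(1) supp(2)]) (use r in auto)
  obtain Cd where Cd: "0 \<le> Cd" "\<And>X. X \<in> closed_upper_half \<Longrightarrow> r1 / 2 \<le> norm X \<Longrightarrow> norm X \<le> r2 + 1 \<Longrightarrow> \<bar>d X\<bar> \<le> Cd"
    using bounded_half_annulus[OF d(1), of "r1 / 2" "r2 + 1"] r(1) by (metis half_gt_zero)
  obtain Ch where Ch: "0 \<le> Ch" "\<And>X. X \<in> closed_upper_half \<Longrightarrow> r1 / 2 \<le> norm X \<Longrightarrow> norm X \<le> r2 + 1 \<Longrightarrow> \<bar>h X\<bar> \<le> Ch"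
    using bounded_half_annulus[OF h(1), of "r1 / 2" "r2 + 1"] r(1) by (metis half_gt_zero)
  have lim1: "I1 \<longlonglongrightarrow> (\<integral>X. indicator {X \<in> upper_half. r1 \<le> norm X \<and> norm X < r2} X * (snd X powr b * d X) \<partial>lborel)"
    unfolding I1_def
  proof (rule integral_dominated_convergence[where w = "\<lambda>X. Cd * (indicator (upper_half \<inter> ball 0 (r2 + 1)) X * snd X powr b)"])
    have dm: "(\<lambda>X. indicator upper_half X * d X) \<in> borel_measurable borel"
      by (rule measurable_on_upper_half[OF d(1)])
    have "(\<lambda>X. indicator {r1..<r2} (norm X) * (snd X powr b * (indicator upper_half X * d X))) \<in> borel_measurable borel"
      using dm by measurable
    moreover have "indicator {r1..<r2} (norm X) * (snd X powr b * (indicator upper_half X * d X)) =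
      indicator {X \<in> upper_half. r1 \<le> norm X \<and> norm X < r2} X * (snd X powr b * d X)" for X
      by (cases "X \<in> upper_half"; cases "r1 \<le> norm X \<and> norm X < r2") (simp_all del: split_paired_All)
    ultimately show "(\<lambda>X. indicator {X \<in> upper_half. r1 \<le> norm X \<and> norm X < r2} X * (snd X powr b * d X)) \<in> borel_measurable lborel"
      by (simp only: measurable_lborel2)
    show "(\<lambda>X. indicator upper_half X * (snd X powr b * (\<phi> k (norm X) * d X))) \<in> borel_measurable lborel" for k
    proof -
      have "(\<lambda>X. snd X powr b * (\<phi> k (norm X) * (indicator upper_half X * d X))) \<in> borel_measurable borel"
        using dm \<phi>m[of k] by measurable
      then show ?thesis by (simp add: mult.left_commute)
    qed
    show "integrable lborel (\<lambda>X :: (real^'n) \<times> real. Cd * (indicator (upper_half \<inter> ball 0 (r2 + 1)) X * snd X powr b))"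
      by (intro integrable_mult_right integrable_powr_ball b)
    show "AE X in lborel. (\<lambda>k. indicator upper_half X * (snd X powr b * (\<phi> k (norm X) * d X))) \<longlonglongrightarrow>
      indicator {X \<in> upper_half. r1 \<le> norm X \<and> norm X < r2} X * (snd X powr b * d X)"
    proof (rule AE_I2)
      fix X :: "(real^'n) \<times> real"
      have "(\<lambda>k. indicator upper_half X * (snd X powr b * (\<phi> k (norm X) * d X))) \<longlonglongrightarrow>
        indicator upper_half X * (snd X powr b * (indicator {r1..<r2} (norm X) * d X))"
        by (intro tendsto_intros lim\<phi>)
      also have "indicator upper_half X * (snd X powr b * (indicator {r1..<r2} (norm X) * d X)) =
        indicator {X \<in> upper_half. r1 \<le> norm X \<and> norm X < r2} X * (snd X powr b * d X)"
        by (cases "X \<in> upper_half"; cases "r1 \<le> norm X \<and> norm X < r2") simp_all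
      finally show "(\<lambda>k. indicator upper_half X * (snd X powr b * (\<phi> k (norm X) * d X))) \<longlonglongrightarrow>
        indicator {X \<in> upper_half. r1 \<le> norm X \<and> norm X < r2} X * (snd X powr b * d X)" .
    qed
    show "AE X in lborel. norm (indicator upper_half X * (snd X powr b * (\<phi> k (norm X) * d X))) \<le>
      Cd * (indicator (upper_half \<inter> ball 0 (r2 + 1)) X * snd X powr b)" for k
    proof (rule AE_I2)
      fix X :: "(real^'n) \<times> real"
      show "norm (indicator upper_half X * (snd X powr b * (\<phi> k (norm X) * d X))) \<le>
        Cd * (indicator (upper_half \<inter> ball 0 (r2 + 1)) X * snd X powr b)"
      proof (cases "X \<in> upper_half \<and> norm X \<in> {r1 / 2<..<r2 + 1}")
        case True
        then have "\<bar>d X\<bar> \<le> Cd" using upper_half_subset_closed by (intro Cd(2)) auto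
        then have "\<bar>\<phi> k (norm X)\<bar> * \<bar>d X\<bar> \<le> 1 * Cd" by (intro mult_mono \<phi>1) auto
        then show ?thesis using True by (simp add: abs_mult mult.commute[of Cd] mult_left_mono)
      next
        case False
        then show ?thesis using supp(1)[of "norm X" k] Cd(1) by (cases "X \<in> upper_half") auto
      qed
    qed
  qed
  have lim3: "I3 \<longlonglongrightarrow> (\<integral>x. indicator {x. r1 \<le> norm x \<and> norm x < r2} x * h (x, 0) \<partial>(lborel :: (real^'n) measure))"
    unfolding I3_def
  proof (rule integral_dominated_convergence[where w = "\<lambda>x. Ch * indicator (cball 0 (r2 + 1)) x"])
    have "continuous_on (UNIV - {0 :: real^'n}) (\<lambda>x. h (x, 0))"
      by (rule continuous_on_compose2[OF h(1)]) (auto intro!: continuous_intros simp: closed_upper_half_def zero_prod_def)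
    then have hm: "(\<lambda>x. indicator (UNIV - {0}) x *\<^sub>R h (x, 0)) \<in> borel_measurable (borel :: (real^'n) measure)"
      by (intro borel_measurable_continuous_on_indicator) auto
    have "(\<lambda>x. indicator {r1..<r2} (norm x) * (indicator (UNIV - {0}) x *\<^sub>R h (x, 0))) \<in> borel_measurable (borel :: (real^'n) measure)"
      using hm by measurable
    also have "(\<lambda>x. indicator {r1..<r2} (norm x) * (indicator (UNIV - {0}) x *\<^sub>R h (x, 0))) =
      (\<lambda>x :: real^'n. indicator {x. r1 \<le> norm x \<and> norm x < r2} x * h (x, 0))"
      using r by (auto simp: fun_eq_iff indicator_def)
    finally show "(\<lambda>x. indicator {x. r1 \<le> norm x \<and> norm x < r2} x * h (x, 0)) \<in> borel_measurable (lborel :: (real^'n) measure)"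
      by (simp only: measurable_lborel2)
    show "(\<lambda>x. \<phi> k (norm x) * h (x, 0)) \<in> borel_measurable (lborel :: (real^'n) measure)" for k
    proof -
      have "(\<lambda>x. \<phi> k (norm x) * (indicator (UNIV - {0}) x *\<^sub>R h (x, 0))) \<in> borel_measurable (borel :: (real^'n) measure)"
        using hm \<phi>m[of k] by measurable
      also have "(\<lambda>x. \<phi> k (norm x) * (indicator (UNIV - {0}) x *\<^sub>R h (x, 0))) = (\<lambda>x :: real^'n. \<phi> k (norm x) * h (x, 0))"
        using supp(1)[of 0 k] r by (auto simp: fun_eq_iff indicator_def)
      finally show ?thesis by simp
    qed
    show "integrable lborel (\<lambda>x :: real^'n. Ch * indicator (cball 0 (r2 + 1)) x)"
      by (intro integrable_mult_right integrable_indicator_cball)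
    show "AE x in lborel. (\<lambda>k. \<phi> k (norm x) * h (x, 0)) \<longlonglongrightarrow>
      indicator {x :: real^'n. r1 \<le> norm x \<and> norm x < r2} x * h (x, 0)"
    proof (rule AE_I2)
      fix x :: "real^'n"
      have "(\<lambda>k. \<phi> k (norm x) * h (x, 0)) \<longlonglongrightarrow> indicator {r1..<r2} (norm x) * h (x, 0)"
        by (intro tendsto_intros lim\<phi>)
      then show "(\<lambda>k. \<phi> k (norm x) * h (x, 0)) \<longlonglongrightarrow>
        indicator {x :: real^'n. r1 \<le> norm x \<and> norm x < r2} x * h (x, 0)"
        by (simp add: indicator_def)
    qed
    show "AE x in lborel. norm (\<phi> k (norm x) * h (x, 0)) \<le> Ch * indicator (cball (0 :: real^'n) (r2 + 1)) x" for k
    proof (rule AE_I2)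
      fix x :: "real^'n"
      show "norm (\<phi> k (norm x) * h (x, 0)) \<le> Ch * indicator (cball 0 (r2 + 1)) x"
      proof (cases "norm x \<in> {r1 / 2<..<r2 + 1}")
        case True
        then have "\<bar>h (x, 0)\<bar> \<le> Ch" by (intro Ch(2)) (auto simp: closed_upper_half_def norm_Pair)
        then have "\<bar>\<phi> k (norm x)\<bar> * \<bar>h (x, 0)\<bar> \<le> 1 * Ch" by (intro mult_mono \<phi>1) auto
        then show ?thesis using True by (simp add: abs_mult)
      next
        case False
        then show ?thesis using supp(1)[of "norm x" k] Ch(1) by auto
      qed
    qed
  qed
  define A where "A = (\<lambda>t. \<integral>\<theta>. f (t *\<^sub>R \<theta>) \<partial>?M)"
  define B where "B = (\<lambda>t. indicator {0<..} t * (t powr (real CARD('n) + b) * A t))"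
  have contB0: "continuous_on {0<..} (\<lambda>t. t powr (real CARD('n) + b) * A t)"
  proof (intro continuous_intros continuous_at_imp_continuous_on ballI)
    fix t :: real assume "t \<in> {0<..}"
    then show "isCont A t"
      unfolding A_def by (intro isCont_integral adm_ray[OF b f(1)]) auto
  qed auto
  have contB: "continuous_on {0<..} B"
    by (rule continuous_on_eq[OF contB0]) (simp add: B_def)
  have Bm: "B \<in> borel_measurable borel"
    using borel_measurable_continuous_on_indicator[OF _ contB0] by (simp add: B_def)
  have "compact (B ` {r1 / 2..r2})"
    using r by (intro compact_continuous_image continuous_on_subset[OF contB]) auto
  then obtain CB where CB: "\<forall>t\<in>{r1 / 2..r2}. \<bar>B t\<bar> \<le> CB"
    using compact_imp_bounded by (force simp: bounded_iff)
  have kern: "(\<lambda>k. \<integral>t. s' k \<rho> t * B t \<partial>lborel) \<longlonglongrightarrow> B \<rho>" and kerni: "\<And>k. integrable lborel (\<lambda>t. s' k \<rho> t * B t)"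
    if \<rho>: "\<rho> \<in> {r1, r2}" for \<rho>
  proof -
    \<comment> \<open>The step at \<rho> rises on (\<rho> - 1 / \<kappa>, \<rho>), so
      \<open>ramp_kernel\<close> is used with the moving starting point \<rho> - 1 /
      \<kappa>.\<close>
    have se: "s' k \<rho> t = \<kappa> k * ramp' (\<kappa> k * (t - (\<rho> - 1 / \<kappa> k)))" for k t
    proof -
      have "\<kappa> k * (t - \<rho>) + 1 = \<kappa> k * (t - (\<rho> - 1 / \<kappa> k))"
        using \<kappa>pos[of k] by (simp add: field_simps)
      then show ?thesis by (simp only: s'_def)
    qed
    have pt: "\<rho> - 1 / \<kappa> k + z / \<kappa> k \<in> {r1 / 2..r2}" if z: "z \<in> {0<..<1}" for z k
    proof -
      have "z / \<kappa> k \<le> 1 / \<kappa> k" "0 \<le> z / \<kappa> k" using z \<kappa>pos[of k] by (auto simp: divide_right_mono)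
      moreover have "r1 \<le> \<rho>" "\<rho> \<le> r2" using \<rho> r by auto
      ultimately have "r1 / 2 \<le> \<rho> - 1 / \<kappa> k + z / \<kappa> k" "\<rho> - 1 / \<kappa> k + z / \<kappa> k \<le> r2"
        using \<kappa>big[of k] by linarith+
      then show ?thesis by simp
    qed
    show "(\<lambda>k. \<integral>t. s' k \<rho> t * B t \<partial>lborel) \<longlonglongrightarrow> B \<rho>"
      unfolding se
    proof (rule ramp_kernel[OF Bm \<kappa>pos, where C = CB])
      fix z :: real assume z: "z \<in> {0<..<1}"
      have "filterlim \<kappa> at_top sequentially"
        unfolding \<kappa>_def
        by (rule filterlim_tendsto_add_at_top[OF tendsto_const, THEN filterlim_mono_eventually[OF _ order_refl order_refl]])
          (auto intro!: filterlim_compose[OF filterlim_real_sequentially filterlim_Suc] simp: add.commute)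
      then have "(\<lambda>k. inverse (\<kappa> k)) \<longlonglongrightarrow> 0"
        by (rule tendsto_inverse_0_at_top)
      then have "(\<lambda>k. \<rho> + (z - 1) * inverse (\<kappa> k)) \<longlonglongrightarrow> \<rho> + (z - 1) * 0"
        by (intro tendsto_intros)
      then have "(\<lambda>k. \<rho> - 1 / \<kappa> k + z / \<kappa> k) \<longlonglongrightarrow> \<rho>"
        by (simp add: divide_inverse algebra_simps)
      then show "(\<lambda>k. B (\<rho> - 1 / \<kappa> k + z / \<kappa> k)) \<longlonglongrightarrow> B \<rho>"
      proof (rule continuous_on_tendsto_compose[OF contB])
        show "\<forall>\<^sub>F k in sequentially. \<rho> - 1 / \<kappa> k + z / \<kappa> k \<in> {0<..}"
          using pt[OF z] r by (intro eventuallyI) (auto intro: less_le_trans[of 0 "r1 / 2"])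
      qed (use \<rho> r in auto)
      show "\<bar>B (\<rho> - 1 / \<kappa> k + z / \<kappa> k)\<bar> \<le> CB" for k
        using CB pt[OF z] by blast
    qed
    show "integrable lborel (\<lambda>t. s' k \<rho> t * B t)" for k
    proof (rule Bochner_Integration.integrable_bound)
      show "integrable lborel (\<lambda>t. \<kappa> k * 2 * CB * indicator (cball 0 (\<bar>r1\<bar> + \<bar>r2\<bar>)) t :: real)"
        by (intro integrable_mult_right integrable_indicator_cball)
      show "(\<lambda>t. s' k \<rho> t * B t) \<in> borel_measurable lborel"
        unfolding s'_def using Bm by measurable
      show "AE t in lborel. norm (s' k \<rho> t * B t) \<le> norm (\<kappa> k * 2 * CB * indicator (cball 0 (\<bar>r1\<bar> + \<bar>r2\<bar>)) t)"
      proof (rule AE_I2)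
        fix t :: real
        show "norm (s' k \<rho> t * B t) \<le> norm (\<kappa> k * 2 * CB * indicator (cball 0 (\<bar>r1\<bar> + \<bar>r2\<bar>)) t)"
        proof (cases "t \<in> {r1 / 2..r2}")
          case True
          then have 1: "\<bar>B t\<bar> \<le> \<bar>CB\<bar>" using CB by fastforce
          have "ramp' (\<kappa> k * (t - \<rho>) + 1) \<le> 2"
            by (rule order_trans[OF ramp'_le]) (simp add: indicator_def)
          then have 2: "\<bar>s' k \<rho> t\<bar> \<le> \<kappa> k * 2"
            using \<kappa>pos[of k] ramp'_nonneg[of "\<kappa> k * (t - \<rho>) + 1"] by (simp add: s'_def abs_mult)
          have "\<bar>s' k \<rho> t\<bar> * \<bar>B t\<bar> \<le> \<kappa> k * 2 * \<bar>CB\<bar>"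
            using 1 2 \<kappa>pos[of k] by (intro mult_mono) auto
          moreover have "t \<in> cball 0 (\<bar>r1\<bar> + \<bar>r2\<bar>)" using True r by auto
          ultimately show ?thesis using \<kappa>pos[of k] by (simp add: abs_mult)
        next
          case False
          then have "t \<le> r1 / 2 \<or> r2 \<le> t" by auto
          then have "s' k \<rho> t = 0"
            using low[of t \<rho> k] high[of \<rho> t k] \<rho> r by (auto simp: s'_def ramp'_eq_0)
          then show ?thesis by simp
        qed
      qed
    qed
  qed
  have I2: "I2 k = (\<integral>t. s' k r1 t * B t \<partial>lborel) - (\<integral>t. s' k r2 t * B t \<partial>lborel)" for k
  proof -
    have contf: "continuous_on (closed_upper_half - {0}) (\<lambda>X. \<phi>' k (norm X) * f X)"
      by (intro continuous_intros f continuous_on_compose2[OF c\<phi>']) auto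
    obtain Cp' where Cp': "0 \<le> Cp'" "\<And>t. \<bar>\<phi>' k t\<bar> \<le> Cp'"
    proof -
      have "\<phi>' k t = 0" if "r1 + r2 + 1 < norm t" for t using that r by (intro supp) auto
      then show thesis using bounded_continuous_bounded_support[OF c\<phi>'] that by blast
    qed
    obtain Cf where Cf: "0 \<le> Cf" "\<And>X. X \<in> closed_upper_half \<Longrightarrow> r1 / 2 \<le> norm X \<Longrightarrow> norm X \<le> r2 + 1 \<Longrightarrow> \<bar>f X\<bar> \<le> Cf"
      using bounded_half_annulus[OF f(1), of "r1 / 2" "r2 + 1"] r(1) by (metis half_gt_zero)
    have bf: "\<bar>\<phi>' k (norm X) * f X\<bar> \<le> Cp' * Cf" if "X \<in> upper_half" for X
    proof (cases "norm X \<in> {r1 / 2<..<r2 + 1}")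
      case True
      then have "\<bar>f X\<bar> \<le> Cf" using that upper_half_subset_closed by (intro Cf(2)) auto
      then show ?thesis using Cp' by (simp add: abs_mult mult_mono)
    next
      case False
      then show ?thesis using supp(2)[OF False] Cp'(1) Cf(1) by simp
    qed
    have intf: "integrable lborel (\<lambda>X. indicator upper_half X * (snd X powr b * (\<phi>' k (norm X) * f X)))"
      by (rule integrable_weighted_upper_half[OF b measurable_on_upper_half[OF contf] bf, of "r2 + 1"])
        (simp_all add: supp)
    have "I2 k = (\<integral>t. indicator {0<..} t * (t powr (real CARD('n) + b) *
      (\<integral>\<theta>. \<phi>' k (norm (t *\<^sub>R \<theta>)) * f (t *\<^sub>R \<theta>) \<partial>?M)) \<partial>lborel)"
      unfolding I2_def by (rule integral_polar_upper_half[OF b measurable_on_upper_half[OF contf] intf])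
    also have "\<dots> = (\<integral>t. s' k r1 t * B t - s' k r2 t * B t \<partial>lborel)"
    proof (rule Bochner_Integration.integral_cong[OF refl])
      fix t :: real
      have eq: "(\<integral>\<theta>. \<phi>' k (norm (t *\<^sub>R \<theta>)) * f (t *\<^sub>R \<theta>) \<partial>?M) = \<phi>' k t * A t" if "0 < t"
      proof -
        have "(\<integral>\<theta>. \<phi>' k (norm (t *\<^sub>R \<theta>)) * f (t *\<^sub>R \<theta>) \<partial>?M) = (\<integral>\<theta>. \<phi>' k t * f (t *\<^sub>R \<theta>) \<partial>?M)"
          using that by (intro Bochner_Integration.integral_cong) (auto simp: half_sphere_def)
        also have "\<dots> = \<phi>' k t * A t" unfolding A_def by (rule integral_mult_right_zero)
        finally show ?thesis .
      qed
      show "indicator {0<..} t * (t powr (real CARD('n) + b) *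
        (\<integral>\<theta>. \<phi>' k (norm (t *\<^sub>R \<theta>)) * f (t *\<^sub>R \<theta>) \<partial>?M)) = s' k r1 t * B t - s' k r2 t * B t"
      proof (cases "0 < t")
        case True
        show ?thesis
          unfolding eq[OF True] using True by (simp add: B_def \<phi>'_def algebra_simps)
      qed (simp add: B_def)
    qed
    also have "\<dots> = (\<integral>t. s' k r1 t * B t \<partial>lborel) - (\<integral>t. s' k r2 t * B t \<partial>lborel)"
      by (intro Bochner_Integration.integral_diff kerni) auto
    finally show ?thesis .
  qed
  have "(\<lambda>k. I1 k + I2 k + I3 k) \<longlonglongrightarrow>
    (\<integral>X. indicator {X \<in> upper_half. r1 \<le> norm X \<and> norm X < r2} X * (snd X powr b * d X) \<partial>lborel)
    + (B r1 - B r2) + (\<integral>x. indicator {x. r1 \<le> norm x \<and> norm x < r2} x * h (x, 0) \<partial>(lborel :: (real^'n) measure))"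
    unfolding I2 by (intro tendsto_intros lim1 lim3 kern) auto
  then have "(\<integral>X. indicator {X \<in> upper_half. r1 \<le> norm X \<and> norm X < r2} X * (snd X powr b * d X) \<partial>lborel)
    + (B r1 - B r2) + (\<integral>x. indicator {x. r1 \<le> norm x \<and> norm x < r2} x * h (x, 0) \<partial>(lborel :: (real^'n) measure)) = 0"
    unfolding eq0 using LIMSEQ_unique[OF _ tendsto_const] by blast
  then show ?thesis
    using r by (simp add: B_def A_def algebra_simps)
qed

lemma (in param_measure) adm_deriv_dilate:
  assumes "adm_deriv f f'" "0 < c"
  shows "adm_deriv (\<lambda>t. f (c * t)) (\<lambda>t \<theta>. c * f' (c * t) \<theta>)"
  unfolding adm_deriv_def
proof (intro conjI allI impI ballI)
  note f = adm_derivD[OF assms(1)]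
  show "adm (\<lambda>t. f (c * t))" by (rule adm_dilate[OF f(1) assms(2)])
  show "adm (\<lambda>t \<theta>. c * f' (c * t) \<theta>)"
    by (intro adm_mult adm_const adm_dilate[OF f(2) assms(2)])
  fix t \<theta> assume t: "(0::real) < t" "\<theta> \<in> space M"
  have "((\<lambda>t. c * t) has_real_derivative c) (at t)"
    by (auto intro!: derivative_eq_intros)
  from DERIV_chain2[OF f(3)[of "c * t", OF _ t(2)] this]
  show "((\<lambda>t. f (c * t) \<theta>) has_real_derivative c * f' (c * t) \<theta>) (at t)"
    using t assms(2) by (simp add: mult.commute)
qed

text \<open>With no contribution from y = 0, the divergence theorem and polar coordinates express
  the flux difference between two radii as an integral of a continuous function of the radius. Its
  derivative involves the half-sphere alone, so integration by parts there needs no calculus on the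
  sphere.\<close>

lemma has_real_derivative_flux_average:
  fixes F :: "(real^'n) \<times> real \<Rightarrow> (real^'n) \<times> real"
  assumes b: "-1 < b" and F: "continuous_on upper_half F"
    and DF: "\<And>e. e \<in> Basis \<Longrightarrow> continuous_on upper_half (DF e)"
    and D: "\<And>X e. X \<in> upper_half \<Longrightarrow> e \<in> Basis \<Longrightarrow>
      ((\<lambda>t. F (X + t *\<^sub>R e) \<bullet> e) has_real_derivative DF e X) (at 0)"
    and d: "continuous_on (closed_upper_half - {0}) d"
      "\<And>X. X \<in> upper_half \<Longrightarrow> (\<Sum>e\<in>Basis. DF e X) = snd X powr b * d X"
    and f: "continuous_on (closed_upper_half - {0}) f"
      "\<And>X. X \<in> upper_half \<Longrightarrow> F X \<bullet> (X /\<^sub>R norm X) = snd X powr b * f X"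
    and h: "continuous_on (closed_upper_half - {0}) h" "\<And>X. X \<in> upper_half \<Longrightarrow> snd (F X) = h X"
    and h0: "\<And>x. x \<noteq> 0 \<Longrightarrow> h (x, 0) = 0" and t: "0 < t"
  shows "((\<lambda>t. t powr (real CARD('n) + b) * (\<integral>\<theta>. f (t *\<^sub>R \<theta>) \<partial>weighted_half_sphere b)) has_real_derivative
    t powr (real CARD('n) + b) * (\<integral>\<theta>. d (t *\<^sub>R \<theta>) \<partial>weighted_half_sphere b)) (at t)"
proof -
  let ?M = "weighted_half_sphere b :: ((real^'n) \<times> real) measure"
  interpret param_measure ?M closed_half_sphere
    by (rule param_measure_half_sphere[OF b])
  define \<Phi> where "\<Phi> = (\<lambda>t. t powr (real CARD('n) + b) * (\<integral>\<theta>. f (t *\<^sub>R \<theta>) \<partial>?M))"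
  define \<psi> where "\<psi> = (\<lambda>t. t powr (real CARD('n) + b) * (\<integral>\<theta>. d (t *\<^sub>R \<theta>) \<partial>?M))"
  have cont\<psi>: "continuous_on {0<..} \<psi>"
    unfolding \<psi>_def
  proof (intro continuous_intros continuous_at_imp_continuous_on ballI)
    fix t :: real assume "t \<in> {0<..}"
    then show "isCont (\<lambda>t. \<integral>\<theta>. d (t *\<^sub>R \<theta>) \<partial>?M) t"
      by (intro isCont_integral adm_ray[OF b d(1)]) auto
  qed auto
  have diff: "\<Phi> r2 = \<Phi> r1 + integral {r1..r2} \<psi>" if r: "0 < r1" "r1 < r2" for r1 r2
  proof -
    have z: "indicator {x. r1 \<le> norm x \<and> norm x < r2} x * h (x, 0) = 0" for x
      using h0[of x] r by (cases "x = 0") auto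
    have dm: "(\<lambda>X. indicator {r1..<r2} (norm X) * (indicator upper_half X * d X)) \<in> borel_measurable borel"
      using measurable_on_upper_half[OF d(1)] by measurable
    let ?g = "\<lambda>X. indicator {r1..<r2} (norm X) * d X"
    have gm: "(\<lambda>X. indicator upper_half X * ?g X) \<in> borel_measurable borel"
      using dm by (simp only: mult.left_commute)
    obtain C where C: "0 \<le> C" "\<And>X. X \<in> closed_upper_half \<Longrightarrow> r1 \<le> norm X \<Longrightarrow> norm X \<le> r2 \<Longrightarrow> \<bar>d X\<bar> \<le> C"
      using bounded_half_annulus[OF d(1) r(1), of r2] by metis
    have gb: "\<bar>?g X\<bar> \<le> C" if "X \<in> upper_half" for X
    proof (cases "norm X \<in> {r1..<r2}")
      case True
      then have "\<bar>d X\<bar> \<le> C" using that upper_half_subset_closed by (intro C(2)) auto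
      then show ?thesis using True by simp
    next
      case False
      then show ?thesis using C(1) by simp
    qed
    have int: "integrable lborel (\<lambda>X. indicator upper_half X * (snd X powr b * ?g X))"
      by (rule integrable_weighted_upper_half[OF b gm gb, of r2]) simp_all
    have "\<Phi> r2 - \<Phi> r1 = (\<integral>X. indicator {X \<in> upper_half. r1 \<le> norm X \<and> norm X < r2} X * (snd X powr b * d X) \<partial>lborel)"
      unfolding \<Phi>_def
      using divergence_half_annulus[OF b F DF D d f h r] by (simp add: z)
    also have "\<dots> = (\<integral>X. indicator upper_half X * (snd X powr b * ?g X) \<partial>lborel)"
      by (rule Bochner_Integration.integral_cong[OF refl]) (simp add: indicator_def of_bool_conj)
    also have "\<dots> = (\<integral>t. indicator {0<..} t * (t powr (real CARD('n) + b) * (\<integral>\<theta>. ?g (t *\<^sub>R \<theta>) \<partial>?M)) \<partial>lborel)"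
      by (rule integral_polar_upper_half[OF b gm int])
    also have "\<dots> = (\<integral>t. indicator {r1..r2} t *\<^sub>R \<psi> t \<partial>lborel)"
    proof (rule integral_cong_AE)
      have i: "(\<lambda>t. indicator {0<..} t *\<^sub>R \<psi> t) \<in> borel_measurable borel"
        by (rule borel_measurable_continuous_on_indicator[OF _ cont\<psi>]) simp
      have eq: "indicator {0<..} t * (t powr (real CARD('n) + b) * (\<integral>\<theta>. ?g (t *\<^sub>R \<theta>) \<partial>?M)) =
        indicator {r1..<r2} t * (indicator {0<..} t *\<^sub>R \<psi> t)" for t
      proof (cases "0 < t")
        case True
        have "(\<integral>\<theta>. ?g (t *\<^sub>R \<theta>) \<partial>?M) = (\<integral>\<theta>. indicator {r1..<r2} t * d (t *\<^sub>R \<theta>) \<partial>?M)"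
          using True by (intro Bochner_Integration.integral_cong) (auto simp: half_sphere_def)
        also have "\<dots> = indicator {r1..<r2} t * (\<integral>\<theta>. d (t *\<^sub>R \<theta>) \<partial>?M)"
          by (rule integral_mult_right_zero)
        finally show ?thesis using True by (simp add: \<psi>_def)
      qed simp
      show "(\<lambda>t. indicator {0<..} t * (t powr (real CARD('n) + b) * (\<integral>\<theta>. ?g (t *\<^sub>R \<theta>) \<partial>?M))) \<in> borel_measurable lborel"
        unfolding eq using i by measurable
      have "(\<lambda>t. indicator {r1..r2} t * (indicator {0<..} t *\<^sub>R \<psi> t)) \<in> borel_measurable borel"
        using i by measurable
      moreover have "indicator {r1..r2} t * (indicator {0<..} t *\<^sub>R \<psi> t) = indicator {r1..r2} t *\<^sub>R \<psi> t" for t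
        using r by (auto simp: indicator_def)
      ultimately show "(\<lambda>t. indicator {r1..r2} t *\<^sub>R \<psi> t) \<in> borel_measurable lborel"
        by (simp only: measurable_lborel2)
      \<comment> \<open>The half-open annulus misses the radius \<open>r2\<close>, which is
        null.\<close>
      show "AE t in lborel. indicator {0<..} t * (t powr (real CARD('n) + b) * (\<integral>\<theta>. ?g (t *\<^sub>R \<theta>) \<partial>?M)) = indicator {r1..r2} t *\<^sub>R \<psi> t"
        unfolding eq using AE_lborel_singleton[of r2]
      proof eventually_elim
        fix t assume "t \<noteq> r2"
        then show "indicator {r1..<r2} t * (indicator {0<..} t *\<^sub>R \<psi> t) = indicator {r1..r2} t *\<^sub>R \<psi> t"
          using r by (auto simp: indicator_def)
      qed
    qed
    also have "\<dots> = integral {r1..r2} \<psi>"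
    proof -
      have "continuous_on {r1..r2} \<psi>" using r by (intro continuous_on_subset[OF cont\<psi>]) auto
      then have "set_integrable lborel {r1..r2} \<psi>"
        unfolding set_integrable_def by (rule borel_integrable_compact[OF compact_Icc])
      from set_borel_integral_eq_integral(2)[OF this] show ?thesis
        by (simp add: set_lebesgue_integral_def)
    qed
    finally show ?thesis by simp
  qed
  \<comment> \<open>The interval [t / 2, 2 t] has t in its interior and stays away from 0, where
    \<psi> need not be continuous.\<close>
  have "((\<lambda>x. \<Phi> (t / 2) + integral {t / 2..x} \<psi>) has_real_derivative \<psi> t) (at t within {t / 2..2 * t})"
  proof -
    have "continuous_on {t / 2..2 * t} \<psi>" using t by (intro continuous_on_subset[OF cont\<psi>]) auto
    then have "((\<lambda>x. integral {t / 2..x} \<psi>) has_real_derivative \<psi> t) (at t within {t / 2..2 * t})"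
      using t by (intro integral_has_real_derivative) auto
    then show ?thesis by (auto intro!: derivative_eq_intros)
  qed
  then have "((\<lambda>x. \<Phi> (t / 2) + integral {t / 2..x} \<psi>) has_real_derivative \<psi> t) (at t)"
    using t at_within_Icc_at[of "t / 2" t "2 * t"] by simp
  then have "(\<Phi> has_real_derivative \<psi> t) (at t)"
  proof (rule has_field_derivative_transform_within_open[of _ _ t "{t / 2<..}"])
    show "\<Phi> (t / 2) + integral {t / 2..x} \<psi> = \<Phi> x" if "x \<in> {t / 2<..}" for x
      using diff[of "t / 2" x] that t by simp
  qed (use t in auto)
  then show ?thesis by (simp add: \<Phi>_def \<psi>_def)
qed

section \<open>Traces, flux fields and behaviour near the origin\<close>

lemma extends_continuously_subset:
  "extends_continuously S f \<Longrightarrow> T \<subseteq> S \<Longrightarrow> extends_continuously T f"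
  unfolding extends_continuously_def using continuous_on_subset by blast

text \<open>The boundary conditions are limits in y for each x, while regularity gives an extension
  with unspecified boundary values; uniqueness of limits identifies the two.\<close>

lemma extension_trace:
  fixes f g :: "(real^'n) \<times> real \<Rightarrow> real"
  assumes "continuous_on closed_upper_half g" "\<And>X. X \<in> upper_half \<Longrightarrow> g X = f X"
    and "((\<lambda>y. f (x, y)) \<longlongrightarrow> L) (at_right 0)"
  shows "g (x, 0) = L"
proof -
  have "((\<lambda>y. g (x, y)) \<longlongrightarrow> g (x, 0)) (at_right 0)"
  proof (rule continuous_on_tendsto_compose[OF assms(1)])
    show "((\<lambda>y. (x, y)) \<longlongrightarrow> (x, 0)) (at_right (0::real))" by (intro tendsto_intros)
    show "\<forall>\<^sub>F y in at_right 0. (x, y) \<in> closed_upper_half"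
      by (rule eventually_mono[OF eventually_at_right_less[of 0]]) (simp add: closed_upper_half_def)
  qed (simp add: closed_upper_half_def)
  moreover have "\<forall>\<^sub>F y in at_right 0. g (x, y) = f (x, y)"
    by (rule eventually_mono[OF eventually_at_right_less[of 0]]) (simp add: assms(2) upper_half_def)
  ultimately have "((\<lambda>y. f (x, y)) \<longlongrightarrow> g (x, 0)) (at_right 0)"
    by (rule Lim_transform_eventually)
  then show ?thesis using assms(3) tendsto_unique trivial_limit_at_right_real by blast
qed

lemma differentiable_radial_deriv:
  assumes "C_k 2 upper_half f" "X \<in> upper_half"
  shows "radial_deriv f differentiable (at X)"
proof -
  have c: "C_k (Suc (Suc 0)) upper_half f" using assms(1) by (simp add: numeral_2_eq_2)
  have n: "norm differentiable (at X)" using differentiable_norm_at upper_half_not_0[OF assms(2)] by blast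
  have "(\<lambda>X. (X \<bullet> e) / norm X * partial e f X) differentiable (at X)" if "e \<in> Basis" for e
    using C_k_Suc_differentiable[OF C_k_partial[OF c that] open_upper_half assms(2)] n upper_half_not_0[OF assms(2)]
    by (intro differentiable_mult differentiable_divide differentiable_inner differentiable_ident differentiable_const) auto
  then show ?thesis
    unfolding radial_deriv_eq_sum[abs_def] by (intro differentiable_sum) auto
qed

lemma radial_deriv_dilate:
  assumes "f differentiable (at (c *\<^sub>R X))" "0 < c"
  shows "radial_deriv (\<lambda>X. f (c *\<^sub>R X)) X = c * radial_deriv f (c *\<^sub>R X)"
  using assms(2) by (simp add: radial_deriv_eq_sum partial_dilate[OF assms(1)] sum_distrib_left mult_ac)

lemma continuous_on_flux_field:
  assumes "C_k 1 upper_half g" "C_k 2 upper_half h"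
  shows "continuous_on upper_half (\<lambda>X. (snd X powr b * g X) *\<^sub>R grad h X)"
proof -
  have "C_k (Suc 1) upper_half h" using assms(2) by (simp add: numeral_2_eq_2)
  from C_k_continuous_on[OF C_k_partial[OF this]] show ?thesis
    unfolding grad_def
    by (intro continuous_intros C_k_continuous_on[OF assms(1)]) (auto simp: upper_half_def)
qed

lemma has_real_derivative_flux_field:
  assumes "C_k 1 upper_half g" "C_k 2 upper_half h" "X \<in> upper_half" "e \<in> Basis"
  shows "((\<lambda>t. ((snd (X + t *\<^sub>R e) powr b * g (X + t *\<^sub>R e)) *\<^sub>R grad h (X + t *\<^sub>R e)) \<bullet> e)
    has_real_derivative flux_diag b g h e X) (at 0)"
  using has_real_derivative_flux[OF assms, of b] by (simp add: grad_Basis[OF assms(4)] mult.assoc)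

text \<open>If c > 0, then P' >= c / (2 t) near 0, because t^m <= t for t <= 1. Hence P - (c / 2) ln
  t is nondecreasing there, and P would oscillate by an unbounded multiple of the logarithm.\<close>

lemma no_logarithmic_growth:
  fixes P P' :: "real \<Rightarrow> real"
  assumes d: "\<And>t. 0 < t \<Longrightarrow> t \<le> 1 \<Longrightarrow> (P has_real_derivative P' t) (at t)"
    and bound: "\<And>t. 0 < t \<Longrightarrow> t \<le> 1 \<Longrightarrow> \<bar>P t\<bar> \<le> C"
    and lim: "((\<lambda>t. t powr m * P' t) \<longlongrightarrow> c) (at_right 0)" and m: "1 \<le> m"
  shows "c \<le> 0"
proof (rule ccontr)
  assume "\<not> c \<le> 0"
  then have c: "0 < c" by simp
  then have "\<forall>\<^sub>F t in at_right 0. c / 2 < t powr m * P' t"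
    by (intro order_tendstoD(1)[OF lim]) simp
  then obtain \<delta>0 where \<delta>0: "0 < \<delta>0" "\<And>t. 0 < t \<Longrightarrow> t < \<delta>0 \<Longrightarrow> c / 2 < t powr m * P' t"
    unfolding eventually_at_right_field by blast
  define \<delta> where "\<delta> = min (\<delta>0 / 2) 1"
  have \<delta>: "0 < \<delta>" "\<delta> \<le> 1" "\<delta> < \<delta>0" using \<delta>0(1) by (auto simp: \<delta>_def)
  have C: "0 \<le> C" using bound[of 1] by linarith
  \<comment> \<open>Chosen so that (c / 2) ln (\<delta> / t) = 2 C + c / 2, which exceeds the
    oscillation 2 C that the bound permits.\<close>
  define t where "t = \<delta> * exp (- (4 * C / c + 1))"
  have "0 \<le> 4 * C / c" using C c by simp
  then have t: "0 < t" "t \<le> \<delta>" using \<delta>(1) by (auto simp: t_def)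
  have "P t - c / 2 * ln t \<le> P \<delta> - c / 2 * ln \<delta>"
  proof (rule DERIV_nonneg_imp_nondecreasing[OF t(2)])
    fix x assume x: "t \<le> x" "x \<le> \<delta>"
    have x0: "0 < x" "x \<le> 1" using x t \<delta> by auto
    have lt: "c / 2 < x powr m * P' x" using \<delta>0(2)[of x] x x0 \<delta> by simp
    have "x powr m \<le> x powr 1" using x0 m by (intro powr_mono') auto
    moreover have "0 < P' x"
    proof (rule ccontr)
      assume "\<not> 0 < P' x"
      then have "x powr m * P' x \<le> 0" by (simp add: mult_nonneg_nonpos)
      then show False using lt c by simp
    qed
    ultimately have "x powr m * P' x \<le> x * P' x" using x0 by (simp add: mult_right_mono)
    then have "c / 2 * (1 / x) \<le> P' x" using lt x0 by (simp add: field_simps)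
    moreover have "((\<lambda>x. P x - c / 2 * ln x) has_real_derivative P' x - c / 2 * (1 / x)) (at x)"
      using x0 by (intro DERIV_diff d DERIV_cmult) (auto intro: DERIV_ln_divide)
    ultimately show "\<exists>y. ((\<lambda>x. P x - c / 2 * ln x) has_real_derivative y) (at x) \<and> 0 \<le> y"
      by (intro exI[of _ "P' x - c / 2 * (1 / x)"]) simp
  qed
  moreover have "ln t = ln \<delta> - (4 * C / c + 1)"
    using \<delta>(1) by (simp add: t_def ln_mult)
  ultimately have "c / 2 * (4 * C / c + 1) \<le> P \<delta> - P t"
    by (simp add: algebra_simps)
  also have "\<dots> \<le> 2 * C"
    using bound[of \<delta>] bound[of t] t \<delta> by linarith
  finally have "c / 2 * (4 * C / c + 1) \<le> 2 * C" .
  moreover have "c / 2 * (4 * C / c + 1) = 2 * C + c / 2" using c by (simp add: distrib_left)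
  ultimately show False using c by linarith
qed

text \<open>A bounded function on \<open>(0, 1]\<close> cannot have a derivative like \<open>c t\<^sup>-\<^sup>m\<close> with \<open>m \<ge> 1\<close>. This is
  how the flux through small half-spheres around the origin is shown to vanish, where no bound on
  the gradient of \<open>\<Delta>\<^sub>b u\<close> is available.\<close>

lemma bounded_imp_zero_flux:
  fixes P P' :: "real \<Rightarrow> real"
  assumes d: "\<And>t. 0 < t \<Longrightarrow> t \<le> 1 \<Longrightarrow> (P has_real_derivative P' t) (at t)"
    and bound: "\<And>t. 0 < t \<Longrightarrow> t \<le> 1 \<Longrightarrow> \<bar>P t\<bar> \<le> C"
    and lim: "((\<lambda>t. t powr m * P' t) \<longlongrightarrow> c) (at_right 0)" and m: "1 \<le> m"
  shows "c = 0"
proof -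
  have "c \<le> 0" by (rule no_logarithmic_growth[OF d bound lim m])
  moreover have "- c \<le> 0"
  proof (rule no_logarithmic_growth[OF _ _ _ m])
    show "((\<lambda>t. - P t) has_real_derivative - P' t) (at t)" if "0 < t" "t \<le> 1" for t
      by (intro DERIV_minus d that)
    show "\<bar>- P t\<bar> \<le> C" if "0 < t" "t \<le> 1" for t
      using bound[OF that] by simp
    show "((\<lambda>t. t powr m * - P' t) \<longlongrightarrow> - c) (at_right 0)"
      using tendsto_minus[OF lim] by simp
  qed
  ultimately show ?thesis by simp
qed

lemma tendsto_integral_punctured:
  fixes g :: "'a::euclidean_space \<Rightarrow> real"
  assumes g: "integrable lborel g"
  shows "((\<lambda>r. \<integral>X. indicator {r..} (norm X) * g X \<partial>lborel) \<longlongrightarrow> (\<integral>X. g X \<partial>lborel)) (at_right 0)"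
proof (rule tendsto_at_right_sequentially[of 0 1])
  fix S :: "nat \<Rightarrow> real" assume S: "\<And>n. 0 < S n" "S \<longlonglongrightarrow> 0"
  show "(\<lambda>n. \<integral>X. indicator {S n..} (norm X) * g X \<partial>lborel) \<longlonglongrightarrow> (\<integral>X. g X \<partial>lborel)"
  proof (rule integral_dominated_convergence[where w = "\<lambda>X. \<bar>g X\<bar>"])
    show "(\<lambda>X. indicator {S n..} (norm X) * g X) \<in> borel_measurable lborel" for n
      using borel_measurable_integrable[OF g] by measurable
    show "AE X in lborel. (\<lambda>n. indicator {S n..} (norm X) * g X) \<longlonglongrightarrow> g X"
      using AE_lborel_singleton[of "0::'a"]
    proof eventually_elim
      fix X :: 'a assume "X \<noteq> 0"
      then have "\<forall>\<^sub>F n in sequentially. S n < norm X"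
        by (intro order_tendstoD(2)[OF S(2)]) simp
      then show "(\<lambda>n. indicator {S n..} (norm X) * g X) \<longlonglongrightarrow> g X"
        by (intro tendsto_eventually) (rule eventually_mono, assumption, simp)
    qed
    show "AE X in lborel. norm (indicator {S n..} (norm X) * g X) \<le> \<bar>g X\<bar>" for n
      by (intro AE_I2) (simp add: indicator_def)
  qed (use g in auto)
qed simp

lemma bounded_half_ball:
  fixes g :: "(real^'n) \<times> real \<Rightarrow> real"
  assumes "continuous_on closed_upper_half g"
  shows "\<exists>C\<ge>0. \<forall>X\<in>closed_upper_half. norm X \<le> R \<longrightarrow> \<bar>g X\<bar> \<le> C"
proof -
  have "compact (closed_upper_half \<inter> cball (0 :: (real^'n) \<times> real) R)"
    by (intro closed_Int_compact closed_closed_upper_half compact_cball)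
  then have "bounded (g ` (closed_upper_half \<inter> cball 0 R))"
    by (intro compact_imp_bounded compact_continuous_image continuous_on_subset[OF assms]) auto
  then obtain C where C: "\<forall>X\<in>closed_upper_half \<inter> cball 0 R. \<bar>g X\<bar> \<le> C"
    by (auto simp: bounded_iff)
  show ?thesis
  proof (intro exI[of _ "max C 0"] conjI ballI impI)
    fix X :: "(real^'n) \<times> real" assume "X \<in> closed_upper_half" "norm X \<le> R"
    then have "\<bar>g X\<bar> \<le> C" using C by simp
    then show "\<bar>g X\<bar> \<le> max C 0" by (rule max.coboundedI1)
  qed simp
qed

text \<open>At 0 the quotient has size |h|^(q-1) and tends to 0 since q > 1, in agreement with the
  factor \<open>v\<close> of the derivative.\<close>

lemma DERIV_abs_powr:
  fixes q v :: real
  assumes "1 < q"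
  shows "((\<lambda>v. \<bar>v\<bar> powr q) has_real_derivative q * (\<bar>v\<bar> powr (q - 2) * v)) (at v)"
proof -
  consider "0 < v" | "v < 0" | "v = 0" by linarith
  then show ?thesis
  proof cases
    case 1
    have "((\<lambda>v. v powr q) has_real_derivative q * v powr (q - 1)) (at v)"
      using 1 by (rule has_real_derivative_powr)
    moreover have "v powr (q - 1) = v powr (q - 2) * v"
      using 1 powr_add[of v "q - 2" 1] by simp
    ultimately have "((\<lambda>v. v powr q) has_real_derivative q * (\<bar>v\<bar> powr (q - 2) * v)) (at v)"
      using 1 by simp
    then show ?thesis
      by (rule has_field_derivative_transform_within_open[of _ _ v "{0<..}"]) (use 1 in auto)
  next
    case 2
    have "((\<lambda>v. v powr q) has_real_derivative q * (- v) powr (q - 1)) (at (- v))"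
      using 2 by (intro has_real_derivative_powr) simp
    moreover have "((\<lambda>v. - v) has_real_derivative - 1) (at v)"
      by (auto intro!: derivative_eq_intros)
    ultimately have "((\<lambda>v. (- v) powr q) has_real_derivative q * (- v) powr (q - 1) * - 1) (at v)"
      by (rule DERIV_chain2)
    moreover have "(- v) powr (q - 1) = (- v) powr (q - 2) * (- v)"
      using 2 powr_add[of "- v" "q - 2" 1] by simp
    ultimately have "((\<lambda>v. (- v) powr q) has_real_derivative q * (\<bar>v\<bar> powr (q - 2) * v)) (at v)"
      using 2 by simp
    then show ?thesis
      by (rule has_field_derivative_transform_within_open[of _ _ v "{..<0}"]) (use 2 in auto)
  next
    case 3
    have "((\<lambda>h. \<bar>h\<bar> powr q / h) \<longlongrightarrow> 0) (at (0::real))"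
    proof (rule Lim_null_comparison[where g = "\<lambda>h. \<bar>h\<bar> powr (q - 1)"])
      show "\<forall>\<^sub>F h in at (0::real). norm (\<bar>h\<bar> powr q / h) \<le> \<bar>h\<bar> powr (q - 1)"
        by (rule eventuallyI) (simp add: powr_diff)
      have "((\<lambda>h. \<bar>h\<bar> powr (q - 1)) \<longlongrightarrow> 0 powr (q - 1)) (at (0::real))"
        using assms by (intro tendsto_powr2 tendsto_rabs_zero tendsto_intros) auto
      then show "((\<lambda>h. \<bar>h\<bar> powr (q - 1)) \<longlongrightarrow> 0) (at (0::real))" by simp
    qed
    with 3 show ?thesis by (simp add: DERIV_def)
  qed
qed

lemma continuous_on_abs_powr: "0 < q \<Longrightarrow> continuous_on UNIV (\<lambda>v::real. \<bar>v\<bar> powr q)"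
  by (intro continuous_on_powr' continuous_intros) auto

abbreviation unit_ball_measure :: "'a::euclidean_space measure" where
  "unit_ball_measure \<equiv> restrict_space lborel (ball 0 1)"

lemma param_measure_unit_ball: "param_measure (unit_ball_measure :: 'a::euclidean_space measure) (cball 0 1)"
proof -
  have "emeasure lborel (ball (0::'a) 1) \<noteq> \<infinity>"
    using emeasure_lborel_ball_finite[of "0::'a" 1] by auto
  then have "finite_measure (unit_ball_measure :: 'a measure)"
    by (intro finite_measureI) (simp add: space_restrict_space emeasure_restrict_space)
  then interpret finite_measure "unit_ball_measure :: 'a measure" .
  show ?thesis
    by unfold_locales (auto simp: space_restrict_space sets_restrict_space)
qed

lemma integral_unit_ball_measure:
  fixes f :: "'a::euclidean_space \<Rightarrow> real"
  shows "(\<integral>x. f x \<partial>unit_ball_measure) = (\<integral>x. indicator (ball 0 1) x * f x \<partial>lborel)"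
  by (subst integral_restrict_space) simp_all

section \<open>Green's identities for dilates of a solution\<close>

text \<open>Of the lower bound on n, the derivative formula for the energy uses \<open>dim\<close>,
  through the vanishing flux at the origin. The full bound enters later as the sign of
  \<open>cA - cB - 1\<close>.\<close>

locale extension_problem =
  fixes s a p b Cns :: real and u :: "(real^'n) \<times> real \<Rightarrow> real"
  assumes s: "1 < s" "s < 2" and a: "0 < a" and p: "1 < p" and b_eq: "b = 3 - 2 * s"
    and dim: "1 < real CARD('n) + b"
    and regular: "regular_up_to_boundary b u"
    and solution: "extension_solution s a p Cns u"
begin

abbreviation w :: "(real^'n) \<times> real \<Rightarrow> real" where "w \<equiv> Delta_b b u"

abbreviation M :: "((real^'n) \<times> real) measure" where "M \<equiv> weighted_half_sphere b"

lemma b_gt: "-1 < b" using s b_eq by simp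

sublocale H: param_measure M closed_half_sphere
  by (rule param_measure_half_sphere[OF b_gt])

section \<open>The solution and \<open>Delta_b b u\<close> along rays\<close>

lemma C_k_u: "k \<le> 4 \<Longrightarrow> C_k k upper_half u"
  using regular C_k_mono unfolding regular_up_to_boundary_def by blast

lemma C_k_w: "k \<le> 2 \<Longrightarrow> C_k k upper_half w"
proof (rule C_k_mono)
  have "C_k (Suc (Suc 2)) upper_half u" using C_k_u[of "Suc (Suc 2)"] by simp
  then show "C_k 2 upper_half w" by (rule C_k_Delta_b)
qed

lemma C_k_partial_u: "e \<in> Basis \<Longrightarrow> k \<le> 3 \<Longrightarrow> C_k k upper_half (partial e u)"
  by (intro C_k_partial C_k_u) auto

text \<open>\<open>r1\<close>, \<open>r2\<close>, \<open>r3\<close> are the \<open>t\<close>-derivatives of \<open>r0\<close>, written through the partial derivatives of \<open>u\<close>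
  because the regularity assumption provides the boundary extensions of the latter.\<close>

definition r0 :: "real \<Rightarrow> (real^'n) \<times> real \<Rightarrow> real" where "r0 t \<theta> = u (t *\<^sub>R \<theta>)"
definition p0 where "p0 e t \<theta> = partial e u (t *\<^sub>R (\<theta> :: (real^'n) \<times> real))"
definition p1 where "p1 e t \<theta> = radial_deriv (partial e u) (t *\<^sub>R (\<theta> :: (real^'n) \<times> real))"
definition p2 where "p2 e t \<theta> = radial_deriv (radial_deriv (partial e u)) (t *\<^sub>R (\<theta> :: (real^'n) \<times> real))"
definition w0 :: "real \<Rightarrow> (real^'n) \<times> real \<Rightarrow> real" where "w0 t \<theta> = w (t *\<^sub>R \<theta>)"
definition w1 :: "real \<Rightarrow> (real^'n) \<times> real \<Rightarrow> real" where "w1 t \<theta> = radial_deriv w (t *\<^sub>R \<theta>)"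
definition r1 where "r1 t \<theta> = (\<Sum>e\<in>Basis. (\<theta> \<bullet> e) * p0 e t \<theta>)"
definition r2 where "r2 t \<theta> = (\<Sum>e\<in>Basis. (\<theta> \<bullet> e) * p1 e t \<theta>)"
definition r3 where "r3 t \<theta> = (\<Sum>e\<in>Basis. (\<theta> \<bullet> e) * p2 e t \<theta>)"

lemma r1_eq: "0 < t \<Longrightarrow> \<theta> \<in> half_sphere \<Longrightarrow> r1 t \<theta> = radial_deriv u (t *\<^sub>R \<theta>)"
  by (simp add: r1_def p0_def radial_deriv_eq_sum half_sphere_def)

lemma half_sphere_scaleR: "\<theta> \<in> half_sphere \<Longrightarrow> 0 < t \<Longrightarrow> t *\<^sub>R \<theta> \<in> upper_half"
  by (simp add: half_sphere_def upper_half_scaleR)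

lemma adm_extends:
  assumes "extends_continuously (closed_upper_half - {0}) f"
  shows "H.adm (\<lambda>t \<theta>. f (t *\<^sub>R \<theta>))"
proof -
  obtain g where "continuous_on (closed_upper_half - {0}) g" "\<forall>X\<in>upper_half. g X = f X"
    using assms unfolding extends_continuously_def by blast
  then show ?thesis using adm_ray[OF b_gt, of g f] by simp
qed

lemma adm_deriv_ray:
  assumes "extends_continuously (closed_upper_half - {0}) f"
    "extends_continuously (closed_upper_half - {0}) (radial_deriv f)"
    "\<And>X. X \<in> upper_half \<Longrightarrow> f differentiable (at X)"
  shows "H.adm_deriv (\<lambda>t \<theta>. f (t *\<^sub>R \<theta>)) (\<lambda>t \<theta>. radial_deriv f (t *\<^sub>R \<theta>))"
  unfolding H.adm_deriv_def
proof (intro conjI allI impI ballI)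
  fix t \<theta> assume "(0::real) < t" "\<theta> \<in> space M"
  then show "((\<lambda>t. f (t *\<^sub>R \<theta>)) has_real_derivative radial_deriv f (t *\<^sub>R \<theta>)) (at t)"
    by (intro has_real_derivative_ray assms(3)) (auto simp: half_sphere_def upper_half_scaleR)
qed (intro adm_extends assms)+

lemma extends_u: "extends_continuously (closed_upper_half - {0}) u"
proof -
  have "continuous_on (closed_upper_half - {0}) u"
    using regular unfolding regular_up_to_boundary_def by (auto intro: continuous_on_subset)
  then show ?thesis unfolding extends_continuously_def by blast
qed

lemma extends_continuously_derivs:
  "e \<in> Basis \<Longrightarrow> extends_continuously closed_upper_half (partial e u)"
  "extends_continuously closed_upper_half w"
  "extends_continuously closed_upper_half (\<lambda>X. snd X powr b * partial_y u X)"
  "extends_continuously closed_upper_half (\<lambda>X. snd X powr b * partial_y w X)"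
  "e \<in> Basis \<Longrightarrow> extends_continuously (closed_upper_half - {0}) (radial_deriv (partial e u))"
  "e \<in> Basis \<Longrightarrow> extends_continuously (closed_upper_half - {0}) (radial_deriv (radial_deriv (partial e u)))"
  "extends_continuously (closed_upper_half - {0}) (radial_deriv w)"
  using regular unfolding regular_up_to_boundary_def by blast+

lemma adm_deriv_p0: "e \<in> Basis \<Longrightarrow> H.adm_deriv (p0 e) (p1 e)"
  unfolding p0_def[abs_def] p1_def[abs_def]
  using C_k_Suc_differentiable[OF C_k_partial_u[of e "Suc 0"] open_upper_half]
  by (intro adm_deriv_ray extends_continuously_subset[OF extends_continuously_derivs(1)] extends_continuously_derivs) auto

lemma adm_deriv_p1: "e \<in> Basis \<Longrightarrow> H.adm_deriv (p1 e) (p2 e)"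
  unfolding p2_def[abs_def] p1_def[abs_def]
  by (intro adm_deriv_ray extends_continuously_derivs differentiable_radial_deriv C_k_partial_u) auto

lemma continuous_on_component: "continuous_on closed_half_sphere (\<lambda>\<theta>. \<theta> \<bullet> e)"
  by (intro continuous_intros)

lemma adm_deriv_r1: "H.adm_deriv r1 r2"
  unfolding r1_def[abs_def] r2_def[abs_def]
  by (intro H.adm_deriv_sum H.adm_deriv_snd adm_deriv_p0 continuous_on_component) auto

lemma adm_deriv_r2: "H.adm_deriv r2 r3"
  unfolding r2_def[abs_def] r3_def[abs_def]
  by (intro H.adm_deriv_sum H.adm_deriv_snd adm_deriv_p1 continuous_on_component) auto

lemma adm_deriv_r0: "H.adm_deriv r0 r1"
  unfolding H.adm_deriv_def
proof (intro conjI allI impI ballI)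
  show "H.adm r0" unfolding r0_def[abs_def] by (rule adm_extends[OF extends_u])
  show "H.adm r1" by (rule H.adm_derivD(1)[OF adm_deriv_r1])
  fix t \<theta> assume t: "(0::real) < t" "\<theta> \<in> space M"
  then have "((\<lambda>t. u (t *\<^sub>R \<theta>)) has_real_derivative radial_deriv u (t *\<^sub>R \<theta>)) (at t)"
    using C_k_Suc_differentiable[OF C_k_u[of "Suc 0"] open_upper_half, of "t *\<^sub>R \<theta>"]
    by (intro has_real_derivative_ray) (auto simp: half_sphere_def upper_half_scaleR)
  then show "((\<lambda>t. r0 t \<theta>) has_real_derivative r1 t \<theta>) (at t)"
    using t by (simp add: r0_def r1_eq)
qed

lemma adm_deriv_w0: "H.adm_deriv w0 w1"
  unfolding w0_def[abs_def] w1_def[abs_def]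
  using C_k_Suc_differentiable[OF C_k_w[of "Suc 0"] open_upper_half]
  by (intro adm_deriv_ray extends_continuously_subset[OF extends_continuously_derivs(2)] extends_continuously_derivs) auto

lemma partials_extend:
  "\<exists>P. \<forall>e\<in>Basis. continuous_on closed_upper_half (P e) \<and> (\<forall>X\<in>upper_half. P e X = partial e u X)"
  using extends_continuously_derivs(1) unfolding extends_continuously_def by (intro bchoice) blast

text \<open>The first boundary condition makes the trace zero. This is what removes the flat
  boundary from the integration by parts on the half-sphere.\<close>

lemma flux_u_extends:
  "\<exists>g. continuous_on closed_upper_half g \<and> (\<forall>X\<in>upper_half. g X = snd X powr b * partial_y u X) \<and> (\<forall>x. g (x, 0) = 0)"
proof -
  obtain g where g: "continuous_on closed_upper_half g" "\<forall>X\<in>upper_half. g X = snd X powr b * partial_y u X"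
    using extends_continuously_derivs(3) unfolding extends_continuously_def by blast
  have "g (x, 0) = 0" for x
  proof (rule extension_trace[OF g(1)])
    show "((\<lambda>y. snd (x, y) powr b * partial_y u (x, y)) \<longlongrightarrow> 0) (at_right 0)"
      using solution by (simp add: extension_solution_def Let_def b_eq)
  qed (use g(2) in simp)
  then show ?thesis using g by blast
qed

text \<open>Through this trace the nonlinear boundary condition enters Green's identity.\<close>

lemma flux_w_extends:
  "\<exists>g. continuous_on closed_upper_half g \<and> (\<forall>X\<in>upper_half. g X = snd X powr b * partial_y w X) \<and>
    (\<forall>x. g (x, 0) = Cns * norm x powr a * \<bar>u (x, 0)\<bar> powr (p - 1) * u (x, 0))"
proof -
  obtain g where g: "continuous_on closed_upper_half g" "\<forall>X\<in>upper_half. g X = snd X powr b * partial_y w X"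
    using extends_continuously_derivs(4) unfolding extends_continuously_def by blast
  have "g (x, 0) = Cns * norm x powr a * \<bar>u (x, 0)\<bar> powr (p - 1) * u (x, 0)" for x
  proof (rule extension_trace[OF g(1)])
    show "((\<lambda>y. snd (x, y) powr b * partial_y w (x, y)) \<longlongrightarrow>
        Cns * norm x powr a * \<bar>u (x, 0)\<bar> powr (p - 1) * u (x, 0)) (at_right 0)"
      using solution by (simp add: extension_solution_def Let_def b_eq)
  qed (use g(2) in simp)
  then show ?thesis using g by blast
qed

lemma w_harmonic: "X \<in> upper_half \<Longrightarrow> Delta_b b w X = 0"
  using solution by (simp add: extension_solution_def Let_def b_eq)

lemma dilate_regularity:
  assumes c: "0 < c"
  shows "C_k 2 upper_half (\<lambda>X. u (c *\<^sub>R X))" "C_k 1 upper_half (\<lambda>X. u (c *\<^sub>R X))"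
    "C_k 2 upper_half (\<lambda>X. w (c *\<^sub>R X))" "C_k 1 upper_half (\<lambda>X. w (c *\<^sub>R X))"
    "X \<in> upper_half \<Longrightarrow> partial e (\<lambda>X. u (c *\<^sub>R X)) X = c * partial e u (c *\<^sub>R X)"
    "X \<in> upper_half \<Longrightarrow> partial e (\<lambda>X. w (c *\<^sub>R X)) X = c * partial e w (c *\<^sub>R X)"
    "X \<in> upper_half \<Longrightarrow> radial_deriv (\<lambda>X. u (c *\<^sub>R X)) X = c * radial_deriv u (c *\<^sub>R X)"
    "X \<in> upper_half \<Longrightarrow> radial_deriv (\<lambda>X. w (c *\<^sub>R X)) X = c * radial_deriv w (c *\<^sub>R X)"
    "X \<in> upper_half \<Longrightarrow> Delta_b b (\<lambda>X. u (c *\<^sub>R X)) X = c\<^sup>2 * w (c *\<^sub>R X)"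
    "X \<in> upper_half \<Longrightarrow> Delta_b b (\<lambda>X. w (c *\<^sub>R X)) X = 0"
proof -
  have sc: "\<And>X. X \<in> upper_half \<Longrightarrow> c *\<^sub>R X \<in> upper_half" using upper_half_scaleR[OF c] by blast
  show "C_k 2 upper_half (\<lambda>X. u (c *\<^sub>R X))" "C_k 1 upper_half (\<lambda>X. u (c *\<^sub>R X))"
    "C_k 2 upper_half (\<lambda>X. w (c *\<^sub>R X))" "C_k 1 upper_half (\<lambda>X. w (c *\<^sub>R X))"
    by (rule C_k_dilate[OF open_upper_half sc C_k_u] C_k_dilate[OF open_upper_half sc C_k_w]; simp)+
  assume X: "X \<in> upper_half"
  have du: "u differentiable (at (c *\<^sub>R X))"
    by (rule C_k_Suc_differentiable[OF C_k_u[of "Suc 0"] open_upper_half sc[OF X]]) simp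
  have dw: "w differentiable (at (c *\<^sub>R X))"
    by (rule C_k_Suc_differentiable[OF C_k_w[of "Suc 0"] open_upper_half sc[OF X]]) simp
  show "partial e (\<lambda>X. u (c *\<^sub>R X)) X = c * partial e u (c *\<^sub>R X)" by (rule partial_dilate[OF du])
  show "partial e (\<lambda>X. w (c *\<^sub>R X)) X = c * partial e w (c *\<^sub>R X)" by (rule partial_dilate[OF dw])
  show "radial_deriv (\<lambda>X. u (c *\<^sub>R X)) X = c * radial_deriv u (c *\<^sub>R X)" by (rule radial_deriv_dilate[OF du c])
  show "radial_deriv (\<lambda>X. w (c *\<^sub>R X)) X = c * radial_deriv w (c *\<^sub>R X)" by (rule radial_deriv_dilate[OF dw c])
  show "Delta_b b (\<lambda>X. u (c *\<^sub>R X)) X = c\<^sup>2 * w (c *\<^sub>R X)" by (rule Delta_b_dilate[OF C_k_u X c]) simp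
  show "Delta_b b (\<lambda>X. w (c *\<^sub>R X)) X = 0"
    using Delta_b_dilate[OF C_k_w X c, of b] w_harmonic[OF sc[OF X]] by simp
qed

lemma continuous_on_dilate:
  assumes "continuous_on closed_upper_half g" "0 < c"
  shows "continuous_on closed_upper_half (\<lambda>X :: (real^'n) \<times> real. g (c *\<^sub>R X) :: real)"
  by (rule continuous_on_compose2[OF assms(1)])
    (auto intro!: continuous_intros simp: closed_upper_half_scaleR[OF assms(2)] simp del: scaleR_Pair)

text \<open>One power of c comes from the chain rule, and c^b is absorbed by the weight.\<close>

lemma weighted_partial_y_dilate:
  assumes "0 < c" "X \<in> upper_half"
  shows "snd X powr b * (c * partial_y v (c *\<^sub>R X)) =
    c powr (1 - b) * (snd (c *\<^sub>R X) powr b * partial_y v (c *\<^sub>R X))"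
  using assms by (simp add: upper_half_def powr_mult powr_diff)

text \<open>The half-sphere flux of the field y^b u(k X) grad u(l X), with u dilated before the
  gradient is taken, is differentiated at radius 1 in two ways: by
  \<open>has_real_derivative_flux_average\<close>, and by the product rule along rays. Comparison
  leaves the tangential gradients on one side. \<open>k\<close> and \<open>l\<close> are kept apart
  so that the identity can later be differentiated in each of them.\<close>

lemma spherical_integration_by_parts:
  assumes l: "0 < l" and k: "0 < k"
  shows "(\<integral>\<theta>. l * k * ((\<Sum>e\<in>Basis. p0 e k \<theta> * p0 e l \<theta>) - r1 k \<theta> * r1 l \<theta>) \<partial>M) =
    (\<integral>\<theta>. r0 k \<theta> * (l\<^sup>2 * r2 l \<theta> + (real CARD('n) + b) * l * r1 l \<theta> - l\<^sup>2 * w0 l \<theta>) \<partial>M)"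
proof -
  let ?m = "real CARD('n) + b"
  let ?g = "\<lambda>X. u (k *\<^sub>R X)" and ?h = "\<lambda>X. u (l *\<^sub>R X)"
  obtain P where P: "\<forall>e\<in>Basis. continuous_on closed_upper_half (P e) \<and> (\<forall>X\<in>upper_half. P e X = partial e u X)"
    using partials_extend by blast
  obtain W where W: "continuous_on closed_upper_half W" "\<forall>X\<in>upper_half. W X = w X"
    using extends_continuously_derivs(2) unfolding extends_continuously_def by blast
  obtain fl where fl: "continuous_on closed_upper_half fl" "\<forall>X\<in>upper_half. fl X = snd X powr b * partial_y u X"
    "\<forall>x. fl (x, 0) = 0"
    using flux_u_extends by blast
  have uc: "continuous_on closed_upper_half u"
    using regular unfolding regular_up_to_boundary_def by blast
  define d where "d = (\<lambda>X. l * k * (\<Sum>e\<in>Basis. P e (k *\<^sub>R X) * P e (l *\<^sub>R X)) + u (k *\<^sub>R X) * (l\<^sup>2 * W (l *\<^sub>R X)))"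
  define f where "f = (\<lambda>X. u (k *\<^sub>R X) * (l * (\<Sum>e\<in>Basis. (X \<bullet> e) / norm X * P e (l *\<^sub>R X))))"
  define h where "h = (\<lambda>X. u (k *\<^sub>R X) * (l powr (1 - b) * fl (l *\<^sub>R X)))"
  note cont = continuous_on_subset[OF continuous_on_dilate, of _ _ "closed_upper_half - {0}"]
  have Pc: "e \<in> Basis \<Longrightarrow> continuous_on closed_upper_half (P e)" for e using P by blast
  have "((\<lambda>t. t powr ?m * (\<integral>\<theta>. f (t *\<^sub>R \<theta>) \<partial>M)) has_real_derivative
    1 powr ?m * (\<integral>\<theta>. d (1 *\<^sub>R \<theta>) \<partial>M)) (at 1)"
  proof (rule has_real_derivative_flux_average[OF b_gt continuous_on_flux_field[OF dilate_regularity(2)[OF k] dilate_regularity(1)[OF l]]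
        continuous_on_flux_diag[OF dilate_regularity(2)[OF k] dilate_regularity(1)[OF l]] has_real_derivative_flux_field[OF dilate_regularity(2)[OF k] dilate_regularity(1)[OF l]]])
    show "continuous_on (closed_upper_half - {0}) d"
      unfolding d_def by (intro continuous_intros cont uc k l W Pc) auto
    show "continuous_on (closed_upper_half - {0}) f"
      unfolding f_def by (intro continuous_intros cont uc k l Pc) auto
    show "continuous_on (closed_upper_half - {0}) h"
      unfolding h_def by (intro continuous_intros cont uc k l fl) auto
    show "h (x, 0) = 0" for x using fl(3) by (simp add: h_def)
    fix X :: "(real^'n) \<times> real" assume X: "X \<in> upper_half"
    have kX: "k *\<^sub>R X \<in> upper_half" and lX: "l *\<^sub>R X \<in> upper_half"
      using X upper_half_scaleR k l by blast+
    have "grad ?g X \<bullet> grad ?h X = l * k * (\<Sum>e\<in>Basis. P e (k *\<^sub>R X) * P e (l *\<^sub>R X))"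
      using P kX lX by (subst euclidean_inner) (simp add: grad_Basis dilate_regularity(5)[OF k X] dilate_regularity(5)[OF l X] sum_distrib_left mult_ac)
    then show "(\<Sum>e\<in>Basis. flux_diag b ?g ?h e X) = snd X powr b * d X"
      using W(2) lX by (simp add: sum_flux_diag[OF X] dilate_regularity(9)[OF l X] d_def)
    have rd: "radial_deriv ?h X = l * (\<Sum>e\<in>Basis. (X \<bullet> e) / norm X * P e (l *\<^sub>R X))"
      unfolding radial_deriv_eq_sum using P lX by (simp add: dilate_regularity(5)[OF l X] sum_distrib_left mult_ac)
    show "((snd X powr b * ?g X) *\<^sub>R grad ?h X) \<bullet> (X /\<^sub>R norm X) = snd X powr b * f X"
      unfolding f_def rd[symmetric] by (simp add: radial_deriv_def)
    have "snd (grad ?h X) = partial_y ?h X"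
      using grad_Basis[OF Basis_snd, of ?h X] by (simp add: inner_prod_def partial_y_def)
    also have "\<dots> = l * partial_y u (l *\<^sub>R X)"
      by (simp add: partial_y_def dilate_regularity(5)[OF l X])
    finally show "snd ((snd X powr b * ?g X) *\<^sub>R grad ?h X) = h X"
      using weighted_partial_y_dilate[OF l X, of u] fl(2) lX by (simp add: h_def mult_ac)
  qed simp_all
  moreover have "((\<lambda>t. t powr ?m * (\<integral>\<theta>. f (t *\<^sub>R \<theta>) \<partial>M)) has_real_derivative
    ?m * (\<integral>\<theta>. r0 k \<theta> * (l * r1 l \<theta>) \<partial>M) + (\<integral>\<theta>. k * r1 k \<theta> * (l * r1 l \<theta>) + r0 k \<theta> * (l * (l * r2 l \<theta>)) \<partial>M)) (at 1)"
  proof -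
    have fe: "(\<integral>\<theta>. f (t *\<^sub>R \<theta>) \<partial>M) = (\<integral>\<theta>. r0 (k * t) \<theta> * (l * r1 (l * t) \<theta>) \<partial>M)" if t: "0 < t" for t
    proof (rule Bochner_Integration.integral_cong[OF refl])
      fix \<theta> assume "\<theta> \<in> space M"
      then have th: "\<theta> \<in> half_sphere" by simp
      have lt: "(l * t) *\<^sub>R \<theta> \<in> upper_half" using half_sphere_scaleR[OF th] l t by simp
      show "f (t *\<^sub>R \<theta>) = r0 (k * t) \<theta> * (l * r1 (l * t) \<theta>)"
        using P lt t th by (simp add: f_def r0_def r1_def p0_def half_sphere_def)
    qed
    have "H.adm_deriv (\<lambda>t \<theta>. r0 (k * t) \<theta> * (l * r1 (l * t) \<theta>))
      (\<lambda>t \<theta>. k * r1 (k * t) \<theta> * (l * r1 (l * t) \<theta>) + r0 (k * t) \<theta> * (l * (l * r2 (l * t) \<theta>)))"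
      by (intro H.adm_deriv_mult H.adm_deriv_cmult H.adm_deriv_dilate adm_deriv_r0 adm_deriv_r1 k l)
    from H.has_real_derivative_integral[OF this, of 1]
    have "((\<lambda>t. \<integral>\<theta>. r0 (k * t) \<theta> * (l * r1 (l * t) \<theta>) \<partial>M) has_real_derivative
      (\<integral>\<theta>. k * r1 k \<theta> * (l * r1 l \<theta>) + r0 k \<theta> * (l * (l * r2 l \<theta>)) \<partial>M)) (at 1)"
      by simp
    moreover have "((\<lambda>t. t powr ?m) has_real_derivative ?m * 1 powr (?m - 1)) (at 1)"
      by (rule has_real_derivative_powr) simp
    ultimately have "((\<lambda>t. t powr ?m * (\<integral>\<theta>. r0 (k * t) \<theta> * (l * r1 (l * t) \<theta>) \<partial>M)) has_real_derivative
      ?m * (\<integral>\<theta>. r0 k \<theta> * (l * r1 l \<theta>) \<partial>M) + (\<integral>\<theta>. k * r1 k \<theta> * (l * r1 l \<theta>) + r0 k \<theta> * (l * (l * r2 l \<theta>)) \<partial>M)) (at 1)"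
      by (rule DERIV_cong[OF DERIV_mult[rotated]]) simp
    then show ?thesis
      by (rule has_field_derivative_transform_within_open[of _ _ 1 "{0<..}"]) (simp_all add: fe)
  qed
  ultimately have eq: "(\<integral>\<theta>. d \<theta> \<partial>M) = ?m * (\<integral>\<theta>. r0 k \<theta> * (l * r1 l \<theta>) \<partial>M)
      + (\<integral>\<theta>. k * r1 k \<theta> * (l * r1 l \<theta>) + r0 k \<theta> * (l * (l * r2 l \<theta>)) \<partial>M)"
    using DERIV_unique by fastforce
  have de: "(\<integral>\<theta>. d \<theta> \<partial>M) = (\<integral>\<theta>. l * k * (\<Sum>e\<in>Basis. p0 e k \<theta> * p0 e l \<theta>) + r0 k \<theta> * (l\<^sup>2 * w0 l \<theta>) \<partial>M)"
  proof (rule Bochner_Integration.integral_cong[OF refl])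
    fix \<theta> assume "\<theta> \<in> space M"
    then have th: "\<theta> \<in> half_sphere" by simp
    have "k *\<^sub>R \<theta> \<in> upper_half" "l *\<^sub>R \<theta> \<in> upper_half"
      using half_sphere_scaleR[OF th k] half_sphere_scaleR[OF th l] by blast+
    then show "d \<theta> = l * k * (\<Sum>e\<in>Basis. p0 e k \<theta> * p0 e l \<theta>) + r0 k \<theta> * (l\<^sup>2 * w0 l \<theta>)"
      using P W(2) by (simp add: d_def r0_def w0_def p0_def)
  qed
  note adms = H.adm_derivD(1)[OF adm_deriv_p0] H.adm_derivD(1)[OF adm_deriv_r0] H.adm_derivD(1)[OF adm_deriv_r1]
    H.adm_derivD(1)[OF adm_deriv_r2] H.adm_derivD(1)[OF adm_deriv_w0]
  have int: "integrable M (\<lambda>\<theta>. \<Sum>e\<in>Basis. p0 e k \<theta> * p0 e l \<theta>)" "integrable M (\<lambda>\<theta>. r1 k \<theta> * r1 l \<theta>)"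
    "integrable M (\<lambda>\<theta>. r0 k \<theta> * r1 l \<theta>)" "integrable M (\<lambda>\<theta>. r0 k \<theta> * r2 l \<theta>)" "integrable M (\<lambda>\<theta>. r0 k \<theta> * w0 l \<theta>)"
  proof -
    have "H.adm (\<lambda>t \<theta>. \<Sum>e\<in>Basis. p0 e k \<theta> * p0 e l \<theta>)"
      by (intro H.adm_sum H.adm_mult H.adm_freeze[OF adms(1) k] H.adm_freeze[OF adms(1) l]) auto
    from H.adm_integrable[OF this, of 1] show "integrable M (\<lambda>\<theta>. \<Sum>e\<in>Basis. p0 e k \<theta> * p0 e l \<theta>)" by simp
    show "integrable M (\<lambda>\<theta>. r1 k \<theta> * r1 l \<theta>)" "integrable M (\<lambda>\<theta>. r0 k \<theta> * r1 l \<theta>)"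
      "integrable M (\<lambda>\<theta>. r0 k \<theta> * r2 l \<theta>)" "integrable M (\<lambda>\<theta>. r0 k \<theta> * w0 l \<theta>)"
      using H.adm_integrable[OF H.adm_mult[OF H.adm_freeze[OF adms(3) k] H.adm_freeze[OF adms(3) l]], of 1]
        H.adm_integrable[OF H.adm_mult[OF H.adm_freeze[OF adms(2) k] H.adm_freeze[OF adms(3) l]], of 1]
        H.adm_integrable[OF H.adm_mult[OF H.adm_freeze[OF adms(2) k] H.adm_freeze[OF adms(4) l]], of 1]
        H.adm_integrable[OF H.adm_mult[OF H.adm_freeze[OF adms(2) k] H.adm_freeze[OF adms(5) l]], of 1]
      by simp_all
  qed
  define S R T1 T2 V where "S = (\<integral>\<theta>. (\<Sum>e\<in>Basis. p0 e k \<theta> * p0 e l \<theta>) \<partial>M)" and "R = (\<integral>\<theta>. r1 k \<theta> * r1 l \<theta> \<partial>M)"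
    and "T1 = (\<integral>\<theta>. r0 k \<theta> * r1 l \<theta> \<partial>M)" and "T2 = (\<integral>\<theta>. r0 k \<theta> * r2 l \<theta> \<partial>M)" and "V = (\<integral>\<theta>. r0 k \<theta> * w0 l \<theta> \<partial>M)"
  have e1: "(\<integral>\<theta>. l * k * (\<Sum>e\<in>Basis. p0 e k \<theta> * p0 e l \<theta>) + r0 k \<theta> * (l\<^sup>2 * w0 l \<theta>) \<partial>M) = l * k * S + l\<^sup>2 * V"
  proof -
    have "(\<integral>\<theta>. l * k * (\<Sum>e\<in>Basis. p0 e k \<theta> * p0 e l \<theta>) + r0 k \<theta> * (l\<^sup>2 * w0 l \<theta>) \<partial>M) =
      (\<integral>\<theta>. l * k * (\<Sum>e\<in>Basis. p0 e k \<theta> * p0 e l \<theta>) + l\<^sup>2 * (r0 k \<theta> * w0 l \<theta>) \<partial>M)"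
      by (simp add: mult_ac)
    then show ?thesis by (simp add: int S_def V_def)
  qed
  have e2: "(\<integral>\<theta>. k * r1 k \<theta> * (l * r1 l \<theta>) + r0 k \<theta> * (l * (l * r2 l \<theta>)) \<partial>M) = l * k * R + l\<^sup>2 * T2"
  proof -
    have "(\<integral>\<theta>. k * r1 k \<theta> * (l * r1 l \<theta>) + r0 k \<theta> * (l * (l * r2 l \<theta>)) \<partial>M) =
      (\<integral>\<theta>. l * k * (r1 k \<theta> * r1 l \<theta>) + l\<^sup>2 * (r0 k \<theta> * r2 l \<theta>) \<partial>M)"
      by (simp add: mult_ac power2_eq_square)
    then show ?thesis by (simp add: int R_def T2_def)
  qed
  have e3: "(\<integral>\<theta>. r0 k \<theta> * (l * r1 l \<theta>) \<partial>M) = l * T1"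
    by (simp add: T1_def mult.left_commute)
  have e4: "(\<integral>\<theta>. l * k * ((\<Sum>e\<in>Basis. p0 e k \<theta> * p0 e l \<theta>) - r1 k \<theta> * r1 l \<theta>) \<partial>M) = l * k * (S - R)"
    by (simp add: int S_def R_def)
  have e5: "(\<integral>\<theta>. r0 k \<theta> * (l\<^sup>2 * r2 l \<theta> + ?m * l * r1 l \<theta> - l\<^sup>2 * w0 l \<theta>) \<partial>M) = l\<^sup>2 * T2 + ?m * l * T1 - l\<^sup>2 * V"
  proof -
    have "(\<integral>\<theta>. r0 k \<theta> * (l\<^sup>2 * r2 l \<theta> + ?m * l * r1 l \<theta> - l\<^sup>2 * w0 l \<theta>) \<partial>M) =
      (\<integral>\<theta>. l\<^sup>2 * (r0 k \<theta> * r2 l \<theta>) + ?m * l * (r0 k \<theta> * r1 l \<theta>) - l\<^sup>2 * (r0 k \<theta> * w0 l \<theta>) \<partial>M)"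
      by (simp add: algebra_simps)
    then show ?thesis by (simp add: int T1_def T2_def V_def)
  qed
  have "l * k * S + l\<^sup>2 * V = ?m * (l * T1) + (l * k * R + l\<^sup>2 * T2)"
    using eq unfolding de e1 e2 e3 .
  then show ?thesis unfolding e4 e5 by (simp add: algebra_simps)
qed

text \<open>In the divergence of y^b (w_l grad u_k - u_k grad w_l), for the dilates of
  \<open>w\<close> by l and of \<open>u\<close> by k, the products of gradients cancel and
  \<open>w_harmonic\<close> removes the last term. What remains contains no derivative of
  \<open>w\<close> and extends continuously to y = 0 and to the origin.\<close>

lemma green_identity:
  assumes l: "0 < l" and k: "0 < k"
  shows "(\<integral>\<theta>. w0 l \<theta> * (k * r1 k \<theta>) - r0 k \<theta> * (l * w1 l \<theta>) \<partial>M) =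
    (\<integral>X. indicator (upper_half \<inter> ball 0 1) X * (snd X powr b * (w (l *\<^sub>R X) * (k\<^sup>2 * w (k *\<^sub>R X)))) \<partial>lborel)
    - (\<integral>x. indicator (ball 0 1) x * (u (k *\<^sub>R x, 0) * (l powr (1 - b) *
        (Cns * norm (l *\<^sub>R x) powr a * \<bar>u (l *\<^sub>R x, 0)\<bar> powr (p - 1) * u (l *\<^sub>R x, 0)))) \<partial>lborel)"
proof -
  let ?m = "real CARD('n) + b"
  let ?g = "\<lambda>X. u (k *\<^sub>R X)" and ?h = "\<lambda>X. w (l *\<^sub>R X)"
  obtain P where P: "\<forall>e\<in>Basis. continuous_on closed_upper_half (P e) \<and> (\<forall>X\<in>upper_half. P e X = partial e u X)"
    using partials_extend by blast
  have Pc: "e \<in> Basis \<Longrightarrow> continuous_on closed_upper_half (P e)" for e using P by blast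
  obtain W where W: "continuous_on closed_upper_half W" "\<forall>X\<in>upper_half. W X = w X"
    using extends_continuously_derivs(2) unfolding extends_continuously_def by blast
  obtain Wr where Wr: "continuous_on (closed_upper_half - {0}) Wr" "\<forall>X\<in>upper_half. Wr X = radial_deriv w X"
    using extends_continuously_derivs(7) unfolding extends_continuously_def by blast
  obtain fl0 where fl0: "continuous_on closed_upper_half fl0" "\<forall>X\<in>upper_half. fl0 X = snd X powr b * partial_y u X"
    "\<forall>x. fl0 (x, 0) = 0"
    using flux_u_extends by blast
  obtain fl1 where fl1: "continuous_on closed_upper_half fl1" "\<forall>X\<in>upper_half. fl1 X = snd X powr b * partial_y w X"
    "\<forall>x. fl1 (x, 0) = Cns * norm x powr a * \<bar>u (x, 0)\<bar> powr (p - 1) * u (x, 0)"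
    using flux_w_extends by blast
  have uc: "continuous_on closed_upper_half u"
    using regular unfolding regular_up_to_boundary_def by blast
  define d where "d = (\<lambda>X. W (l *\<^sub>R X) * (k\<^sup>2 * W (k *\<^sub>R X)))"
  define f where "f = (\<lambda>X. W (l *\<^sub>R X) * (k * (\<Sum>e\<in>Basis. (X \<bullet> e) / norm X * P e (k *\<^sub>R X)))
    - u (k *\<^sub>R X) * (l * Wr (l *\<^sub>R X)))"
  define h where "h = (\<lambda>X. W (l *\<^sub>R X) * (k powr (1 - b) * fl0 (k *\<^sub>R X)) - u (k *\<^sub>R X) * (l powr (1 - b) * fl1 (l *\<^sub>R X)))"
  define F where "F = (\<lambda>X. (snd X powr b * ?h X) *\<^sub>R grad ?g X - (snd X powr b * ?g X) *\<^sub>R grad ?h X)"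
  note cont = continuous_on_subset[OF continuous_on_dilate, of _ _ "closed_upper_half - {0}"]
  have dc: "continuous_on closed_upper_half d"
    unfolding d_def by (intro continuous_intros continuous_on_dilate k l W)
  have hc: "continuous_on closed_upper_half h"
    unfolding h_def by (intro continuous_intros continuous_on_dilate k l W uc fl0 fl1)
  have Wrc: "continuous_on (closed_upper_half - {0}) (\<lambda>X. Wr (l *\<^sub>R X))"
  proof (rule continuous_on_compose2[OF Wr(1)])
    show "(\<lambda>X. l *\<^sub>R X) ` (closed_upper_half - {0}) \<subseteq> closed_upper_half - {0 :: (real^'n) \<times> real}"
    proof (intro image_subsetI)
      fix X :: "(real^'n) \<times> real" assume "X \<in> closed_upper_half - {0}"
      then show "l *\<^sub>R X \<in> closed_upper_half - {0}"
        using l closed_upper_half_scaleR[OF l, of X] by simp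
    qed
  qed (intro continuous_intros)
  have fc: "continuous_on (closed_upper_half - {0}) f"
    unfolding f_def by (intro continuous_intros cont uc k l Pc W Wrc) auto
  have rd: "radial_deriv ?g X = k * (\<Sum>e\<in>Basis. (X \<bullet> e) / norm X * P e (k *\<^sub>R X))" if X: "X \<in> upper_half" for X
    unfolding radial_deriv_eq_sum using P upper_half_scaleR[OF k, of X] X
    by (simp add: dilate_regularity(5)[OF k X] sum_distrib_left mult_ac)
  have flux: "t2 powr ?m * (\<integral>\<theta>. f (t2 *\<^sub>R \<theta>) \<partial>M) - t1 powr ?m * (\<integral>\<theta>. f (t1 *\<^sub>R \<theta>) \<partial>M) =
      (\<integral>X. indicator {X \<in> upper_half. t1 \<le> norm X \<and> norm X < t2} X * (snd X powr b * d X) \<partial>lborel)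
      + (\<integral>x. indicator {x. t1 \<le> norm x \<and> norm x < t2} x * h (x, 0) \<partial>lborel)" if t: "0 < t1" "t1 < t2" for t1 t2
  proof (rule divergence_half_annulus[OF b_gt, where F = F and DF = "\<lambda>e X. flux_diag b ?h ?g e X - flux_diag b ?g ?h e X"])
    show "continuous_on upper_half F"
      unfolding F_def
      by (intro continuous_on_diff continuous_on_flux_field dilate_regularity k l)
    show "continuous_on upper_half (\<lambda>X. flux_diag b ?h ?g e X - flux_diag b ?g ?h e X)" if "e \<in> Basis" for e
      by (intro continuous_on_diff continuous_on_flux_diag dilate_regularity k l that)
    show "continuous_on (closed_upper_half - {0}) d" by (rule continuous_on_subset[OF dc]) simp
    show "continuous_on (closed_upper_half - {0}) h" by (rule continuous_on_subset[OF hc]) simp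
    show "continuous_on (closed_upper_half - {0}) f" by (rule fc)
    fix X :: "(real^'n) \<times> real" assume X: "X \<in> upper_half"
    have kX: "k *\<^sub>R X \<in> upper_half" and lX: "l *\<^sub>R X \<in> upper_half"
      using X upper_half_scaleR k l by blast+
    show "((\<lambda>t. F (X + t *\<^sub>R e) \<bullet> e) has_real_derivative flux_diag b ?h ?g e X - flux_diag b ?g ?h e X) (at 0)"
      if e: "e \<in> Basis" for e
      unfolding F_def inner_diff_left
      by (intro DERIV_diff has_real_derivative_flux_field dilate_regularity k l X e)
    show "(\<Sum>e\<in>Basis. flux_diag b ?h ?g e X - flux_diag b ?g ?h e X) = snd X powr b * d X"
      unfolding sum_subtractf sum_flux_diag[OF X] dilate_regularity(9)[OF k X] dilate_regularity(10)[OF l X] d_def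
      using W(2) lX kX by (simp add: inner_commute algebra_simps)
    have "F X \<bullet> (X /\<^sub>R norm X) = snd X powr b * (?h X * radial_deriv ?g X - ?g X * radial_deriv ?h X)"
      unfolding F_def radial_deriv_def by (simp add: inner_diff_left algebra_simps)
    also have "\<dots> = snd X powr b * f X"
      unfolding rd[OF X] dilate_regularity(8)[OF l X] f_def using W(2) Wr(2) lX by simp
    finally show "F X \<bullet> (X /\<^sub>R norm X) = snd X powr b * f X" .
    have sg: "snd (grad v X) = partial_y v X" for v :: "(real^'n) \<times> real \<Rightarrow> real"
      using grad_Basis[OF Basis_snd, of v X] by (simp add: inner_prod_def partial_y_def)
    have "partial_y ?g X = k * partial_y u (k *\<^sub>R X)" "partial_y ?h X = l * partial_y w (l *\<^sub>R X)"
      by (simp_all add: partial_y_def dilate_regularity(5)[OF k X] dilate_regularity(6)[OF l X])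
    then have eu: "snd X powr b * partial_y ?g X = k powr (1 - b) * fl0 (k *\<^sub>R X)"
      and ew: "snd X powr b * partial_y ?h X = l powr (1 - b) * fl1 (l *\<^sub>R X)"
      using weighted_partial_y_dilate[OF k X, of u] weighted_partial_y_dilate[OF l X, of w] fl0(2) fl1(2) lX kX
      by simp_all
    have "snd (F X) = ?h X * (snd X powr b * partial_y ?g X) - ?g X * (snd X powr b * partial_y ?h X)"
      unfolding F_def snd_diff snd_scaleR sg by simp
    then show "snd (F X) = h X"
      unfolding eu ew h_def using W(2) lX by simp
  qed (use t in auto)
  define V where "V = (\<lambda>r. (\<integral>X. indicator {X \<in> upper_half. r \<le> norm X \<and> norm X < 1} X * (snd X powr b * d X) \<partial>lborel)
      + (\<integral>x. indicator {x :: real^'n. r \<le> norm x \<and> norm x < 1} x * h (x, 0) \<partial>lborel))"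
  define V0 where "V0 = (\<integral>X. indicator (upper_half \<inter> ball 0 1) X * (snd X powr b * d X) \<partial>lborel)
      + (\<integral>x. indicator (ball (0 :: real^'n) 1) x * h (x, 0) \<partial>lborel)"
  have limV: "(V \<longlongrightarrow> V0) (at_right 0)"
  proof -
    let ?d = "\<lambda>X :: (real^'n) \<times> real. indicator (ball 0 1) X * d X"
    have "(\<lambda>X. indicator upper_half X * d X) \<in> borel_measurable borel"
      by (rule measurable_on_upper_half[OF continuous_on_subset[OF dc]]) simp
    then have "(\<lambda>X. indicator (ball 0 1) X * (indicator upper_half X * d X)) \<in> borel_measurable borel"
      by measurable
    then have dm: "(\<lambda>X. indicator upper_half X * ?d X) \<in> borel_measurable borel"
      by (simp only: mult.left_commute)
    obtain Cd where Cd: "0 \<le> Cd" "\<forall>X\<in>closed_upper_half. norm X \<le> 1 \<longrightarrow> \<bar>d X\<bar> \<le> Cd"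
      using bounded_half_ball[OF dc, of 1] by blast
    have db: "\<bar>?d X\<bar> \<le> Cd" if "X \<in> upper_half" for X
      using Cd that upper_half_subset_closed by (cases "norm X < 1") auto
    have "integrable lborel (\<lambda>X. indicator upper_half X * (snd X powr b * ?d X))"
      by (rule integrable_weighted_upper_half[OF b_gt dm db, of 1]) auto
    moreover have "indicator upper_half X * (snd X powr b * ?d X) = indicator (upper_half \<inter> ball 0 1) X * (snd X powr b * d X)" for X
      by (cases "X \<in> upper_half"; cases "norm X < 1") simp_all
    ultimately have i1: "integrable lborel (\<lambda>X. indicator (upper_half \<inter> ball 0 1) X * (snd X powr b * d X))"
      by simp
    have hx: "continuous_on UNIV (\<lambda>x :: real^'n. h (x, 0))"
      by (rule continuous_on_compose2[OF hc]) (auto intro!: continuous_intros simp: closed_upper_half_def)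
    have "integrable lborel (\<lambda>x :: real^'n. indicator (cball 0 1) x *\<^sub>R h (x, 0))"
      by (intro borel_integrable_compact compact_cball continuous_on_subset[OF hx]) auto
    then have i2: "integrable lborel (\<lambda>x :: real^'n. indicator (ball 0 1) x * h (x, 0))"
    proof (rule Bochner_Integration.integrable_bound)
      show "(\<lambda>x :: real^'n. indicator (ball 0 1) x * h (x, 0)) \<in> borel_measurable lborel"
        using borel_measurable_continuous_onI[OF hx] by measurable
      show "AE x in lborel. norm (indicator (ball 0 1) x * h (x, 0)) \<le> norm (indicator (cball (0 :: real^'n) 1) x *\<^sub>R h (x, 0))"
        by (intro AE_I2) (simp add: indicator_def)
    qed
    have e1: "(\<integral>X. indicator {X \<in> upper_half. r \<le> norm X \<and> norm X < 1} X * (snd X powr b * d X) \<partial>lborel) =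
      (\<integral>X. indicator {r..} (norm X) * (indicator (upper_half \<inter> ball 0 1) X * (snd X powr b * d X)) \<partial>lborel)" for r
      by (rule Bochner_Integration.integral_cong[OF refl]) (simp add: indicator_def)
    have e2: "(\<integral>x. indicator {x :: real^'n. r \<le> norm x \<and> norm x < 1} x * h (x, 0) \<partial>lborel) =
      (\<integral>x. indicator {r..} (norm x) * (indicator (ball 0 1) x * h (x, 0)) \<partial>lborel)" for r
      by (rule Bochner_Integration.integral_cong[OF refl]) (simp add: indicator_def)
    show ?thesis
      unfolding V_def V0_def e1 e2 by (intro tendsto_add tendsto_integral_punctured i1 i2)
  qed
  \<comment> \<open>The flux at radius t is t^m (2 Q - P1), where m = n + b and P1 is the derivative
    of P0. P0 and Q are bounded near 0 because they contain no derivative of \<open>w\<close>. The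
    term with \<open>w1\<close>, for which no bound is available, is thus handled through its
    antiderivative by \<open>bounded_imp_zero_flux\<close>.\<close>
  define P0 where "P0 = (\<lambda>t. \<integral>\<theta>. r0 (k * t) \<theta> * w0 (l * t) \<theta> \<partial>M)"
  define Q where "Q = (\<lambda>t. \<integral>\<theta>. k * r1 (k * t) \<theta> * w0 (l * t) \<theta> \<partial>M)"
  define P1 where "P1 = (\<lambda>t. \<integral>\<theta>. k * r1 (k * t) \<theta> * w0 (l * t) \<theta> + r0 (k * t) \<theta> * (l * w1 (l * t) \<theta>) \<partial>M)"
  note adms = H.adm_derivD(1)[OF adm_deriv_p0] H.adm_derivD(1)[OF adm_deriv_r0] H.adm_derivD(1)[OF adm_deriv_r1]
    H.adm_derivD(1)[OF adm_deriv_w0] H.adm_derivD(2)[OF adm_deriv_w0]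
  have dP: "(P0 has_real_derivative P1 t) (at t)" if "0 < t" for t
    unfolding P0_def P1_def
    by (rule H.has_real_derivative_integral[OF _ that])
      (intro H.adm_deriv_mult H.adm_deriv_dilate adm_deriv_r0 adm_deriv_w0 k l)
  have fe: "(\<integral>\<theta>. f (t *\<^sub>R \<theta>) \<partial>M) = 2 * Q t - P1 t" if t: "0 < t" for t
  proof -
    have i1: "integrable M (\<lambda>\<theta>. k * r1 (k * t) \<theta> * w0 (l * t) \<theta>)"
      by (rule H.adm_integrable[OF _ t]) (intro H.adm_mult H.adm_const H.adm_dilate adms k l)
    have i2: "integrable M (\<lambda>\<theta>. r0 (k * t) \<theta> * (l * w1 (l * t) \<theta>))"
      by (rule H.adm_integrable[OF _ t]) (intro H.adm_mult H.adm_const H.adm_dilate adms k l)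
    have "(\<integral>\<theta>. f (t *\<^sub>R \<theta>) \<partial>M) = (\<integral>\<theta>. k * r1 (k * t) \<theta> * w0 (l * t) \<theta> - r0 (k * t) \<theta> * (l * w1 (l * t) \<theta>) \<partial>M)"
    proof (rule Bochner_Integration.integral_cong[OF refl])
      fix \<theta> assume "\<theta> \<in> space M"
      then have th: "\<theta> \<in> half_sphere" by simp
      have "(k * t) *\<^sub>R \<theta> \<in> upper_half" "(l * t) *\<^sub>R \<theta> \<in> upper_half" using half_sphere_scaleR[OF th] k l t by simp_all
      then show "f (t *\<^sub>R \<theta>) = k * r1 (k * t) \<theta> * w0 (l * t) \<theta> - r0 (k * t) \<theta> * (l * w1 (l * t) \<theta>)"
        using P W(2) Wr(2) t th by (simp add: f_def r0_def r1_def p0_def w0_def w1_def half_sphere_def)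
    qed
    also have "\<dots> = 2 * Q t - P1 t"
      using i1 i2 by (simp add: Q_def P1_def)
    finally show ?thesis .
  qed
  obtain Cw where Cw: "0 \<le> Cw" "\<forall>X\<in>closed_upper_half. norm X \<le> l \<longrightarrow> \<bar>W X\<bar> \<le> Cw"
    using bounded_half_ball[OF W(1), of l] by blast
  obtain Cu where Cu: "0 \<le> Cu" "\<forall>X\<in>closed_upper_half. norm X \<le> k \<longrightarrow> \<bar>u X\<bar> \<le> Cu"
    using bounded_half_ball[OF uc, of k] by blast
  have "\<forall>e\<in>Basis. \<exists>C\<ge>0. \<forall>X\<in>closed_upper_half. norm X \<le> k \<longrightarrow> \<bar>P e X\<bar> \<le> C"
    using bounded_half_ball Pc by blast
  then obtain Cp where Cp: "\<forall>e\<in>Basis. 0 \<le> Cp e \<and> (\<forall>X\<in>closed_upper_half. norm X \<le> k \<longrightarrow> \<bar>P e X\<bar> \<le> Cp e)"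
    using bchoice[of Basis "\<lambda>e C. 0 \<le> C \<and> (\<forall>X\<in>closed_upper_half. norm X \<le> k \<longrightarrow> \<bar>P e X\<bar> \<le> C)"] by blast
  have pt: "\<bar>r0 (k * t) \<theta>\<bar> \<le> Cu" "\<bar>w0 (l * t) \<theta>\<bar> \<le> Cw" "\<bar>r1 (k * t) \<theta>\<bar> \<le> (\<Sum>e\<in>Basis. Cp e)"
    if t: "0 < t" "t \<le> 1" and th: "\<theta> \<in> half_sphere" for t \<theta>
  proof -
    have up: "(k * t) *\<^sub>R \<theta> \<in> upper_half" "(l * t) *\<^sub>R \<theta> \<in> upper_half" using half_sphere_scaleR[OF th] k l t by simp_all
    then have cl: "(k * t) *\<^sub>R \<theta> \<in> closed_upper_half" "(l * t) *\<^sub>R \<theta> \<in> closed_upper_half"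
      using upper_half_subset_closed by blast+
    have n1: "norm \<theta> = 1" using th by (simp add: half_sphere_def)
    have n: "norm ((k * t) *\<^sub>R \<theta>) \<le> k" "norm ((l * t) *\<^sub>R \<theta>) \<le> l"
      using n1 t k l by (simp_all add: mult_left_le)
    have "\<bar>u ((k * t) *\<^sub>R \<theta>)\<bar> \<le> Cu" using Cu(2) cl(1) n(1) by blast
    then show "\<bar>r0 (k * t) \<theta>\<bar> \<le> Cu" by (simp add: r0_def)
    have "W ((l * t) *\<^sub>R \<theta>) = w ((l * t) *\<^sub>R \<theta>)" using W(2) up(2) by blast
    moreover have "\<bar>W ((l * t) *\<^sub>R \<theta>)\<bar> \<le> Cw" using Cw(2) cl(2) n(2) by blast
    ultimately show "\<bar>w0 (l * t) \<theta>\<bar> \<le> Cw" by (simp add: w0_def)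
    have "\<bar>r1 (k * t) \<theta>\<bar> \<le> (\<Sum>e\<in>Basis. \<bar>(\<theta> \<bullet> e) * p0 e (k * t) \<theta>\<bar>)"
      unfolding r1_def by (rule sum_abs)
    also have "\<dots> \<le> (\<Sum>e\<in>Basis. Cp e)"
    proof (rule sum_mono)
      fix e :: "(real^'n) \<times> real" assume e: "e \<in> Basis"
      have "\<bar>\<theta> \<bullet> e\<bar> \<le> 1" using Basis_le_norm[OF e, of \<theta>] n1 by simp
      moreover have "\<bar>p0 e (k * t) \<theta>\<bar> \<le> Cp e" "0 \<le> Cp e"
      proof -
        have "P e ((k * t) *\<^sub>R \<theta>) = partial e u ((k * t) *\<^sub>R \<theta>)" using P e up(1) by blast
        moreover have "\<bar>P e ((k * t) *\<^sub>R \<theta>)\<bar> \<le> Cp e" "0 \<le> Cp e" using Cp e cl(1) n(1) by blast+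
        ultimately show "\<bar>p0 e (k * t) \<theta>\<bar> \<le> Cp e" "0 \<le> Cp e" by (simp_all add: p0_def)
      qed
      ultimately have "\<bar>\<theta> \<bullet> e\<bar> * \<bar>p0 e (k * t) \<theta>\<bar> \<le> 1 * Cp e" by (intro mult_mono) auto
      then show "\<bar>(\<theta> \<bullet> e) * p0 e (k * t) \<theta>\<bar> \<le> Cp e" by (simp add: abs_mult)
    qed
    finally show "\<bar>r1 (k * t) \<theta>\<bar> \<le> (\<Sum>e\<in>Basis. Cp e)" .
  qed
  have Csum: "0 \<le> (\<Sum>e\<in>Basis. Cp e)" using Cp by (intro sum_nonneg) blast
  have avg: "\<bar>\<integral>\<theta>. g \<theta> \<partial>M\<bar> \<le> C * measure M half_sphere"
    if "\<And>\<theta>. \<theta> \<in> half_sphere \<Longrightarrow> \<bar>g \<theta>\<bar> \<le> C" "integrable M g" for g :: "(real^'n) \<times> real \<Rightarrow> real" and C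
  proof -
    have "\<bar>\<integral>\<theta>. g \<theta> \<partial>M\<bar> \<le> (\<integral>\<theta>. \<bar>g \<theta>\<bar> \<partial>M)" by (rule integral_abs_bound)
    also have "\<dots> \<le> (\<integral>\<theta>. C \<partial>M)"
      by (rule integral_mono) (use that in auto)
    finally show ?thesis by (simp add: mult.commute)
  qed
  have P0b: "\<bar>P0 t\<bar> \<le> Cu * Cw * measure M half_sphere" if t: "0 < t" "t \<le> 1" for t
    unfolding P0_def
  proof (rule avg)
    show "integrable M (\<lambda>\<theta>. r0 (k * t) \<theta> * w0 (l * t) \<theta>)"
      by (rule H.adm_integrable[OF _ t(1)]) (intro H.adm_mult H.adm_const H.adm_dilate adms k l)
    show "\<bar>r0 (k * t) \<theta> * w0 (l * t) \<theta>\<bar> \<le> Cu * Cw" if "\<theta> \<in> half_sphere" for \<theta>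
      using pt(1,2)[OF t that] Cu(1) Cw(1) by (simp only: abs_mult) (intro mult_mono; simp)
  qed
  have Qb: "\<bar>Q t\<bar> \<le> k * (\<Sum>e\<in>Basis. Cp e) * Cw * measure M half_sphere" if t: "0 < t" "t \<le> 1" for t
    unfolding Q_def
  proof (rule avg)
    show "integrable M (\<lambda>\<theta>. k * r1 (k * t) \<theta> * w0 (l * t) \<theta>)"
      by (rule H.adm_integrable[OF _ t(1)]) (intro H.adm_mult H.adm_const H.adm_dilate adms k l)
    show "\<bar>k * r1 (k * t) \<theta> * w0 (l * t) \<theta>\<bar> \<le> k * (\<Sum>e\<in>Basis. Cp e) * Cw" if "\<theta> \<in> half_sphere" for \<theta>
    proof -
      have "\<bar>k * r1 (k * t) \<theta>\<bar> \<le> k * (\<Sum>e\<in>Basis. Cp e)"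
        using pt(3)[OF t that] k by (simp add: abs_mult)
      then show ?thesis
        using pt(2)[OF t that] Csum Cw(1) k by (simp only: abs_mult) (intro mult_mono; simp)
    qed
  qed
  have ev: "\<forall>\<^sub>F t in at_right 0. (0::real) < t \<and> t < 1"
    unfolding eventually_at_right_field by (intro exI[of _ 1]) auto
  define G where "G = (\<lambda>t. t powr ?m * (\<integral>\<theta>. f (t *\<^sub>R \<theta>) \<partial>M))"
  have limG: "(G \<longlongrightarrow> G 1 - V0) (at_right 0)"
  proof (rule Lim_transform_eventually)
    show "((\<lambda>t. G 1 - V t) \<longlongrightarrow> G 1 - V0) (at_right 0)"
      by (intro tendsto_diff tendsto_const limV)
    show "\<forall>\<^sub>F t in at_right 0. G 1 - V t = G t"
      using ev
    proof (rule eventually_mono)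
      fix t :: real assume "0 < t \<and> t < 1"
      then show "G 1 - V t = G t" using flux[of t 1] by (simp add: G_def V_def)
    qed
  qed
  have limQ: "((\<lambda>t. t powr ?m * Q t) \<longlongrightarrow> 0) (at_right 0)"
  proof (rule Lim_null_comparison)
    show "\<forall>\<^sub>F t in at_right 0. norm (t powr ?m * Q t) \<le> t powr ?m * (k * (\<Sum>e\<in>Basis. Cp e) * Cw * measure M half_sphere)"
      using ev
    proof (rule eventually_mono)
      fix t :: real assume "0 < t \<and> t < 1"
      then show "norm (t powr ?m * Q t) \<le> t powr ?m * (k * (\<Sum>e\<in>Basis. Cp e) * Cw * measure M half_sphere)"
        using Qb[of t] by (simp add: abs_mult mult_left_mono)
    qed
    have "((\<lambda>t. t powr ?m) \<longlongrightarrow> 0 powr ?m) (at_right 0)"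
      using dim by (intro tendsto_powr2 tendsto_intros) (auto simp: eventually_at_right_field intro!: exI[of _ 1])
    then show "((\<lambda>t. t powr ?m * (k * (\<Sum>e\<in>Basis. Cp e) * Cw * measure M half_sphere)) \<longlongrightarrow> 0) (at_right 0)"
      using tendsto_mult_left_zero[of "\<lambda>t. t powr ?m"] by simp
  qed
  have "((\<lambda>t. t powr ?m * P1 t) \<longlongrightarrow> V0 - G 1) (at_right 0)"
  proof (rule Lim_transform_eventually)
    show "((\<lambda>t. 2 * (t powr ?m * Q t) - G t) \<longlongrightarrow> V0 - G 1) (at_right 0)"
      using tendsto_diff[OF tendsto_mult[OF tendsto_const[of 2] limQ] limG] by simp
    show "\<forall>\<^sub>F t in at_right 0. 2 * (t powr ?m * Q t) - G t = t powr ?m * P1 t"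
      using ev
    proof (rule eventually_mono)
      fix t :: real assume "0 < t \<and> t < 1"
      then show "2 * (t powr ?m * Q t) - G t = t powr ?m * P1 t"
        by (simp add: G_def fe algebra_simps)
    qed
  qed
  then have "V0 - G 1 = 0"
    using dim by (intro bounded_imp_zero_flux[of P0 P1 "Cu * Cw * measure M half_sphere" ?m] dP P0b) auto
  then have "(\<integral>\<theta>. f \<theta> \<partial>M) = V0" by (simp add: G_def)
  moreover have "(\<integral>\<theta>. f \<theta> \<partial>M) = (\<integral>\<theta>. w0 l \<theta> * (k * r1 k \<theta>) - r0 k \<theta> * (l * w1 l \<theta>) \<partial>M)"
  proof (rule Bochner_Integration.integral_cong[OF refl])
    fix \<theta> assume "\<theta> \<in> space M"
    then have th: "\<theta> \<in> half_sphere" by simp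
    have "k *\<^sub>R \<theta> \<in> upper_half" "l *\<^sub>R \<theta> \<in> upper_half" using half_sphere_scaleR[OF th] k l by simp_all
    then show "f \<theta> = w0 l \<theta> * (k * r1 k \<theta>) - r0 k \<theta> * (l * w1 l \<theta>)"
      using P W(2) Wr(2) th by (simp add: f_def r0_def r1_def p0_def w0_def w1_def half_sphere_def)
  qed
  moreover have "(\<integral>X. indicator (upper_half \<inter> ball 0 1) X * (snd X powr b * d X) \<partial>lborel) =
    (\<integral>X. indicator (upper_half \<inter> ball 0 1) X * (snd X powr b * (w (l *\<^sub>R X) * (k\<^sup>2 * w (k *\<^sub>R X)))) \<partial>lborel)"
  proof (rule Bochner_Integration.integral_cong[OF refl])
    fix X :: "(real^'n) \<times> real"
    show "indicator (upper_half \<inter> ball 0 1) X * (snd X powr b * d X) =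
      indicator (upper_half \<inter> ball 0 1) X * (snd X powr b * (w (l *\<^sub>R X) * (k\<^sup>2 * w (k *\<^sub>R X))))"
      using W(2) upper_half_scaleR[OF k, of X] upper_half_scaleR[OF l, of X]
      by (cases "X \<in> upper_half") (simp_all add: d_def)
  qed
  moreover have "(\<integral>x. indicator (ball (0 :: real^'n) 1) x * h (x, 0) \<partial>lborel) =
    - (\<integral>x. indicator (ball 0 1) x * (u (k *\<^sub>R x, 0) * (l powr (1 - b) *
        (Cns * norm (l *\<^sub>R x) powr a * \<bar>u (l *\<^sub>R x, 0)\<bar> powr (p - 1) * u (l *\<^sub>R x, 0)))) \<partial>lborel)"
    using fl0(3) fl1(3) by (simp add: h_def flip: integral_minus)
  ultimately show ?thesis by (simp add: V0_def)
qed

section \<open>The rescaled solution\<close>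

text \<open>The exponent for which t^\<alpha> u(t X) solves the same boundary value problem:
  \<alpha> (p - 1) = 2 s + a.\<close>

definition \<alpha> :: real where "\<alpha> = (2 * s + a) / (p - 1)"
text \<open>The growth exponent of the weighted half-sphere; m + 1 plays the part of the
  dimension.\<close>

definition m :: real where "m = real CARD('n) + b"

text \<open>\<open>U\<close>, \<open>g0\<close> and \<open>W\<close> are the rescaled solution \<open>u\<^sup>t\<close>, its gradient and \<open>\<Delta>\<^sub>b u\<^sup>t\<close> on the unit half-sphere;
  the digit counts the derivatives with respect to \<open>t\<close>.\<close>

definition U where "U t \<theta> = t powr \<alpha> * r0 t \<theta>"
definition U1 where "U1 t \<theta> = t powr (\<alpha> - 1) * (\<alpha> * r0 t \<theta> + t * r1 t \<theta>)"
definition U2 where "U2 t \<theta> = t powr (\<alpha> - 2) * (\<alpha> * (\<alpha> - 1) * r0 t \<theta> + 2 * \<alpha> * t * r1 t \<theta> + t\<^sup>2 * r2 t \<theta>)"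
definition U3 where "U3 t \<theta> = t powr (\<alpha> - 3) * (\<alpha> * (\<alpha> - 1) * (\<alpha> - 2) * r0 t \<theta>
  + 3 * \<alpha> * (\<alpha> - 1) * t * r1 t \<theta> + 3 * \<alpha> * t\<^sup>2 * r2 t \<theta> + t ^ 3 * r3 t \<theta>)"
definition g0 where "g0 e t \<theta> = t powr (\<alpha> + 1) * p0 e t \<theta>"
definition g1 where "g1 e t \<theta> = t powr (\<alpha> + 1 - 1) * ((\<alpha> + 1) * p0 e t \<theta> + t * p1 e t \<theta>)"
definition g2 where "g2 e t \<theta> = t powr (\<alpha> + 1 - 2) * ((\<alpha> + 1) * (\<alpha> + 1 - 1) * p0 e t \<theta> + 2 * (\<alpha> + 1) * t * p1 e t \<theta> + t\<^sup>2 * p2 e t \<theta>)"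
definition W where "W t \<theta> = t powr (\<alpha> + 2) * w0 t \<theta>"
definition W1 where "W1 t \<theta> = t powr (\<alpha> + 2 - 1) * ((\<alpha> + 2) * w0 t \<theta> + t * w1 t \<theta>)"

lemma adm_deriv_U: "H.adm_deriv U U1"
  unfolding U_def[abs_def] U1_def[abs_def] by (rule H.adm_deriv_powr[OF adm_deriv_r0])

lemma adm_deriv_U1: "H.adm_deriv U1 U2"
  unfolding U1_def[abs_def] U2_def[abs_def] by (rule H.adm_deriv_powr2[OF adm_deriv_r0 adm_deriv_r1])

lemma adm_deriv_U2: "H.adm_deriv U2 U3"
  unfolding U2_def[abs_def] U3_def[abs_def] by (rule H.adm_deriv_powr3[OF adm_deriv_r0 adm_deriv_r1 adm_deriv_r2])

lemma adm_deriv_g0: "e \<in> Basis \<Longrightarrow> H.adm_deriv (g0 e) (g1 e)"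
  unfolding g0_def[abs_def] g1_def[abs_def] by (rule H.adm_deriv_powr[OF adm_deriv_p0])

lemma adm_deriv_g1: "e \<in> Basis \<Longrightarrow> H.adm_deriv (g1 e) (g2 e)"
  unfolding g1_def[abs_def] g2_def[abs_def] by (rule H.adm_deriv_powr2[OF adm_deriv_p0 adm_deriv_p1])

lemma adm_deriv_W: "H.adm_deriv W W1"
  unfolding W_def[abs_def] W1_def[abs_def] by (rule H.adm_deriv_powr[OF adm_deriv_w0])

text \<open>Applied to the rescaled solution at r = 1, the radial part of \<open>Delta_b\<close>,
  that is the second radial derivative plus m / r times the first, equals t^2 \<open>U2\<close> +
  \<open>cA\<close> t \<open>U1\<close> + \<open>cB\<close> \<open>U\<close>. The two constants
  arise from moving t^\<alpha> through the derivatives.\<close>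

definition cA :: real where "cA = m - 2 * \<alpha>"
definition cB :: real where "cB = \<alpha> * (\<alpha> + 1 - m)"

definition L where "L t \<theta> = W t \<theta> - (t\<^sup>2 * U2 t \<theta> + cA * (t * U1 t \<theta>) + cB * U t \<theta>)"
definition L1 where "L1 t \<theta> = W1 t \<theta> - ((2 * t * U2 t \<theta> + t\<^sup>2 * U3 t \<theta>) + cA * (U1 t \<theta> + t * U2 t \<theta>) + cB * U1 t \<theta>)"

lemma adm_deriv_L: "H.adm_deriv L L1"
proof -
  have "H.adm_deriv (\<lambda>t \<theta>. W t \<theta> - ((t * t) * U2 t \<theta> + cA * (t * U1 t \<theta>) + cB * U t \<theta>))
    (\<lambda>t \<theta>. W1 t \<theta> - (((1 * t + t * 1) * U2 t \<theta> + (t * t) * U3 t \<theta>) + cA * (1 * U1 t \<theta> + t * U2 t \<theta>) + cB * U1 t \<theta>))"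
    by (intro H.adm_deriv_diff H.adm_deriv_add H.adm_deriv_cmult H.adm_deriv_mult H.adm_deriv_id
        adm_deriv_W adm_deriv_U adm_deriv_U1 adm_deriv_U2)
  then show ?thesis unfolding L_def[abs_def] L1_def[abs_def] by (simp add: power2_eq_square)
qed

text \<open>\<open>L\<close> is the spherical part of the operator \<open>\<Delta>\<^sub>b\<close> applied to the rescaled solution.\<close>

lemma L_eq:
  assumes "0 < t"
  shows "L t \<theta> = t powr \<alpha> * (t\<^sup>2 * w0 t \<theta> - t\<^sup>2 * r2 t \<theta> - m * t * r1 t \<theta>)"
proof -
  have p: "t powr (\<alpha> + 2) = t powr \<alpha> * t\<^sup>2" "t * t powr (\<alpha> - 1) = t powr \<alpha>" "t\<^sup>2 * t powr (\<alpha> - 2) = t powr \<alpha>"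
    using assms powr_realpow[of t 2] by (simp_all add: powr_add powr_diff)
  have "t\<^sup>2 * U2 t \<theta> = t powr \<alpha> * (\<alpha> * (\<alpha> - 1) * r0 t \<theta> + 2 * \<alpha> * t * r1 t \<theta> + t\<^sup>2 * r2 t \<theta>)"
    unfolding U2_def p(3)[symmetric] by (simp only: mult.assoc)
  moreover have "t * U1 t \<theta> = t powr \<alpha> * (\<alpha> * r0 t \<theta> + t * r1 t \<theta>)"
    unfolding U1_def p(2)[symmetric] by (simp only: mult.assoc)
  ultimately show ?thesis
    unfolding L_def W_def U_def p(1) cA_def cB_def by (simp add: algebra_simps)
qed

text \<open>The inner product of the tangential parts of two vectors at \<open>\<theta>\<close>.\<close>

definition tau where "tau f g k l \<theta> = (\<Sum>e\<in>Basis. f e k \<theta> * g e l \<theta>) - (\<Sum>e\<in>Basis. (\<theta> \<bullet> e) * f e k \<theta>) * (\<Sum>e\<in>Basis. (\<theta> \<bullet> e) * g e l \<theta>)"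
  for \<theta> :: "(real^'n) \<times> real"

text \<open>The preceding integration by parts, multiplied by (k l)^\<alpha> and stated for
  \<open>L\<close>. \<open>U\<close> and \<open>L\<close> carry separate parameters, so
  differentiating in one leaves the other untouched.\<close>

lemma spherical_parts_U:
  assumes l: "0 < l" and k: "0 < k"
  shows "(\<integral>\<theta>. U k \<theta> * L l \<theta> + tau g0 g0 k l \<theta> \<partial>M) = 0"
proof -
  let ?A = "\<lambda>\<theta>. l * k * ((\<Sum>e\<in>Basis. p0 e k \<theta> * p0 e l \<theta>) - r1 k \<theta> * r1 l \<theta>)"
  let ?B = "\<lambda>\<theta>. r0 k \<theta> * (l\<^sup>2 * r2 l \<theta> + m * l * r1 l \<theta> - l\<^sup>2 * w0 l \<theta>)"
  note adms = H.adm_derivD(1)[OF adm_deriv_p0] H.adm_derivD(1)[OF adm_deriv_r0] H.adm_derivD(1)[OF adm_deriv_r1]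
    H.adm_derivD(1)[OF adm_deriv_r2] H.adm_derivD(1)[OF adm_deriv_w0]
  note fk = H.adm_freeze[OF _ k] and fl = H.adm_freeze[OF _ l]
  have "H.adm (\<lambda>t. ?A)"
    by (intro H.adm_mult H.adm_diff H.adm_sum H.adm_const fk[OF adms(1)] fl[OF adms(1)] fk[OF adms(3)] fl[OF adms(3)]) auto
  then have iA: "integrable M ?A" using H.adm_integrable[of "\<lambda>t. ?A" 1] by simp
  have "H.adm (\<lambda>t. ?B)"
    by (intro H.adm_mult H.adm_diff H.adm_add H.adm_const fk[OF adms(2)] fl[OF adms(4)] fl[OF adms(3)] fl[OF adms(5)])
  then have iB: "integrable M ?B" using H.adm_integrable[of "\<lambda>t. ?B" 1] by simp
  have pw: "U k \<theta> * L l \<theta> + tau g0 g0 k l \<theta> = k powr \<alpha> * l powr \<alpha> * (?A \<theta> - ?B \<theta>)" for \<theta>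
  proof -
    have "tau g0 g0 k l \<theta> = (k powr \<alpha> * l powr \<alpha>) * ?A \<theta>"
    proof -
      have "(\<Sum>e\<in>Basis. g0 e k \<theta> * g0 e l \<theta>) = (k powr (\<alpha> + 1) * l powr (\<alpha> + 1)) * (\<Sum>e\<in>Basis. p0 e k \<theta> * p0 e l \<theta>)"
        unfolding sum_distrib_left by (simp add: g0_def mult_ac)
      moreover have "(\<Sum>e\<in>Basis. (\<theta> \<bullet> e) * g0 e c \<theta>) = c powr (\<alpha> + 1) * r1 c \<theta>" for c
        unfolding r1_def sum_distrib_left by (simp add: g0_def mult_ac)
      moreover have "k powr (\<alpha> + 1) = k powr \<alpha> * k" "l powr (\<alpha> + 1) = l powr \<alpha> * l"
        using k l by (simp_all add: powr_add)
      ultimately show ?thesis by (simp add: tau_def algebra_simps)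
    qed
    moreover have "U k \<theta> * L l \<theta> = (k powr \<alpha> * l powr \<alpha>) * (- ?B \<theta>)"
      unfolding L_eq[OF l] U_def by (simp add: algebra_simps)
    ultimately show ?thesis by (simp add: algebra_simps)
  qed
  have "(\<integral>\<theta>. ?A \<theta> \<partial>M) = (\<integral>\<theta>. ?B \<theta> \<partial>M)"
    unfolding m_def by (rule spherical_integration_by_parts[OF l k])
  then have "(\<integral>\<theta>. ?A \<theta> - ?B \<theta> \<partial>M) = 0"
    using Bochner_Integration.integral_diff[OF iA iB] by simp
  then show ?thesis unfolding pw integral_mult_right_zero by simp
qed

text \<open>\<open>tau\<close> is bilinear, so with \<open>l\<close> frozen only the factor with
  parameter \<open>k\<close> is differentiated.\<close>

lemma adm_deriv_tau_left:
  assumes "\<And>e. e \<in> Basis \<Longrightarrow> H.adm_deriv (f e) (f' e)" "\<And>e. e \<in> Basis \<Longrightarrow> H.adm (g e)" "0 < l"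
  shows "H.adm_deriv (\<lambda>k. tau f g k l) (\<lambda>k. tau f' g k l)"
proof -
  have c: "H.adm_deriv (\<lambda>t. g e l) (\<lambda>t \<theta>. 0)" if "e \<in> Basis" for e
    by (rule H.adm_deriv_const[OF assms(2)[OF that] assms(3)])
  have "H.adm_deriv (\<lambda>t \<theta>. \<Sum>e\<in>Basis. (\<theta> \<bullet> e) * g e l \<theta>) (\<lambda>t \<theta>. \<Sum>e\<in>Basis. (\<theta> \<bullet> e) * 0)"
    by (intro H.adm_deriv_sum H.adm_deriv_snd continuous_on_component c) auto
  then have "H.adm_deriv (\<lambda>k \<theta>. (\<Sum>e\<in>Basis. f e k \<theta> * g e l \<theta>)
      - (\<Sum>e\<in>Basis. (\<theta> \<bullet> e) * f e k \<theta>) * (\<Sum>e\<in>Basis. (\<theta> \<bullet> e) * g e l \<theta>))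
    (\<lambda>k \<theta>. (\<Sum>e\<in>Basis. f' e k \<theta> * g e l \<theta> + f e k \<theta> * 0)
      - ((\<Sum>e\<in>Basis. (\<theta> \<bullet> e) * f' e k \<theta>) * (\<Sum>e\<in>Basis. (\<theta> \<bullet> e) * g e l \<theta>)
        + (\<Sum>e\<in>Basis. (\<theta> \<bullet> e) * f e k \<theta>) * (\<Sum>e\<in>Basis. (\<theta> \<bullet> e) * 0)))"
    by (intro H.adm_deriv_diff H.adm_deriv_mult H.adm_deriv_sum H.adm_deriv_snd continuous_on_component c assms(1)) auto
  then show ?thesis by (simp add: tau_def[abs_def])
qed

lemma tau_commute: "tau f g k l \<theta> = tau g f l k \<theta>"
  by (simp add: tau_def mult.commute)

lemma adm_deriv_tau_right:
  assumes "\<And>e. e \<in> Basis \<Longrightarrow> H.adm_deriv (g e) (g' e)" "\<And>e. e \<in> Basis \<Longrightarrow> H.adm (f e)" "0 < k"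
  shows "H.adm_deriv (\<lambda>l. tau f g k l) (\<lambda>l. tau f g' k l)"
  using adm_deriv_tau_left[of g g' f k] assms by (simp add: tau_commute[of f, abs_def])

lemma adm_deriv_tau_diag:
  assumes "\<And>e. e \<in> Basis \<Longrightarrow> H.adm_deriv (f e) (f' e)" "\<And>e. e \<in> Basis \<Longrightarrow> H.adm_deriv (g e) (g' e)"
  shows "H.adm_deriv (\<lambda>t. tau f g t t) (\<lambda>t \<theta>. tau f' g t t \<theta> + tau f g' t t \<theta>)"
proof -
  have "H.adm_deriv (\<lambda>t \<theta>. (\<Sum>e\<in>Basis. f e t \<theta> * g e t \<theta>)
      - (\<Sum>e\<in>Basis. (\<theta> \<bullet> e) * f e t \<theta>) * (\<Sum>e\<in>Basis. (\<theta> \<bullet> e) * g e t \<theta>))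
    (\<lambda>t \<theta>. (\<Sum>e\<in>Basis. f' e t \<theta> * g e t \<theta> + f e t \<theta> * g' e t \<theta>)
      - ((\<Sum>e\<in>Basis. (\<theta> \<bullet> e) * f' e t \<theta>) * (\<Sum>e\<in>Basis. (\<theta> \<bullet> e) * g e t \<theta>)
        + (\<Sum>e\<in>Basis. (\<theta> \<bullet> e) * f e t \<theta>) * (\<Sum>e\<in>Basis. (\<theta> \<bullet> e) * g' e t \<theta>)))"
    by (intro H.adm_deriv_diff H.adm_deriv_mult H.adm_deriv_sum H.adm_deriv_snd continuous_on_component assms) auto
  then show ?thesis
    unfolding tau_def[abs_def] by (rule H.adm_deriv_eqI) (simp add: sum.distrib)
qed

lemma adm_mult_freeze:
  "H.adm_deriv f f' \<Longrightarrow> H.adm g \<Longrightarrow> 0 < l \<Longrightarrow> H.adm_deriv (\<lambda>k \<theta>. f k \<theta> * g l \<theta>) (\<lambda>k \<theta>. f' k \<theta> * g l \<theta>)"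
  using H.adm_deriv_mult[of f f' "\<lambda>t. g l" "\<lambda>t \<theta>. 0"] H.adm_deriv_const[of g l] by simp

text \<open>For fixed \<open>l\<close> the identity for \<open>U\<close> holds for all
  \<open>k > 0\<close> and may be differentiated in \<open>k\<close>. No boundary condition for the
  t-derivative of the rescaled solution is used.\<close>

lemma spherical_parts_U1:
  assumes l: "0 < l" and k: "0 < k"
  shows "(\<integral>\<theta>. U1 k \<theta> * L l \<theta> + tau g1 g0 k l \<theta> \<partial>M) = 0"
proof (rule H.integral_derivative_eq_0[OF _ _ k])
  show "H.adm_deriv (\<lambda>k \<theta>. U k \<theta> * L l \<theta> + tau g0 g0 k l \<theta>) (\<lambda>k \<theta>. U1 k \<theta> * L l \<theta> + tau g1 g0 k l \<theta>)"
    by (intro H.adm_deriv_add adm_mult_freeze adm_deriv_tau_left adm_deriv_U adm_deriv_g0 H.adm_derivD(1)[OF adm_deriv_L]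
        H.adm_derivD(1)[OF adm_deriv_g0] l)
qed (rule spherical_parts_U[OF l])

lemma spherical_parts_U2:
  assumes l: "0 < l" and k: "0 < k"
  shows "(\<integral>\<theta>. U2 k \<theta> * L l \<theta> + tau g2 g0 k l \<theta> \<partial>M) = 0"
proof (rule H.integral_derivative_eq_0[OF _ _ k])
  show "H.adm_deriv (\<lambda>k \<theta>. U1 k \<theta> * L l \<theta> + tau g1 g0 k l \<theta>) (\<lambda>k \<theta>. U2 k \<theta> * L l \<theta> + tau g2 g0 k l \<theta>)"
    by (intro H.adm_deriv_add adm_mult_freeze adm_deriv_tau_left adm_deriv_U1 adm_deriv_g1 H.adm_derivD(1)[OF adm_deriv_L]
        H.adm_derivD(1)[OF adm_deriv_g0] l)
qed (rule spherical_parts_U1[OF l])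

text \<open>Here the derivative is taken in \<open>l\<close>, with \<open>U1\<close> frozen at
  \<open>k\<close>; it moves onto \<open>L\<close> and onto the second slot of
  \<open>tau\<close>.\<close>

lemma spherical_parts_U1_L1:
  assumes l: "0 < l" and k: "0 < k"
  shows "(\<integral>\<theta>. U1 k \<theta> * L1 l \<theta> + tau g1 g1 k l \<theta> \<partial>M) = 0"
proof (rule H.integral_derivative_eq_0[OF _ _ l])
  have "H.adm_deriv (\<lambda>l \<theta>. U1 k \<theta> * L l \<theta>) (\<lambda>l \<theta>. U1 k \<theta> * L1 l \<theta>)"
    using adm_mult_freeze[OF adm_deriv_L H.adm_derivD(1)[OF adm_deriv_U1] k] by (simp add: mult.commute)
  then show "H.adm_deriv (\<lambda>l \<theta>. U1 k \<theta> * L l \<theta> + tau g1 g0 k l \<theta>) (\<lambda>l \<theta>. U1 k \<theta> * L1 l \<theta> + tau g1 g1 k l \<theta>)"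
    by (intro H.adm_deriv_add adm_deriv_tau_right adm_deriv_g0 H.adm_derivD(1)[OF adm_deriv_g1] k)
qed (rule spherical_parts_U1[OF _ k])

text \<open>Cauchy-Schwarz with |theta| = 1: the radial component is no longer than the
  vector.\<close>

lemma tau_nonneg:
  assumes "\<theta> \<in> half_sphere"
  shows "0 \<le> tau f f t t \<theta>"
proof -
  define v where "v = (\<Sum>e\<in>Basis. f e t \<theta> *\<^sub>R e)"
  have ve: "v \<bullet> e = f e t \<theta>" if "e \<in> Basis" for e
    using that by (simp add: v_def inner_sum_left_Basis)
  have "(\<Sum>e\<in>Basis. (\<theta> \<bullet> e) * f e t \<theta>) = \<theta> \<bullet> v"
    by (subst euclidean_inner) (simp add: ve)
  moreover have "(\<Sum>e\<in>Basis. f e t \<theta> * f e t \<theta>) = v \<bullet> v"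
    by (subst euclidean_inner) (simp add: ve)
  moreover have "(\<theta> \<bullet> v) * (\<theta> \<bullet> v) \<le> v \<bullet> v"
    using Cauchy_Schwarz_ineq[of \<theta> v] assms by (simp add: half_sphere_def power2_eq_square dot_square_norm)
  ultimately show ?thesis by (simp add: tau_def)
qed

section \<open>The trace of the solution on the flat boundary\<close>

sublocale B: param_measure "unit_ball_measure :: (real^'n) measure" "cball 0 1"
  by (rule param_measure_unit_ball)

definition v0 :: "real \<Rightarrow> real^'n \<Rightarrow> real" where "v0 t x = u (t *\<^sub>R x, 0)"

text \<open>\<open>u\<close> is differentiable only for y > 0. On horizontal lines at small height
  the mean value theorem controls the linearisation error uniformly in y, because the partial
  derivatives extend continuously; the estimate survives y to 0.\<close>

lemma trace_derivative: "\<exists>v1. B.adm_deriv v0 v1"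
proof -
  obtain P where P: "\<forall>e\<in>Basis. continuous_on closed_upper_half (P e) \<and> (\<forall>X\<in>upper_half. P e X = partial e u X)"
    using partials_extend by blast
  have Pc: "e \<in> Basis \<Longrightarrow> continuous_on closed_upper_half (P e)" for e using P by blast
  have uc: "continuous_on closed_upper_half u"
    using regular unfolding regular_up_to_boundary_def by blast
  define D where "D = (\<lambda>x X. \<Sum>e\<in>Basis. ((x, 0) \<bullet> e) * P e X)"
  define v1 where "v1 = (\<lambda>t x. D x (t *\<^sub>R x, 0))"
  have Dc: "continuous_on closed_upper_half (D x)" for x
    unfolding D_def by (intro continuous_intros Pc)
  have dy: "((\<lambda>t. u (t *\<^sub>R x, y)) has_real_derivative D x (t *\<^sub>R x, y)) (at t)" if y: "0 < y" for t x y
  proof -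
    have up: "(t *\<^sub>R x, y) \<in> upper_half" using y by (simp add: upper_half_def)
    have eq: "(0, y) + t *\<^sub>R (x, 0) = (t *\<^sub>R x, y)" for t by simp
    have du: "u differentiable (at (t *\<^sub>R x, y))"
      by (rule C_k_Suc_differentiable[OF C_k_u[of "Suc 0"] open_upper_half up]) simp
    have "((\<lambda>t. u ((0, y) + t *\<^sub>R (x, 0))) has_real_derivative grad u ((0, y) + t *\<^sub>R (x, 0)) \<bullet> (x, 0)) (at t)"
      by (rule has_real_derivative_along) (simp only: eq du)
    moreover have "grad u (t *\<^sub>R x, y) \<bullet> (x, 0) = D x (t *\<^sub>R x, y)"
      unfolding D_def using P up by (subst euclidean_inner) (simp add: grad_Basis mult.commute)
    ultimately show ?thesis unfolding eq by simp
  qed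
  have "((\<lambda>t. v0 t x) has_real_derivative v1 t x) (at t)" for t x
    unfolding has_field_derivative_iff
  proof (rule tendstoI)
    fix \<epsilon> :: real assume e: "0 < \<epsilon>"
    have "continuous (at (t *\<^sub>R x, 0) within closed_upper_half) (D x)"
      using Dc by (simp add: continuous_on_eq_continuous_within closed_upper_half_def)
    then obtain \<delta> where \<delta>: "0 < \<delta>"
      "\<And>X. X \<in> closed_upper_half \<Longrightarrow> dist X (t *\<^sub>R x, 0) < \<delta> \<Longrightarrow> dist (D x X) (v1 t x) < \<epsilon> / 2"
      unfolding continuous_within_eps_delta v1_def using e half_gt_zero by metis
    \<comment> \<open>A step of size \<eta> in the parameter moves the point by at most \<delta> /
      2; the summand 1 covers x = 0.\<close>
    define \<eta> where "\<eta> = \<delta> / (2 * (norm x + 1))"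
    have \<eta>: "0 < \<eta>" using \<delta>(1) by (simp add: \<eta>_def add_nonneg_pos)
    have near: "dist (r *\<^sub>R x, y) (t *\<^sub>R x, 0) < \<delta>" if "\<bar>r - t\<bar> \<le> \<eta>" "0 < y" "y < \<delta> / 2" for r y
    proof -
      have "dist (r *\<^sub>R x, y) (t *\<^sub>R x, 0) \<le> norm ((r - t) *\<^sub>R x) + norm y"
        by (simp add: dist_norm norm_Pair scaleR_left_diff_distrib sqrt_sum_squares_le_sum_abs[THEN order_trans])
      also have "norm ((r - t) *\<^sub>R x) \<le> \<eta> * (norm x + 1)"
        using that(1) by (simp add: mult_mono)
      also have "\<eta> * (norm x + 1) = \<delta> / 2"
      proof -
        have "norm x + 1 \<noteq> 0" using norm_ge_zero[of x] by linarith
        then show ?thesis unfolding \<eta>_def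
          unfolding times_divide_eq_left by (rule nonzero_mult_divide_mult_cancel_right)
      qed
      finally show ?thesis using that by simp
    qed
    have bound: "\<bar>v0 r x - v0 t x - v1 t x * (r - t)\<bar> \<le> \<epsilon> / 2 * \<bar>r - t\<bar>" if r: "\<bar>r - t\<bar> \<le> \<eta>" for r
    proof -
      \<comment> \<open>After the expected linear part is subtracted, the derivative in r is at most
        \<epsilon> / 2, so the mean value theorem bounds the error.\<close>
      let ?f = "\<lambda>y r. u (r *\<^sub>R x, y) - v1 t x * r"
      have bnd: "norm (?f y r - ?f y t) \<le> \<epsilon> / 2 * norm (r - t)" if y: "0 < y" "y < \<delta> / 2" for y
      proof (rule field_differentiable_bound[of "{t - \<eta>..t + \<eta>}"])
        fix z assume z: "z \<in> {t - \<eta>..t + \<eta>}"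
        show "(?f y has_field_derivative D x (z *\<^sub>R x, y) - v1 t x) (at z within {t - \<eta>..t + \<eta>})"
          by (rule has_field_derivative_at_within[OF DERIV_diff[OF dy[OF y(1)] DERIV_cmult_Id]])
        have "dist (z *\<^sub>R x, y) (t *\<^sub>R x, 0) < \<delta>" using z y by (intro near) auto
        then have "dist (D x (z *\<^sub>R x, y)) (v1 t x) < \<epsilon> / 2"
          using y by (intro \<delta>(2)) (auto simp: closed_upper_half_def)
        then show "norm (D x (z *\<^sub>R x, y) - v1 t x) \<le> \<epsilon> / 2" by (simp add: dist_norm)
      qed (use r \<eta> in auto)
      have lim: "((\<lambda>y. u (r *\<^sub>R x, y)) \<longlongrightarrow> u (r *\<^sub>R x, 0)) (at_right 0)" for r
      proof (rule continuous_on_tendsto_compose[OF uc])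
        show "((\<lambda>y. (r *\<^sub>R x, y)) \<longlongrightarrow> (r *\<^sub>R x, 0)) (at_right (0::real))" by (intro tendsto_intros)
        show "\<forall>\<^sub>F y in at_right 0. (r *\<^sub>R x, y) \<in> closed_upper_half"
          by (rule eventually_mono[OF eventually_at_right_less[of 0]]) (simp add: closed_upper_half_def)
      qed (simp add: closed_upper_half_def)
      have "((\<lambda>y. norm (?f y r - ?f y t)) \<longlongrightarrow> norm (?f 0 r - ?f 0 t)) (at_right 0)"
        by (intro tendsto_intros lim)
      moreover have "\<forall>\<^sub>F y in at_right 0. norm (?f y r - ?f y t) \<le> \<epsilon> / 2 * norm (r - t)"
        unfolding eventually_at_right_field using \<delta>(1) bnd by (intro exI[of _ "\<delta> / 2"] conjI allI impI) simp_all
      ultimately have "norm (?f 0 r - ?f 0 t) \<le> \<epsilon> / 2 * norm (r - t)"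
        by (rule tendsto_upperbound) simp
      then show ?thesis by (simp add: v0_def algebra_simps)
    qed
    have "\<forall>\<^sub>F r in at t. \<bar>r - t\<bar> < \<eta> \<and> r \<noteq> t"
      using \<eta> unfolding eventually_at by (intro exI[of _ \<eta>]) (auto simp: dist_real_def)
    then show "\<forall>\<^sub>F r in at t. dist ((v0 r x - v0 t x) / (r - t)) (v1 t x) < \<epsilon>"
    proof (rule eventually_mono)
      fix r assume r: "\<bar>r - t\<bar> < \<eta> \<and> r \<noteq> t"
      have "(v0 r x - v0 t x) / (r - t) - v1 t x = (v0 r x - v0 t x - v1 t x * (r - t)) / (r - t)"
        using r by (simp add: field_simps)
      then have "dist ((v0 r x - v0 t x) / (r - t)) (v1 t x) \<le> \<epsilon> / 2"
        using bound[of r] r by (simp add: dist_norm divide_le_eq)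
      then show "dist ((v0 r x - v0 t x) / (r - t)) (v1 t x) < \<epsilon>" using e by simp
    qed
  qed
  moreover have "B.adm v0"
  proof (rule B.admI[of "\<lambda>z. u (fst z *\<^sub>R snd z, 0)"])
    show "continuous_on ({0<..} \<times> cball 0 1) (\<lambda>z. u (fst z *\<^sub>R snd z, 0))"
      by (rule continuous_on_compose2[OF uc]) (auto intro!: continuous_intros simp: closed_upper_half_def)
  qed (simp add: v0_def)
  moreover have "B.adm v1"
  proof (rule B.admI[of "\<lambda>z. \<Sum>e\<in>Basis. ((snd z, 0) \<bullet> e) * P e (fst z *\<^sub>R snd z, 0)"])
    have "continuous_on ({0<..} \<times> cball 0 1) (\<lambda>z. P e (fst z *\<^sub>R snd z, 0))" if "e \<in> Basis" for e
      by (rule continuous_on_compose2[OF Pc[OF that]]) (auto intro!: continuous_intros simp: closed_upper_half_def)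
    then show "continuous_on ({0<..} \<times> cball 0 1) (\<lambda>z. \<Sum>e\<in>Basis. ((snd z, 0) \<bullet> e) * P e (fst z *\<^sub>R snd z, 0))"
      by (intro continuous_intros)
  qed (simp add: v1_def D_def)
  ultimately show ?thesis unfolding B.adm_deriv_def by blast
qed

definition V where "V t x = t powr \<alpha> * v0 t x"
definition fV where "fV t x = norm x powr a * (\<bar>V t x\<bar> powr (p - 1) * V t x)"

lemma adm_deriv_V: "\<exists>V1. B.adm_deriv V V1"
  using trace_derivative B.adm_deriv_powr unfolding V_def[abs_def] by blast

lemma adm_norm_powr: "B.adm (\<lambda>t x. norm x powr a)"
  using a by (intro B.adm_snd continuous_on_powr' continuous_intros) auto

lemma adm_fV: "B.adm fV"
proof -
  obtain V1 where "B.adm_deriv V V1" using adm_deriv_V by blast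
  then have "B.adm V" by (rule B.adm_derivD)
  then show ?thesis
    unfolding fV_def[abs_def]
    using p by (intro B.adm_mult adm_norm_powr B.adm_compose[OF continuous_on_abs_powr]) auto
qed

section \<open>The bulk pairing, the potential term and their derivatives\<close>

definition Wq where "Wq l k = (\<integral>X. indicator (upper_half \<inter> ball 0 1) X *
    (snd X powr b * ((l powr (\<alpha> + 2) * w (l *\<^sub>R X)) * (k powr (\<alpha> + 2) * w (k *\<^sub>R X)))) \<partial>lborel)"

lemma Wq_commute: "Wq l k = Wq k l"
  by (simp add: Wq_def mult_ac)

lemma alpha_p: "\<alpha> * (p - 1) = 2 * s + a"
  using p by (simp add: \<alpha>_def)

text \<open>Green's identity is multiplied by l^(\<alpha>+2) k^\<alpha>. The powers in the boundary
  term fit since (\<alpha> + 2) + (1 - b) + a = \<alpha> + \<alpha> (p - 1), by b = 3 - 2 s. The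
  combinations \<open>k * U1 k - \<alpha> * U k\<close> and
  \<open>l * W1 l - (\<alpha> + 2) * W l\<close> recover the radial derivatives before
  rescaling.\<close>

lemma green_scaled:
  assumes l: "0 < l" and k: "0 < k"
  shows "Wq l k = Cns * (\<integral>x. fV l x * V k x \<partial>unit_ball_measure) +
    (\<integral>\<theta>. W l \<theta> * (k * U1 k \<theta> - \<alpha> * U k \<theta>) - U k \<theta> * (l * W1 l \<theta> - (\<alpha> + 2) * W l \<theta>) \<partial>M)"
proof -
  let ?c = "l powr (\<alpha> + 2) * k powr \<alpha>"
  have k2: "k powr (\<alpha> + 2) = k powr \<alpha> * k\<^sup>2" using k powr_realpow[of k 2] by (simp add: powr_add)
  have "?c * (\<integral>X. indicator (upper_half \<inter> ball 0 1) X * (snd X powr b * (w (l *\<^sub>R X) * (k\<^sup>2 * w (k *\<^sub>R X)))) \<partial>lborel) = Wq l k"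
    unfolding Wq_def integral_mult_right_zero[symmetric] k2
    by (rule Bochner_Integration.integral_cong) (simp_all add: mult_ac)
  moreover have "?c * (\<integral>x. indicator (ball 0 1) x * (u (k *\<^sub>R x, 0) * (l powr (1 - b) *
        (Cns * norm (l *\<^sub>R x) powr a * \<bar>u (l *\<^sub>R x, 0)\<bar> powr (p - 1) * u (l *\<^sub>R x, 0)))) \<partial>lborel)
      = Cns * (\<integral>x. fV l x * V k x \<partial>unit_ball_measure)"
    unfolding integral_unit_ball_measure integral_mult_right_zero[symmetric]
  proof (rule Bochner_Integration.integral_cong[OF refl])
    fix x :: "real^'n"
    have "(l powr \<alpha>) powr (p - 1) = l powr (2 * s + a)"
      by (simp add: powr_powr alpha_p)
    then have "\<bar>V l x\<bar> powr (p - 1) = l powr (2 * s + a) * \<bar>v0 l x\<bar> powr (p - 1)"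
      using l by (simp add: V_def abs_mult powr_mult)
    moreover have "norm (l *\<^sub>R x) powr a = l powr a * norm x powr a"
      using l by (simp add: powr_mult)
    moreover have "l powr (\<alpha> + 2) * l powr (1 - b) * l powr a = l powr (2 * s + a) * l powr \<alpha>"
      by (simp add: powr_add[symmetric] b_eq algebra_simps)
    ultimately have "l powr (\<alpha> + 2) * (l powr (1 - b) * (norm (l *\<^sub>R x) powr a * \<bar>v0 l x\<bar> powr (p - 1) * v0 l x)) = fV l x"
      by (simp add: fV_def V_def)
    then show "?c * (indicator (ball 0 1) x * (u (k *\<^sub>R x, 0) * (l powr (1 - b) *
        (Cns * norm (l *\<^sub>R x) powr a * \<bar>u (l *\<^sub>R x, 0)\<bar> powr (p - 1) * u (l *\<^sub>R x, 0))))) =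
      Cns * (indicator (ball 0 1) x * (fV l x * V k x))"
      by (simp add: V_def v0_def[symmetric] mult_ac)
  qed
  moreover have "?c * (\<integral>\<theta>. w0 l \<theta> * (k * r1 k \<theta>) - r0 k \<theta> * (l * w1 l \<theta>) \<partial>M) =
    (\<integral>\<theta>. W l \<theta> * (k * U1 k \<theta> - \<alpha> * U k \<theta>) - U k \<theta> * (l * W1 l \<theta> - (\<alpha> + 2) * W l \<theta>) \<partial>M)"
    unfolding integral_mult_right_zero[symmetric]
  proof (rule Bochner_Integration.integral_cong[OF refl])
    fix \<theta> :: "(real^'n) \<times> real"
    have "k * k powr (\<alpha> - 1) = k powr \<alpha>" using k by (simp add: powr_diff)
    then have 1: "k * U1 k \<theta> = k powr \<alpha> * (\<alpha> * r0 k \<theta> + k * r1 k \<theta>)"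
      by (simp add: U1_def mult.assoc[symmetric])
    have "l * l powr (\<alpha> + 2 - 1) = l powr (\<alpha> + 2)"
      using l powr_mult_base[of l "\<alpha> + 2 - 1"] by (simp add: add.commute)
    then have 2: "l * W1 l \<theta> = l powr (\<alpha> + 2) * ((\<alpha> + 2) * w0 l \<theta> + l * w1 l \<theta>)"
      unfolding W1_def by (simp only: mult.assoc[symmetric])
    show "?c * (w0 l \<theta> * (k * r1 k \<theta>) - r0 k \<theta> * (l * w1 l \<theta>)) =
      W l \<theta> * (k * U1 k \<theta> - \<alpha> * U k \<theta>) - U k \<theta> * (l * W1 l \<theta> - (\<alpha> + 2) * W l \<theta>)"
      unfolding 1 2 by (simp add: W_def U_def algebra_simps)
  qed
  ultimately show ?thesis
    using arg_cong[OF green_identity[OF l k], of "\<lambda>z. ?c * z"] by (simp add: right_diff_distrib)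
qed

text \<open>By symmetry \<open>Wq (k, k) - Wq (t, t) = (Wq (k, k) - Wq (k, t)) + (Wq (t, k) - Wq (t, t))\<close>, and Green's
  identity turns both differences into boundary integrals of difference quotients in one variable.\<close>

lemma has_real_derivative_Wq:
  assumes t: "0 < t" and V1: "B.adm_deriv V V1"
  shows "((\<lambda>l. Wq l l) has_real_derivative 2 * (Cns * (\<integral>x. fV t x * V1 t x \<partial>unit_ball_measure)
    + (\<integral>\<theta>. W t \<theta> * (1 * U1 t \<theta> + t * U2 t \<theta> - \<alpha> * U1 t \<theta>) \<partial>M)
    - (\<integral>\<theta>. (t * W1 t \<theta> - (\<alpha> + 2) * W t \<theta>) * U1 t \<theta> \<partial>M))) (at t)"
proof -
  define c where "c = (\<lambda>k \<theta>. k * U1 k \<theta> - \<alpha> * U k \<theta>)"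
  define c' where "c' = (\<lambda>k \<theta>. 1 * U1 k \<theta> + k * U2 k \<theta> - \<alpha> * U1 k \<theta>)"
  define y where "y = (\<lambda>l \<theta>. l * W1 l \<theta> - (\<alpha> + 2) * W l \<theta>)"
  note adms = H.adm_derivD(1)[OF adm_deriv_U] H.adm_derivD(1)[OF adm_deriv_W] H.adm_derivD(2)[OF adm_deriv_W]
  have dc: "H.adm_deriv c c'"
    unfolding c_def c'_def
    by (intro H.adm_deriv_diff H.adm_deriv_mult H.adm_deriv_cmult H.adm_deriv_id adm_deriv_U adm_deriv_U1)
  have ay: "H.adm y"
    unfolding y_def by (intro H.adm_diff H.adm_mult H.adm_const H.adm_id adms)
  note aV = B.adm_derivD(1)[OF V1] and ac = H.adm_derivD(1)[OF dc]
  have G: "Wq l k = Cns * (\<integral>x. fV l x * V k x \<partial>unit_ball_measure) + (\<integral>\<theta>. W l \<theta> * c k \<theta> - y l \<theta> * U k \<theta> \<partial>M)"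
    if "0 < l" "0 < k" for l k
    using green_scaled[OF that] by (simp add: c_def y_def mult.commute)
  \<comment> \<open>The difference quotient of \<open>Wq l\<close> in its second argument, with base
    point \<open>t\<close>. The factors \<open>W\<close>, \<open>y\<close> and \<open>fV\<close> at
    \<open>l\<close> are only evaluated, never differentiated.\<close>
  define Q where "Q = (\<lambda>l k. Cns * (\<integral>x. fV l x * ((V k x - V t x) / (k - t)) \<partial>unit_ball_measure)
    + (\<integral>\<theta>. W l \<theta> * ((c k \<theta> - c t \<theta>) / (k - t)) \<partial>M) - (\<integral>\<theta>. y l \<theta> * ((U k \<theta> - U t \<theta>) / (k - t)) \<partial>M))"
  have quot: "(Wq l k - Wq l t) / (k - t) = Q l k" if l: "0 < l" and k: "0 < k" for l k
  proof -
    have iB: "integrable unit_ball_measure (\<lambda>x. fV l x * V k x)" if "0 < k" for k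
      using B.adm_integrable[OF B.adm_mult[OF B.adm_freeze[OF adm_fV l] B.adm_freeze[OF aV that]], of 1] by simp
    have iW: "integrable M (\<lambda>\<theta>. W l \<theta> * c k \<theta>)" if "0 < k" for k
      using H.adm_integrable[OF H.adm_mult[OF H.adm_freeze[OF adms(2) l] H.adm_freeze[OF ac that]], of 1] by simp
    have iy: "integrable M (\<lambda>\<theta>. y l \<theta> * U k \<theta>)" if "0 < k" for k
      using H.adm_integrable[OF H.adm_mult[OF H.adm_freeze[OF ay l] H.adm_freeze[OF adms(1) that]], of 1] by simp
    have "Wq l k - Wq l t = Cns * ((\<integral>x. fV l x * V k x \<partial>unit_ball_measure) - (\<integral>x. fV l x * V t x \<partial>unit_ball_measure))
      + ((\<integral>\<theta>. W l \<theta> * c k \<theta> \<partial>M) - (\<integral>\<theta>. W l \<theta> * c t \<theta> \<partial>M))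
      - ((\<integral>\<theta>. y l \<theta> * U k \<theta> \<partial>M) - (\<integral>\<theta>. y l \<theta> * U t \<theta> \<partial>M))"
      unfolding G[OF l k] G[OF l t] using iW iy k t by (simp add: algebra_simps)
    also have "\<dots> = Cns * (\<integral>x. fV l x * (V k x - V t x) \<partial>unit_ball_measure)
      + (\<integral>\<theta>. W l \<theta> * (c k \<theta> - c t \<theta>) \<partial>M) - (\<integral>\<theta>. y l \<theta> * (U k \<theta> - U t \<theta>) \<partial>M)"
      using iB iW iy k t by (simp add: right_diff_distrib)
    also have "\<dots> / (k - t) = Q l k"
      unfolding Q_def times_divide_eq_right integral_divide_zero
      by (simp only: diff_divide_distrib add_divide_distrib)
    finally show ?thesis .
  qed
  define D where "D = Cns * (\<integral>x. fV t x * V1 t x \<partial>unit_ball_measure) + (\<integral>\<theta>. W t \<theta> * c' t \<theta> \<partial>M) - (\<integral>\<theta>. y t \<theta> * U1 t \<theta> \<partial>M)"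
  have lim1: "((\<lambda>l. Q l l) \<longlongrightarrow> D) (at t)"
    unfolding Q_def D_def
    by (intro tendsto_add tendsto_diff tendsto_mult tendsto_const B.integral_diff_quotient H.integral_diff_quotient
        adm_fV V1 dc ay adms adm_deriv_U t)
  have lim2: "((\<lambda>l. Q t l) \<longlongrightarrow> D) (at t)"
    unfolding Q_def D_def
    using B.integral_diff_quotient[OF B.adm_freeze[OF adm_fV t] V1 t] H.integral_diff_quotient[OF H.adm_freeze[OF adms(2) t] dc t]
      H.integral_diff_quotient[OF H.adm_freeze[OF ay t] adm_deriv_U t]
    by (intro tendsto_add tendsto_diff tendsto_mult tendsto_const)
  have "((\<lambda>l. Q l l + Q t l) \<longlongrightarrow> D + D) (at t)"
    by (rule tendsto_add[OF lim1 lim2])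
  moreover have "\<forall>\<^sub>F l in at t. Q l l + Q t l = (Wq l l - Wq t t) / (l - t)"
    using eventually_at_in_open'[of "{0<..}" t]
  proof (rule eventually_mono)
    fix l :: real assume "l \<in> {0<..}"
    then have l: "0 < l" by simp
    show "Q l l + Q t l = (Wq l l - Wq t t) / (l - t)"
      unfolding quot[OF l l, symmetric] quot[OF t l, symmetric] Wq_commute[of t l]
      by (simp add: diff_divide_distrib)
  qed (use t in auto)
  ultimately have "((\<lambda>l. Wq l l) has_real_derivative D + D) (at t)"
    unfolding has_field_derivative_iff by (auto elim: Lim_transform_eventually)
  moreover have "D + D = 2 * (Cns * (\<integral>x. fV t x * V1 t x \<partial>unit_ball_measure)
    + (\<integral>\<theta>. W t \<theta> * (1 * U1 t \<theta> + t * U2 t \<theta> - \<alpha> * U1 t \<theta>) \<partial>M)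
    - (\<integral>\<theta>. (t * W1 t \<theta> - (\<alpha> + 2) * W t \<theta>) * U1 t \<theta> \<partial>M))"
    by (simp add: D_def c'_def y_def)
  ultimately show ?thesis by simp
qed

definition Z where "Z t = (\<integral>x. norm x powr a * \<bar>V t x\<bar> powr (p + 1) \<partial>(unit_ball_measure :: (real^'n) measure))"

text \<open>The factor p + 1 cancels the denominator in the energy; the integral left over is the
  one that \<open>has_real_derivative_Wq\<close> contains.\<close>

lemma has_real_derivative_Z:
  assumes t: "0 < t" and V1: "B.adm_deriv V V1"
  shows "(Z has_real_derivative (p + 1) * (\<integral>x. fV t x * V1 t x \<partial>unit_ball_measure)) (at t)"
proof -
  note aV = B.adm_derivD[OF V1]
  have "B.adm_deriv (\<lambda>t x. norm x powr a * \<bar>V t x\<bar> powr (p + 1)) (\<lambda>t x. (p + 1) * (fV t x * V1 t x))"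
    unfolding B.adm_deriv_def
  proof (intro conjI allI impI ballI)
    show "B.adm (\<lambda>t x. norm x powr a * \<bar>V t x\<bar> powr (p + 1))"
      using p by (intro B.adm_mult adm_norm_powr B.adm_compose[OF continuous_on_abs_powr] aV) auto
    show "B.adm (\<lambda>t x. (p + 1) * (fV t x * V1 t x))"
      by (intro B.adm_mult B.adm_const adm_fV aV)
    fix t x assume tx: "(0::real) < t" "x \<in> space (unit_ball_measure :: (real^'n) measure)"
    have "((\<lambda>v. \<bar>v\<bar> powr (p + 1)) has_real_derivative (p + 1) * (\<bar>V t x\<bar> powr (p + 1 - 2) * V t x)) (at (V t x))"
      using p by (intro DERIV_abs_powr) simp
    from DERIV_cmult[OF DERIV_chain2[OF this aV(3)[OF tx]], of "norm x powr a"]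
    show "((\<lambda>t. norm x powr a * \<bar>V t x\<bar> powr (p + 1)) has_real_derivative (p + 1) * (fV t x * V1 t x)) (at t)"
      by (simp add: fV_def mult_ac)
  qed
  from B.has_real_derivative_integral[OF this t] show ?thesis
    by (simp add: Z_def[abs_def])
qed

section \<open>The terms of the energy on the unit half-ball and half-sphere\<close>

lemma measurable_upper_half_continuous:
  assumes "continuous_on upper_half f"
  shows "(\<lambda>X :: (real^'n) \<times> real. indicator upper_half X * f X :: real) \<in> borel_measurable borel"
  using borel_measurable_continuous_on_indicator[OF upper_half_borel assms] by simp

lemma continuous_on_grad_u: "continuous_on upper_half (grad u)"
proof -
  have "C_k (Suc 0) upper_half u" by (rule C_k_u) simp
  from C_k_continuous_on[OF C_k_partial[OF this]] show ?thesis
    unfolding grad_def[abs_def] by (intro continuous_intros)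
qed

lemma continuous_on_radial_deriv_u: "continuous_on upper_half (radial_deriv u)"
  unfolding radial_deriv_def[abs_def]
  by (intro continuous_intros continuous_on_grad_u) (use upper_half_not_0 in auto)

text \<open>A dictionary from the exponents and the coefficient in the energy to \<alpha>, m and
  \<open>cB\<close>. In particular the factor in front of the mass terms is
  \<open>cB / 2\<close>.\<close>

lemma powr_exponents:
  "(2 * s * (p + 1) + 2 * a) / (p - 1) - real CARD('n) = 2 * \<alpha> + 3 - m"
  "(4 * s + 2 * a) / (p - 1) + 2 * s - 2 - real CARD('n) = 2 * \<alpha> + 1 - m"
  "(4 * s + 2 * a) / (p - 1) + 2 * s - 3 - real CARD('n) = 2 * \<alpha> - m"
  "- 3 + 2 * s + (4 * s + 2 * a) / (p - 1) - real CARD('n) = 2 * \<alpha> - m"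
  "(s + a / 2) / (p - 1) * ((p + 2 * s + a - 1) / (p - 1) - real CARD('n) - b) = cB / 2"
proof -
  have p1: "p - 1 \<noteq> 0" using p by simp
  have 1: "(4 * s + 2 * a) / (p - 1) = 2 * \<alpha>" by (simp add: \<alpha>_def)
  have e: "2 * s * (p + 1) + 2 * a = (4 * s + 2 * a) + 2 * s * (p - 1)" by (simp add: algebra_simps)
  have 2: "(2 * s * (p + 1) + 2 * a) / (p - 1) = 2 * \<alpha> + 2 * s"
    unfolding e add_divide_distrib[of "4 * s + 2 * a"] 1 using p1 by simp
  have 3: "(s + a / 2) / (p - 1) = \<alpha> / 2" using p1 by (simp add: \<alpha>_def field_simps)
  have "p + 2 * s + a - 1 = (p - 1) + (2 * s + a)" by simp
  then have 4: "(p + 2 * s + a - 1) / (p - 1) = 1 + \<alpha>"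
    using p1 by (simp only: add_divide_distrib \<alpha>_def) simp
  show "(2 * s * (p + 1) + 2 * a) / (p - 1) - real CARD('n) = 2 * \<alpha> + 3 - m"
    unfolding 2 m_def using b_eq by simp
  show "(4 * s + 2 * a) / (p - 1) + 2 * s - 2 - real CARD('n) = 2 * \<alpha> + 1 - m"
    "(4 * s + 2 * a) / (p - 1) + 2 * s - 3 - real CARD('n) = 2 * \<alpha> - m"
    "- 3 + 2 * s + (4 * s + 2 * a) / (p - 1) - real CARD('n) = 2 * \<alpha> - m"
    unfolding 1 m_def using b_eq by simp_all
  show "(s + a / 2) / (p - 1) * ((p + 2 * s + a - 1) / (p - 1) - real CARD('n) - b) = cB / 2"
    unfolding 3 4 m_def cB_def by (simp add: field_simps)
qed

lemma mass_eq:
  assumes t: "0 < t"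
  shows "t powr (2 * \<alpha> - m) * half_sphere_integral (\<lambda>X. snd X powr b * (u X)\<^sup>2) t = (\<integral>\<theta>. (U t \<theta>)\<^sup>2 \<partial>M)"
proof -
  have "half_sphere_integral (\<lambda>X. snd X powr b * (u X)\<^sup>2) t = t powr m * (\<integral>\<theta>. (u (t *\<^sub>R \<theta>))\<^sup>2 \<partial>M)"
    unfolding m_def
    by (intro half_sphere_integral_eq measurable_upper_half_continuous t continuous_intros C_k_continuous_on[OF C_k_u[of 0]]) simp
  moreover have "t powr (2 * \<alpha> - m) * t powr m = t powr (2 * \<alpha>)"
    by (simp add: powr_add[symmetric])
  ultimately have "t powr (2 * \<alpha> - m) * half_sphere_integral (\<lambda>X. snd X powr b * (u X)\<^sup>2) t =
    (\<integral>\<theta>. t powr (2 * \<alpha>) * (u (t *\<^sub>R \<theta>))\<^sup>2 \<partial>M)"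
    by (simp add: mult.assoc[symmetric])
  also have "\<dots> = (\<integral>\<theta>. (U t \<theta>)\<^sup>2 \<partial>M)"
    using t by (intro Bochner_Integration.integral_cong)
      (simp_all add: U_def r0_def power_mult_distrib power2_eq_square powr_add[symmetric])
  finally show ?thesis .
qed

text \<open>At radius t the expression inside the square is t^(-\<alpha>) times the t-derivative of
  t^\<alpha> u(t theta). The integral in the claimed lower bound is therefore, up to a power of t,
  the integral of the square of \<open>U1\<close>.\<close>

lemma scaling_eq:
  assumes t: "0 < t"
  shows "t powr (2 * \<alpha> - m) * half_sphere_integral (\<lambda>X. snd X powr b *
    ((2 * s + a) / (p - 1) * inverse (norm X) * u X + radial_deriv u X)\<^sup>2) t = (\<integral>\<theta>. (U1 t \<theta>)\<^sup>2 \<partial>M)"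
proof -
  let ?f = "\<lambda>X. (\<alpha> * inverse (norm X) * u X + radial_deriv u X)\<^sup>2"
  have "half_sphere_integral (\<lambda>X. snd X powr b * ?f X) t = t powr m * (\<integral>\<theta>. ?f (t *\<^sub>R \<theta>) \<partial>M)"
    unfolding m_def
    by (intro half_sphere_integral_eq measurable_upper_half_continuous t continuous_intros
        C_k_continuous_on[OF C_k_u[of 0]] continuous_on_radial_deriv_u) (use upper_half_not_0 in auto)
  moreover have "t powr (2 * \<alpha> - m) * t powr m = t powr (2 * \<alpha>)"
    by (simp add: powr_add[symmetric])
  ultimately have "t powr (2 * \<alpha> - m) * half_sphere_integral (\<lambda>X. snd X powr b * ?f X) t =
    (\<integral>\<theta>. t powr (2 * \<alpha>) * ?f (t *\<^sub>R \<theta>) \<partial>M)"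
    by (simp add: mult.assoc[symmetric])
  also have "\<dots> = (\<integral>\<theta>. (U1 t \<theta>)\<^sup>2 \<partial>M)"
  proof (rule Bochner_Integration.integral_cong[OF refl])
    fix \<theta> assume "\<theta> \<in> space M"
    then have th: "\<theta> \<in> half_sphere" by simp
    have h: "t powr \<alpha> = t powr (\<alpha> - 1) * t" using t by (simp add: powr_diff)
    have "t * (\<alpha> * inverse t * r0 t \<theta> + r1 t \<theta>) = \<alpha> * r0 t \<theta> + t * r1 t \<theta>"
      using t by (simp add: distrib_left)
    then have "U1 t \<theta> = t powr \<alpha> * (\<alpha> * inverse t * r0 t \<theta> + r1 t \<theta>)"
      unfolding U1_def h by (simp only: mult.assoc)
    moreover have "norm (t *\<^sub>R \<theta>) = t" using th t by (simp add: half_sphere_def)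
    ultimately show "t powr (2 * \<alpha>) * ?f (t *\<^sub>R \<theta>) = (U1 t \<theta>)\<^sup>2"
      using r1_eq[OF t th] by (simp only: r0_def) (simp add: power_mult_distrib power2_eq_square[of "t powr \<alpha>"] powr_add[symmetric])
  qed
  finally show ?thesis by (simp add: \<alpha>_def)
qed

text \<open>The gradient of the rescaled solution carries t^(\<alpha>+1), which accounts for the two
  powers of t more than in \<open>mass_eq\<close>.\<close>

lemma tangential_eq:
  assumes t: "0 < t"
  shows "t powr (2 * \<alpha> + 2 - m) * half_sphere_integral (\<lambda>X. snd X powr b *
    ((norm (grad u X))\<^sup>2 - \<bar>radial_deriv u X\<bar>\<^sup>2)) t = (\<integral>\<theta>. tau g0 g0 t t \<theta> \<partial>M)"
proof -
  let ?f = "\<lambda>X. (norm (grad u X))\<^sup>2 - \<bar>radial_deriv u X\<bar>\<^sup>2"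
  have "half_sphere_integral (\<lambda>X. snd X powr b * ?f X) t = t powr m * (\<integral>\<theta>. ?f (t *\<^sub>R \<theta>) \<partial>M)"
    unfolding m_def
    by (intro half_sphere_integral_eq measurable_upper_half_continuous t continuous_intros
        continuous_on_grad_u continuous_on_radial_deriv_u)
  moreover have "t powr (2 * \<alpha> + 2 - m) * t powr m = t powr (2 * (\<alpha> + 1))"
    by (simp add: powr_add[symmetric])
  ultimately have "t powr (2 * \<alpha> + 2 - m) * half_sphere_integral (\<lambda>X. snd X powr b * ?f X) t =
    (\<integral>\<theta>. t powr (2 * (\<alpha> + 1)) * ?f (t *\<^sub>R \<theta>) \<partial>M)"
    by (simp add: mult.assoc[symmetric])
  also have "\<dots> = (\<integral>\<theta>. tau g0 g0 t t \<theta> \<partial>M)"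
  proof (rule Bochner_Integration.integral_cong[OF refl])
    fix \<theta> assume "\<theta> \<in> space M"
    then have th: "\<theta> \<in> half_sphere" by simp
    have p2: "t powr (2 * (\<alpha> + 1)) = t powr (\<alpha> + 1) * t powr (\<alpha> + 1)"
      by (simp add: powr_add[symmetric])
    have n: "(norm (grad u (t *\<^sub>R \<theta>)))\<^sup>2 = (\<Sum>e\<in>Basis. p0 e t \<theta> * p0 e t \<theta>)"
      unfolding power2_norm_eq_inner by (subst euclidean_inner) (simp add: grad_Basis p0_def)
    have "(\<Sum>e\<in>Basis. g0 e t \<theta> * g0 e t \<theta>) = (t powr (\<alpha> + 1) * t powr (\<alpha> + 1)) * (\<Sum>e\<in>Basis. p0 e t \<theta> * p0 e t \<theta>)"
      unfolding sum_distrib_left by (simp add: g0_def mult_ac)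
    moreover have "(\<Sum>e\<in>Basis. (\<theta> \<bullet> e) * g0 e t \<theta>) = t powr (\<alpha> + 1) * r1 t \<theta>"
      unfolding r1_def sum_distrib_left by (simp add: g0_def mult_ac)
    ultimately show "t powr (2 * (\<alpha> + 1)) * ?f (t *\<^sub>R \<theta>) = tau g0 g0 t t \<theta>"
      unfolding tau_def n r1_eq[OF t th, symmetric] p2 by (simp add: power2_eq_square right_diff_distrib mult_ac)
  qed
  finally show ?thesis .
qed

text \<open>Volume and weight contribute n + 1 + b = m + 1 powers of t, and (2 \<alpha> + 3 - m) +
  (m + 1) = 2 (\<alpha> + 2) is what two factors \<open>Delta_b\<close> of the rescaled solution
  require.\<close>

lemma half_ball_eq:
  assumes t: "0 < t"
  shows "t powr (2 * \<alpha> + 3 - m) * half_ball_integral (\<lambda>X. 1 / 2 * snd X powr b * \<bar>w X\<bar>\<^sup>2) t = Wq t t / 2"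
proof -
  have "continuous_on upper_half w" by (rule C_k_continuous_on[OF C_k_w[of 0]]) simp
  then have "(\<lambda>X. indicator upper_half X * (w X)\<^sup>2) \<in> borel_measurable borel"
    by (intro measurable_upper_half_continuous continuous_intros)
  then have "(\<lambda>X. indicator (ball 0 t) X * (1 / 2 * (snd X powr b * (indicator upper_half X * (w X)\<^sup>2)))) \<in> borel_measurable borel"
    by measurable
  moreover have "indicator (ball 0 t) X * (1 / 2 * (snd X powr b * (indicator upper_half X * (w X)\<^sup>2))) =
    indicator (upper_half \<inter> ball 0 t) X *\<^sub>R (1 / 2 * snd X powr b * \<bar>w X\<bar>\<^sup>2)" for X
    by (cases "X \<in> upper_half"; cases "norm X < t") simp_all
  ultimately have meas: "(\<lambda>X. indicator (upper_half \<inter> ball 0 t) X *\<^sub>R (1 / 2 * snd X powr b * \<bar>w X\<bar>\<^sup>2)) \<in> borel_measurable borel"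
    by (simp only:)
  have ex: "t powr (2 * \<alpha> + 3 - m) * t ^ (CARD('n) + 1) * t powr b = t powr (\<alpha> + 2) * t powr (\<alpha> + 2)"
  proof -
    have "t powr (2 * \<alpha> + 3 - m) * t powr real (CARD('n) + 1) * t powr b = t powr (\<alpha> + 2) * t powr (\<alpha> + 2)"
      unfolding powr_add[symmetric] by (rule arg_cong[where f = "\<lambda>z. t powr z"]) (simp add: m_def)
    then show ?thesis using powr_realpow[OF t, of "CARD('n) + 1"] by simp
  qed
  have "half_ball_integral (\<lambda>X. 1 / 2 * snd X powr b * \<bar>w X\<bar>\<^sup>2) t =
    t ^ (CARD('n) + 1) * (\<integral>X. indicator (upper_half \<inter> ball 0 t) (t *\<^sub>R X) *\<^sub>R (1 / 2 * snd (t *\<^sub>R X) powr b * \<bar>w (t *\<^sub>R X)\<bar>\<^sup>2) \<partial>lborel)"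
    unfolding half_ball_integral_def set_lebesgue_integral_def
    using integral_lborel_scaleR[OF meas t] by simp
  also have "(\<integral>X. indicator (upper_half \<inter> ball 0 t) (t *\<^sub>R X) *\<^sub>R (1 / 2 * snd (t *\<^sub>R X) powr b * \<bar>w (t *\<^sub>R X)\<bar>\<^sup>2) \<partial>lborel) =
    (\<integral>X. t powr b * (1 / 2 * (indicator (upper_half \<inter> ball 0 1) X * (snd X powr b * (w (t *\<^sub>R X))\<^sup>2))) \<partial>lborel)"
  proof (rule Bochner_Integration.integral_cong[OF refl])
    fix X :: "(real^'n) \<times> real"
    have i: "t *\<^sub>R X \<in> upper_half \<inter> ball 0 t \<longleftrightarrow> X \<in> upper_half \<inter> ball 0 1"
      using t upper_half_scaleR[OF t, of X] by simp
    show "indicator (upper_half \<inter> ball 0 t) (t *\<^sub>R X) *\<^sub>R (1 / 2 * snd (t *\<^sub>R X) powr b * \<bar>w (t *\<^sub>R X)\<bar>\<^sup>2) =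
      t powr b * (1 / 2 * (indicator (upper_half \<inter> ball 0 1) X * (snd X powr b * (w (t *\<^sub>R X))\<^sup>2)))"
    proof (cases "X \<in> upper_half \<inter> ball 0 1")
      case True
      then have "t *\<^sub>R X \<in> upper_half \<inter> ball 0 t" using i by blast
      then show ?thesis using True t by (simp add: powr_mult upper_half_def)
    next
      case False
      then have "t *\<^sub>R X \<notin> upper_half \<inter> ball 0 t" using i by blast
      then have "indicator (upper_half \<inter> ball 0 t) (t *\<^sub>R X) = (0::real)" by (rule indicator_simps(2))
      moreover have "indicator (upper_half \<inter> ball 0 1) X = (0::real)" using False by (rule indicator_simps(2))
      ultimately show ?thesis by (simp only:) simp
    qed
  qed
  also have "\<dots> = t powr b * (1 / 2 * (\<integral>X. indicator (upper_half \<inter> ball 0 1) X * (snd X powr b * (w (t *\<^sub>R X))\<^sup>2) \<partial>lborel))"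
    by (simp only: integral_mult_right_zero)
  finally have "t powr (2 * \<alpha> + 3 - m) * half_ball_integral (\<lambda>X. 1 / 2 * snd X powr b * \<bar>w X\<bar>\<^sup>2) t =
    (t powr (2 * \<alpha> + 3 - m) * t ^ (CARD('n) + 1) * t powr b) * (\<integral>X. indicator (upper_half \<inter> ball 0 1) X * (snd X powr b * (w (t *\<^sub>R X))\<^sup>2) \<partial>lborel) / 2"
    by simp
  also have "\<dots> = Wq t t / 2"
    unfolding ex Wq_def integral_mult_right_zero[symmetric]
    by (rule arg_cong[where f = "\<lambda>z. z / 2"], rule Bochner_Integration.integral_cong) (simp_all add: power2_eq_square mult_ac)
  finally show ?thesis .
qed

lemma potential_eq:
  assumes t: "0 < t"
  shows "t powr (2 * \<alpha> + 3 - m) * (LINT x:ball (0 :: real^'n) t|lborel. norm x powr a * \<bar>u (x, 0)\<bar> powr (p + 1)) = Z t"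
proof -
  have uc: "continuous_on closed_upper_half u"
    using regular unfolding regular_up_to_boundary_def by blast
  have "continuous_on UNIV (\<lambda>x :: real^'n. u (x, 0))"
    by (rule continuous_on_compose2[OF uc]) (auto intro!: continuous_intros simp: closed_upper_half_def)
  then have um: "(\<lambda>x :: real^'n. u (x, 0)) \<in> borel_measurable borel" by (rule borel_measurable_continuous_onI)
  have meas: "(\<lambda>x :: real^'n. indicator (ball 0 t) x *\<^sub>R (norm x powr a * \<bar>u (x, 0)\<bar> powr (p + 1))) \<in> borel_measurable borel"
    using um by measurable
  have ap: "\<alpha> * (p + 1) = 2 * s + a + 2 * \<alpha>"
    using alpha_p by (simp add: algebra_simps)
  have ex: "t powr (2 * \<alpha> + 3 - m) * t ^ CARD('n) * t powr a = t powr (\<alpha> * (p + 1))"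
  proof -
    have "t powr (2 * \<alpha> + 3 - m) * t powr real CARD('n) * t powr a = t powr (\<alpha> * (p + 1))"
      unfolding powr_add[symmetric] ap by (rule arg_cong[where f = "\<lambda>z. t powr z"]) (unfold m_def, use b_eq in simp)
    then show ?thesis using powr_realpow[OF t, of "CARD('n)"] by simp
  qed
  have "(LINT x:ball (0 :: real^'n) t|lborel. norm x powr a * \<bar>u (x, 0)\<bar> powr (p + 1)) =
    t ^ CARD('n) * (\<integral>x. indicator (ball 0 t) (t *\<^sub>R x) *\<^sub>R (norm (t *\<^sub>R x) powr a * \<bar>u (t *\<^sub>R x, 0)\<bar> powr (p + 1)) \<partial>lborel)"
    unfolding set_lebesgue_integral_def using integral_lborel_scaleR[OF meas t] by simp
  also have "(\<integral>x. indicator (ball 0 t) (t *\<^sub>R x) *\<^sub>R (norm (t *\<^sub>R x) powr a * \<bar>u (t *\<^sub>R x, 0)\<bar> powr (p + 1)) \<partial>lborel) =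
    (\<integral>x. t powr a * (indicator (ball 0 1) x * (norm x powr a * \<bar>v0 t x\<bar> powr (p + 1))) \<partial>lborel)"
    using t by (intro Bochner_Integration.integral_cong) (simp_all add: v0_def powr_mult indicator_def)
  also have "\<dots> = t powr a * (\<integral>x. indicator (ball 0 1) x * (norm x powr a * \<bar>v0 t x\<bar> powr (p + 1)) \<partial>lborel)"
    by (rule integral_mult_right_zero)
  finally have "t powr (2 * \<alpha> + 3 - m) * (LINT x:ball (0 :: real^'n) t|lborel. norm x powr a * \<bar>u (x, 0)\<bar> powr (p + 1)) =
    (t powr (2 * \<alpha> + 3 - m) * t ^ CARD('n) * t powr a) * (\<integral>x. indicator (ball 0 1) x * (norm x powr a * \<bar>v0 t x\<bar> powr (p + 1)) \<partial>lborel)"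
    by simp
  also have "\<dots> = Z t"
    unfolding ex Z_def integral_unit_ball_measure integral_mult_right_zero[symmetric]
    using t by (intro Bochner_Integration.integral_cong) (simp_all add: V_def abs_mult powr_mult powr_powr mult_ac)
  finally show ?thesis .
qed

section \<open>Monotonicity of the energy\<close>

text \<open>The boundary part of the energy after the radial derivatives in its definition are
  carried out. The two terms with coefficient \<open>cB / 2\<close> merge, and so do the two
  tangential ones; hence no factor 1/2 remains.\<close>

definition boundary_terms where "boundary_terms t \<theta> = t ^ 3 * (U1 t \<theta> * U2 t \<theta>) - cB * (U t \<theta> * U t \<theta>) - cB * (t * (U t \<theta> * U1 t \<theta>))
  + (tau g0 g0 t t \<theta> + t * tau g1 g0 t t \<theta>)"

lemma tau_diag_commute: "tau f g t t \<theta> = tau g f t t \<theta>"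
  by (rule tau_commute)

lemma adm_deriv_tau_00: "H.adm_deriv (\<lambda>t. tau g0 g0 t t) (\<lambda>t \<theta>. 2 * tau g1 g0 t t \<theta>)"
  by (rule H.adm_deriv_eqI[OF adm_deriv_tau_diag[OF adm_deriv_g0 adm_deriv_g0]])
    (simp_all add: tau_diag_commute[of g0 g1])

lemma adm_deriv_tau_10: "H.adm_deriv (\<lambda>t. tau g1 g0 t t) (\<lambda>t \<theta>. tau g2 g0 t t \<theta> + tau g1 g1 t t \<theta>)"
  by (rule adm_deriv_tau_diag[OF adm_deriv_g1 adm_deriv_g0])

lemma adm_deriv_cube: "H.adm_deriv (\<lambda>t \<theta>. t ^ 3) (\<lambda>t \<theta>. 3 * t\<^sup>2)"
  by (rule H.adm_deriv_fst) (auto intro!: derivative_eq_intros continuous_intros)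

lemma adm_deriv_boundary_terms: "H.adm_deriv boundary_terms (\<lambda>t \<theta>.
    (3 * t\<^sup>2 * (U1 t \<theta> * U2 t \<theta>) + t ^ 3 * (U2 t \<theta> * U2 t \<theta> + U1 t \<theta> * U3 t \<theta>))
    - cB * (U1 t \<theta> * U t \<theta> + U t \<theta> * U1 t \<theta>)
    - cB * (1 * (U t \<theta> * U1 t \<theta>) + t * (U1 t \<theta> * U1 t \<theta> + U t \<theta> * U2 t \<theta>))
    + (2 * tau g1 g0 t t \<theta> + (1 * tau g1 g0 t t \<theta> + t * (tau g2 g0 t t \<theta> + tau g1 g1 t t \<theta>))))"
  unfolding boundary_terms_def[abs_def]
  by (intro H.adm_deriv_add H.adm_deriv_diff H.adm_deriv_mult H.adm_deriv_cmult H.adm_deriv_id adm_deriv_cube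
      adm_deriv_U adm_deriv_U1 adm_deriv_U2 adm_deriv_tau_00 adm_deriv_tau_10)

lemma energy_eq:
  assumes t: "0 < t"
  shows "energy s a p Cns u t = Wq t t / 2 - Cns / (p + 1) * Z t + (\<integral>\<theta>. boundary_terms t \<theta> \<partial>M)"
proof -
  define mass where "mass = half_sphere_integral (\<lambda>X. snd X powr b * (u X)\<^sup>2)"
  define scal where "scal = half_sphere_integral (\<lambda>X. snd X powr b *
    ((2 * s + a) / (p - 1) * inverse (norm X) * u X + radial_deriv u X)\<^sup>2)"
  define tang where "tang = half_sphere_integral (\<lambda>X. snd X powr b * ((norm (grad u X))\<^sup>2 - \<bar>radial_deriv u X\<bar>\<^sup>2))"
  define hb where "hb = half_ball_integral (\<lambda>X. 1 / 2 * snd X powr b * \<bar>w X\<bar>\<^sup>2) t"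
  define pot where "pot = (LINT x:ball (0 :: real^'n) t|lborel. norm x powr a * \<bar>u (x, 0)\<bar> powr (p + 1))"
  have E: "energy s a p Cns u t = t powr (2 * \<alpha> + 3 - m) * (hb - Cns / (p + 1) * pot)
    - cB / 2 * t powr (2 * \<alpha> - m) * mass t
    - cB / 2 * deriv (\<lambda>t. t powr (2 * \<alpha> + 1 - m) * mass t) t
    + 1 / 2 * t ^ 3 * deriv (\<lambda>t. t powr (2 * \<alpha> - m) * scal t) t
    + 1 / 2 * deriv (\<lambda>t. t powr (2 * \<alpha> + 3 - m) * tang t) t
    + 1 / 2 * t powr (2 * \<alpha> + 3 - m - 1) * tang t"
    unfolding mass_def scal_def tang_def hb_def pot_def
    by (simp only: energy_def Let_def b_eq[symmetric] powr_exponents)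
  have mass: "r powr (2 * \<alpha> - m) * mass r = (\<integral>\<theta>. U r \<theta> * U r \<theta> \<partial>M)" if "0 < r" for r
    using mass_eq[OF that] by (simp add: mass_def power2_eq_square)
  have scal: "r powr (2 * \<alpha> - m) * scal r = (\<integral>\<theta>. U1 r \<theta> * U1 r \<theta> \<partial>M)" if "0 < r" for r
    using scaling_eq[OF that] by (simp add: scal_def power2_eq_square)
  have tang: "r powr (2 * \<alpha> + 2 - m) * tang r = (\<integral>\<theta>. tau g0 g0 r r \<theta> \<partial>M)" if "0 < r" for r
    using tangential_eq[OF that] by (simp add: tang_def)
  have shift: "r powr (z + 1) = r * r powr z" if "0 < r" for r z :: real
    using that by (simp add: powr_add)
  define IUU IU1 I12 T0 T1 where "IUU = (\<integral>\<theta>. U t \<theta> * U t \<theta> \<partial>M)" and "IU1 = (\<integral>\<theta>. U t \<theta> * U1 t \<theta> \<partial>M)"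
    and "I12 = (\<integral>\<theta>. U1 t \<theta> * U2 t \<theta> \<partial>M)" and "T0 = (\<integral>\<theta>. tau g0 g0 t t \<theta> \<partial>M)" and "T1 = (\<integral>\<theta>. tau g1 g0 t t \<theta> \<partial>M)"
  have d1: "deriv (\<lambda>t. t powr (2 * \<alpha> + 1 - m) * mass t) t = IUU + t * (2 * IU1)"
  proof (rule DERIV_imp_deriv)
    have "((\<lambda>r. \<integral>\<theta>. U r \<theta> * U r \<theta> \<partial>M) has_real_derivative (\<integral>\<theta>. U1 t \<theta> * U t \<theta> + U t \<theta> * U1 t \<theta> \<partial>M)) (at t)"
      by (rule H.has_real_derivative_integral[OF H.adm_deriv_mult[OF adm_deriv_U adm_deriv_U] t])
    moreover have "(\<integral>\<theta>. U1 t \<theta> * U t \<theta> + U t \<theta> * U1 t \<theta> \<partial>M) = 2 * IU1"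
      unfolding IU1_def integral_mult_right_zero[symmetric]
      by (rule Bochner_Integration.integral_cong) (simp_all add: mult.commute)
    ultimately have "((\<lambda>r. \<integral>\<theta>. U r \<theta> * U r \<theta> \<partial>M) has_real_derivative 2 * IU1) (at t)" by simp
    from DERIV_mult[OF DERIV_ident this]
    have "((\<lambda>r. r * (\<integral>\<theta>. U r \<theta> * U r \<theta> \<partial>M)) has_real_derivative IUU + t * (2 * IU1)) (at t)"
      by (simp add: IUU_def mult.commute)
    then show "((\<lambda>t. t powr (2 * \<alpha> + 1 - m) * mass t) has_real_derivative IUU + t * (2 * IU1)) (at t)"
    proof (rule has_field_derivative_transform_within_open[of _ _ t "{0<..}"])
      fix r :: real assume "r \<in> {0<..}"
      then have r: "0 < r" by simp
      show "r * (\<integral>\<theta>. U r \<theta> * U r \<theta> \<partial>M) = r powr (2 * \<alpha> + 1 - m) * mass r"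
        using shift[OF r, of "2 * \<alpha> - m"] by (simp add: mass[OF r, symmetric] algebra_simps)
    qed (use t in auto)
  qed
  have d2: "deriv (\<lambda>t. t powr (2 * \<alpha> - m) * scal t) t = 2 * I12"
  proof (rule DERIV_imp_deriv)
    have "((\<lambda>r. \<integral>\<theta>. U1 r \<theta> * U1 r \<theta> \<partial>M) has_real_derivative (\<integral>\<theta>. U2 t \<theta> * U1 t \<theta> + U1 t \<theta> * U2 t \<theta> \<partial>M)) (at t)"
      by (rule H.has_real_derivative_integral[OF H.adm_deriv_mult[OF adm_deriv_U1 adm_deriv_U1] t])
    moreover have "(\<integral>\<theta>. U2 t \<theta> * U1 t \<theta> + U1 t \<theta> * U2 t \<theta> \<partial>M) = 2 * I12"
      unfolding I12_def integral_mult_right_zero[symmetric]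
      by (rule Bochner_Integration.integral_cong) (simp_all add: mult.commute)
    ultimately have "((\<lambda>r. \<integral>\<theta>. U1 r \<theta> * U1 r \<theta> \<partial>M) has_real_derivative 2 * I12) (at t)" by simp
    then show "((\<lambda>t. t powr (2 * \<alpha> - m) * scal t) has_real_derivative 2 * I12) (at t)"
      by (rule has_field_derivative_transform_within_open[of _ _ t "{0<..}"]) (use t scal in auto)
  qed
  have d3: "deriv (\<lambda>t. t powr (2 * \<alpha> + 3 - m) * tang t) t = T0 + t * (2 * T1)"
  proof (rule DERIV_imp_deriv)
    have "((\<lambda>r. \<integral>\<theta>. tau g0 g0 r r \<theta> \<partial>M) has_real_derivative (\<integral>\<theta>. 2 * tau g1 g0 t t \<theta> \<partial>M)) (at t)"
      by (rule H.has_real_derivative_integral[OF adm_deriv_tau_00 t])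
    then have "((\<lambda>r. \<integral>\<theta>. tau g0 g0 r r \<theta> \<partial>M) has_real_derivative 2 * T1) (at t)"
      by (simp add: T1_def)
    from DERIV_mult[OF DERIV_ident this]
    have "((\<lambda>r. r * (\<integral>\<theta>. tau g0 g0 r r \<theta> \<partial>M)) has_real_derivative T0 + t * (2 * T1)) (at t)"
      by (simp add: T0_def mult.commute)
    then show "((\<lambda>t. t powr (2 * \<alpha> + 3 - m) * tang t) has_real_derivative T0 + t * (2 * T1)) (at t)"
    proof (rule has_field_derivative_transform_within_open[of _ _ t "{0<..}"])
      fix r :: real assume "r \<in> {0<..}"
      then have r: "0 < r" by simp
      show "r * (\<integral>\<theta>. tau g0 g0 r r \<theta> \<partial>M) = r powr (2 * \<alpha> + 3 - m) * tang r"
        using shift[OF r, of "2 * \<alpha> + 2 - m"] by (simp add: tang[OF r, symmetric] algebra_simps)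
    qed (use t in auto)
  qed
  have boundary_terms: "(\<integral>\<theta>. boundary_terms t \<theta> \<partial>M) = t ^ 3 * I12 - cB * IUU - cB * (t * IU1) + (T0 + t * T1)"
  proof -
    note adms = H.adm_derivD(1)[OF adm_deriv_U] H.adm_derivD(1)[OF adm_deriv_U1] H.adm_derivD(1)[OF adm_deriv_U2]
      H.adm_derivD(1)[OF adm_deriv_tau_00] H.adm_derivD(1)[OF adm_deriv_tau_10]
    have i: "integrable M (\<lambda>\<theta>. U t \<theta> * U t \<theta>)" "integrable M (\<lambda>\<theta>. U t \<theta> * U1 t \<theta>)" "integrable M (\<lambda>\<theta>. U1 t \<theta> * U2 t \<theta>)"
      "integrable M (\<lambda>\<theta>. tau g0 g0 t t \<theta>)" "integrable M (\<lambda>\<theta>. tau g1 g0 t t \<theta>)"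
      using H.adm_integrable[OF H.adm_mult[OF adms(1) adms(1)] t] H.adm_integrable[OF H.adm_mult[OF adms(1) adms(2)] t]
        H.adm_integrable[OF H.adm_mult[OF adms(2) adms(3)] t] H.adm_integrable[OF adms(4) t] H.adm_integrable[OF adms(5) t]
      by simp_all
    show ?thesis
      unfolding boundary_terms_def IUU_def IU1_def I12_def T0_def T1_def by (simp add: i)
  qed
  have sc: "t powr (2 * \<alpha> + 3 - m - 1) * tang t = T0"
    using tang[OF t] by (simp add: T0_def algebra_simps)
  have m0: "t powr (2 * \<alpha> - m) * mass t = IUU"
    using mass[OF t] by (simp add: IUU_def)
  have hb: "t powr (2 * \<alpha> + 3 - m) * hb = Wq t t / 2"
    unfolding hb_def by (rule half_ball_eq[OF t])
  have pot: "t powr (2 * \<alpha> + 3 - m) * pot = Z t"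
    unfolding pot_def by (rule potential_eq[OF t])
  have bulk: "t powr (2 * \<alpha> + 3 - m) * (hb - Cns / (p + 1) * pot) = Wq t t / 2 - Cns / (p + 1) * Z t"
    unfolding hb[symmetric] pot[symmetric] by (simp add: algebra_simps)
  have "P - cB / 2 * IUU - cB / 2 * (IUU + t * (2 * IU1)) + 1 / 2 * (t ^ 3 * (2 * I12)) + 1 / 2 * (T0 + t * (2 * T1))
    + 1 / 2 * T0 = P + (t ^ 3 * I12 - cB * IUU - cB * (t * IU1) + (T0 + t * T1))" for P :: real
    by (simp add: field_simps)
  then show ?thesis
    unfolding E d1 d2 d3 boundary_terms bulk mult.assoc sc m0 .
qed

text \<open>After integration by parts on the half-sphere, the derivative of the energy is a sum of squares.\<close>

lemma has_real_derivative_energy: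
  assumes t: "0 < t"
  shows "(energy s a p Cns u has_real_derivative (\<integral>\<theta>. 2 * t * (t * U2 t \<theta> + U1 t \<theta>)\<^sup>2
    + 2 * (cA - cB - 1) * t * (U1 t \<theta>)\<^sup>2 + 2 * t * tau g1 g1 t t \<theta> \<partial>M)) (at t)"
proof -
  obtain V1 where V1: "B.adm_deriv V V1" using adm_deriv_V by blast
  let ?I = "\<integral>x. fV t x * V1 t x \<partial>unit_ball_measure"
  let ?A = "\<lambda>\<theta>. W t \<theta> * (1 * U1 t \<theta> + t * U2 t \<theta> - \<alpha> * U1 t \<theta>)"
  let ?B = "\<lambda>\<theta>. (t * W1 t \<theta> - (\<alpha> + 2) * W t \<theta>) * U1 t \<theta>"
  let ?E = "\<lambda>\<theta>. (3 * t\<^sup>2 * (U1 t \<theta> * U2 t \<theta>) + t ^ 3 * (U2 t \<theta> * U2 t \<theta> + U1 t \<theta> * U3 t \<theta>))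
    - cB * (U1 t \<theta> * U t \<theta> + U t \<theta> * U1 t \<theta>)
    - cB * (1 * (U t \<theta> * U1 t \<theta>) + t * (U1 t \<theta> * U1 t \<theta> + U t \<theta> * U2 t \<theta>))
    + (2 * tau g1 g0 t t \<theta> + (1 * tau g1 g0 t t \<theta> + t * (tau g2 g0 t t \<theta> + tau g1 g1 t t \<theta>)))"
  let ?S = "\<lambda>\<theta>. 2 * t * (t * U2 t \<theta> + U1 t \<theta>)\<^sup>2 + 2 * (cA - cB - 1) * t * (U1 t \<theta>)\<^sup>2 + 2 * t * tau g1 g1 t t \<theta>"
  \<comment> \<open>The integrands of the three spherical integrations by parts at k = l = t; each
    of them integrates to 0.\<close>
  let ?X1 = "\<lambda>\<theta>. U1 t \<theta> * L t \<theta> + tau g1 g0 t t \<theta>"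
  let ?X2 = "\<lambda>\<theta>. U2 t \<theta> * L t \<theta> + tau g2 g0 t t \<theta>"
  let ?X3 = "\<lambda>\<theta>. U1 t \<theta> * L1 t \<theta> + tau g1 g1 t t \<theta>"
  note adms = H.adm_derivD(1)[OF adm_deriv_U1] H.adm_derivD(1)[OF adm_deriv_U2] H.adm_derivD(1)[OF adm_deriv_W]
    H.adm_derivD(2)[OF adm_deriv_W] H.adm_derivD(1)[OF adm_deriv_L] H.adm_derivD(2)[OF adm_deriv_L]
    H.adm_derivD(1)[OF adm_deriv_tau_10]
  have a2: "H.adm (g2 e)" and a1: "H.adm (g1 e)" and a0: "H.adm (g0 e)" if "e \<in> Basis" for e
    using adm_deriv_g1[OF that] adm_deriv_g0[OF that] H.adm_derivD by blast+
  have at: "H.adm (\<lambda>t. tau f g t t)" if "\<And>e. e \<in> Basis \<Longrightarrow> H.adm (f e)" "\<And>e. e \<in> Basis \<Longrightarrow> H.adm (g e)" for f g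
    unfolding tau_def[abs_def]
    by (intro H.adm_diff H.adm_mult H.adm_sum H.adm_snd continuous_on_component that) auto
  have iA: "integrable M ?A"
    by (rule H.adm_integrable[OF _ t]) (intro H.adm_intros adms)
  have iB: "integrable M ?B"
    by (rule H.adm_integrable[OF _ t]) (intro H.adm_intros adms)
  have iE: "integrable M ?E"
    by (rule H.adm_integrable[OF H.adm_derivD(2)[OF adm_deriv_boundary_terms] t])
  have iX1: "integrable M ?X1"
    by (rule H.adm_integrable[OF _ t]) (intro H.adm_add H.adm_mult adms)
  have iX2: "integrable M ?X2"
    by (rule H.adm_integrable[OF _ t]) (intro H.adm_add H.adm_mult adms at a0 a2)
  have iX3: "integrable M ?X3"
    by (rule H.adm_integrable[OF _ t]) (intro H.adm_add H.adm_mult adms at a1)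
  have iS: "integrable M ?S"
    by (rule H.adm_integrable[OF _ t]) (intro H.adm_add H.adm_mult H.adm_power H.adm_const H.adm_id adms at a1)
  have "((\<lambda>t. Wq t t / 2 - Cns / (p + 1) * Z t + (\<integral>\<theta>. boundary_terms t \<theta> \<partial>M)) has_real_derivative
    2 * (Cns * ?I + (\<integral>\<theta>. ?A \<theta> \<partial>M) - (\<integral>\<theta>. ?B \<theta> \<partial>M)) / 2 - Cns / (p + 1) * ((p + 1) * ?I) + (\<integral>\<theta>. ?E \<theta> \<partial>M)) (at t)"
    by (intro DERIV_add DERIV_diff DERIV_cmult DERIV_cdivide has_real_derivative_Wq[OF t V1] has_real_derivative_Z[OF t V1]
        H.has_real_derivative_integral[OF adm_deriv_boundary_terms t])
  \<comment> \<open>The nonlinear contributions of the bulk term and of the potential cancel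
    here.\<close>
  also have "2 * (Cns * ?I + (\<integral>\<theta>. ?A \<theta> \<partial>M) - (\<integral>\<theta>. ?B \<theta> \<partial>M)) / 2 - Cns / (p + 1) * ((p + 1) * ?I) + (\<integral>\<theta>. ?E \<theta> \<partial>M) =
    (\<integral>\<theta>. ?A \<theta> \<partial>M) - (\<integral>\<theta>. ?B \<theta> \<partial>M) + (\<integral>\<theta>. ?E \<theta> \<partial>M)"
  proof -
    have "2 * (Cns * i + A - B) / 2 - Cns / (p + 1) * ((p + 1) * i) + E = A - B + E" for i A B E :: real
      using p by (simp add: field_simps)
    then show ?thesis .
  qed
  also have "\<dots> = (\<integral>\<theta>. ?A \<theta> - ?B \<theta> + ?E \<theta> \<partial>M)"
    using iA iB iE by (simp only: Bochner_Integration.integral_diff Bochner_Integration.integral_add Bochner_Integration.integrable_diff)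
  \<comment> \<open>With \<open>W\<close> and \<open>W1\<close> expressed through \<open>L\<close>
    and \<open>L1\<close>, the terms with \<open>L\<close> and \<open>tau\<close> group into the
    three identities with coefficients 3, t and -t, up to twice \<open>t * tau g1 g1\<close>. The
    rest is polynomial algebra in which \<open>U3\<close> cancels.\<close>
  also have "\<dots> = (\<integral>\<theta>. ?S \<theta> + (3 * ?X1 \<theta> + t * ?X2 \<theta> - t * ?X3 \<theta>) \<partial>M)"
  proof (rule Bochner_Integration.integral_cong[OF refl])
    fix \<theta> :: "(real^'n) \<times> real"
    have w: "W t \<theta> = L t \<theta> + (t\<^sup>2 * U2 t \<theta> + cA * (t * U1 t \<theta>) + cB * U t \<theta>)"
      by (simp add: L_def)
    have w1: "W1 t \<theta> = L1 t \<theta> + ((2 * t * U2 t \<theta> + t\<^sup>2 * U3 t \<theta>) + cA * (U1 t \<theta> + t * U2 t \<theta>) + cB * U1 t \<theta>)"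
      by (simp add: L1_def)
    show "?A \<theta> - ?B \<theta> + ?E \<theta> = ?S \<theta> + (3 * ?X1 \<theta> + t * ?X2 \<theta> - t * ?X3 \<theta>)"
      unfolding w w1 by (simp add: algebra_simps power2_eq_square power3_eq_cube)
  qed
  also have "\<dots> = (\<integral>\<theta>. ?S \<theta> \<partial>M) + (3 * (\<integral>\<theta>. ?X1 \<theta> \<partial>M) + t * (\<integral>\<theta>. ?X2 \<theta> \<partial>M) - t * (\<integral>\<theta>. ?X3 \<theta> \<partial>M))"
    using iS iX1 iX2 iX3
    by (simp only: Bochner_Integration.integral_diff Bochner_Integration.integral_add Bochner_Integration.integrable_diff
        Bochner_Integration.integrable_add integrable_mult_right integral_mult_right_zero)
  also have "\<dots> = (\<integral>\<theta>. ?S \<theta> \<partial>M)"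
    unfolding spherical_parts_U1[OF t t] spherical_parts_U2[OF t t] spherical_parts_U1_L1[OF t t] by simp
  finally have "((\<lambda>t. Wq t t / 2 - Cns / (p + 1) * Z t + (\<integral>\<theta>. boundary_terms t \<theta> \<partial>M)) has_real_derivative (\<integral>\<theta>. ?S \<theta> \<partial>M)) (at t)" .
  then show ?thesis
    by (rule has_field_derivative_transform_within_open[of _ _ t "{0<..}"]) (use t energy_eq in auto)
qed

text \<open>The square of \<open>t * U2 + U1\<close> and the tangential term are nonnegative and are
  dropped; \<open>scaling_eq\<close> converts what remains back to radius t.\<close>

lemma energy_derivative_bound:
  assumes t: "0 < t"
  shows "deriv (energy s a p Cns u) t \<ge> 2 * (cA - cB - 1) * t powr (2 * \<alpha> + 1 - m) *
    half_sphere_integral (\<lambda>X. snd X powr b * ((2 * s + a) / (p - 1) * inverse (norm X) * u X + radial_deriv u X)\<^sup>2) t"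
    (is "_ \<ge> _ * _ * ?scal")
proof -
  note adms = H.adm_derivD(1)[OF adm_deriv_U1] H.adm_derivD(1)[OF adm_deriv_U2]
  have a1: "H.adm (g1 e)" if "e \<in> Basis" for e
    by (rule H.adm_derivD(1)[OF adm_deriv_g1[OF that]])
  have at: "H.adm (\<lambda>t. tau g1 g1 t t)"
    unfolding tau_def[abs_def]
    by (intro H.adm_diff H.adm_mult H.adm_sum H.adm_snd continuous_on_component a1) auto
  have "2 * (cA - cB - 1) * t powr (2 * \<alpha> + 1 - m) * ?scal = 2 * (cA - cB - 1) * t * (t powr (2 * \<alpha> - m) * ?scal)"
  proof -
    have "t powr (2 * \<alpha> + 1 - m) = t * t powr (2 * \<alpha> - m)"
      using t powr_mult_base[of t "2 * \<alpha> - m"] by (simp add: algebra_simps)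
    then show ?thesis by (simp only: mult.assoc)
  qed
  also have "\<dots> = (\<integral>\<theta>. 2 * (cA - cB - 1) * t * (U1 t \<theta>)\<^sup>2 \<partial>M)"
    unfolding scaling_eq[OF t] integral_mult_right_zero ..
  also have "\<dots> \<le> (\<integral>\<theta>. 2 * t * (t * U2 t \<theta> + U1 t \<theta>)\<^sup>2 + 2 * (cA - cB - 1) * t * (U1 t \<theta>)\<^sup>2 + 2 * t * tau g1 g1 t t \<theta> \<partial>M)"
  proof (rule integral_mono)
    show "integrable M (\<lambda>\<theta>. 2 * (cA - cB - 1) * t * (U1 t \<theta>)\<^sup>2)"
      by (rule H.adm_integrable[OF _ t]) (intro H.adm_mult H.adm_power H.adm_const H.adm_id adms)
    show "integrable M (\<lambda>\<theta>. 2 * t * (t * U2 t \<theta> + U1 t \<theta>)\<^sup>2 + 2 * (cA - cB - 1) * t * (U1 t \<theta>)\<^sup>2 + 2 * t * tau g1 g1 t t \<theta>)"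
      by (rule H.adm_integrable[OF _ t]) (intro H.adm_add H.adm_mult H.adm_power H.adm_const H.adm_id adms at)
    fix \<theta> assume "\<theta> \<in> space M"
    then have "0 \<le> tau g1 g1 t t \<theta>" by (intro tau_nonneg) simp
    then show "2 * (cA - cB - 1) * t * (U1 t \<theta>)\<^sup>2 \<le>
      2 * t * (t * U2 t \<theta> + U1 t \<theta>)\<^sup>2 + 2 * (cA - cB - 1) * t * (U1 t \<theta>)\<^sup>2 + 2 * t * tau g1 g1 t t \<theta>"
      using t by simp
  qed
  also have "\<dots> = deriv (energy s a p Cns u) t"
    by (rule DERIV_imp_deriv[OF has_real_derivative_energy[OF t], symmetric])
  finally show ?thesis .
qed

lemma scaling_nonneg:
  "0 \<le> half_sphere_integral (\<lambda>X. snd X powr b * ((2 * s + a) / (p - 1) * inverse (norm X) * u X + radial_deriv u X)\<^sup>2) t"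
  unfolding half_sphere_integral_def set_lebesgue_integral_def by (rule integral_nonneg_AE) simp

lemma mono_energy:
  assumes "0 \<le> cA - cB - 1"
  shows "mono_on {0<..} (energy s a p Cns u)"
proof (rule mono_onI)
  fix r t :: real assume r: "r \<in> {0<..}" "t \<in> {0<..}" "r \<le> t"
  show "energy s a p Cns u r \<le> energy s a p Cns u t"
  proof (rule DERIV_nonneg_imp_nondecreasing[OF r(3)])
    fix x assume "r \<le> x" "x \<le> t"
    then have x: "0 < x" using r by simp
    have "0 \<le> deriv (energy s a p Cns u) x"
      by (rule order_trans[OF _ energy_derivative_bound[OF x]]) (use assms scaling_nonneg in simp)
    moreover have "(energy s a p Cns u has_real_derivative deriv (energy s a p Cns u) x) (at x)"
      unfolding DERIV_imp_deriv[OF has_real_derivative_energy[OF x]] by (rule has_real_derivative_energy[OF x])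
    ultimately show "\<exists>y. (energy s a p Cns u has_real_derivative y) (at x) \<and> 0 \<le> y" by blast
  qed
qed

end

theorem theorem2p2:
  fixes s a p b :: real
  assumes "1 < s" and "s < 2" and "a > 0" and "p > 1" and "b = 3 - 2 * s"
    and "real CARD('n::finite)
           > (p + 4 * s + 2 * a - 1) / (p + 2 * s + a - 1) + (2 * s + a) / (p - 1) - b"
  shows "\<exists>C>0. \<forall>Cns>0. \<forall>u :: (real^'n) \<times> real \<Rightarrow> real.
           regular_up_to_boundary b u \<longrightarrow> extension_solution s a p Cns u \<longrightarrow>
             mono_on {0<..} (energy s a p Cns u) \<and>
             (\<forall>\<rho>>0. energy s a p Cns u differentiable (at \<rho>) \<and>
               deriv (energy s a p Cns u) \<rho>
                 \<ge> C * \<rho> powr ((4 * s + 2 * a) / (p - 1) + 2 * s - 2 - real CARD('n))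
                     * half_sphere_integral
                         (\<lambda>X. snd X powr (3 - 2 * s)
                               * ((2 * s + a) / (p - 1) * inverse (norm X) * u X
                                  + radial_deriv u X)\<^sup>2) \<rho>)"
proof -
  define \<alpha> m where "\<alpha> = (2 * s + a) / (p - 1)" and "m = real CARD('n) + b"
  \<comment> \<open>This is \<open>cA - cB - 1\<close> written out before \<open>u\<close> and
    \<open>Cns\<close> are introduced, so that the constant depends on n, s, p and a only.\<close>
  define C where "C = (m - 2 * \<alpha>) - \<alpha> * (\<alpha> + 1 - m) - 1"
  have \<alpha>: "0 < \<alpha>" using assms by (simp add: \<alpha>_def)
  have "p + 4 * s + 2 * a - 1 = (1 + 2 * \<alpha>) * (p - 1)" "p + 2 * s + a - 1 = (1 + \<alpha>) * (p - 1)"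
    using assms by (simp_all add: \<alpha>_def field_simps)
  then have "(p + 4 * s + 2 * a - 1) / (p + 2 * s + a - 1) = (1 + 2 * \<alpha>) / (1 + \<alpha>)"
    using assms by simp
  then have m: "(1 + 2 * \<alpha>) / (1 + \<alpha>) + \<alpha> < m"
    using assms(6) by (simp add: m_def \<alpha>_def)
  moreover have "1 \<le> (1 + 2 * \<alpha>) / (1 + \<alpha>)" using \<alpha> by simp
  \<comment> \<open>The quotient is at least 1 and \<alpha> > 0, so the assumption on n contains the
    condition for vanishing flux at the origin.\<close>
  ultimately have dim: "1 < real CARD('n) + b" using \<alpha> unfolding m_def by linarith
  \<comment> \<open>Clearing the denominator turns the assumption into (1 + \<alpha>) m > 1 + 3
    \<alpha> + \<alpha>^2, which is \<open>0 < C\<close>.\<close>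
  have "(1 + \<alpha>) * ((1 + 2 * \<alpha>) / (1 + \<alpha>) + \<alpha>) < (1 + \<alpha>) * m"
    using m \<alpha> by (intro mult_strict_left_mono) auto
  moreover have "(1 + \<alpha>) * ((1 + 2 * \<alpha>) / (1 + \<alpha>) + \<alpha>) = (1 + 2 * \<alpha>) + (1 + \<alpha>) * \<alpha>"
    using \<alpha> by (simp only: distrib_left[of "1 + \<alpha>" "(1 + 2 * \<alpha>) / (1 + \<alpha>)"]) simp
  ultimately have C: "0 < C"
    by (simp add: C_def algebra_simps)
  show ?thesis
  proof (intro exI[of _ "2 * C"] conjI allI impI)
    show "0 < 2 * C" using C by simp
    fix Cns :: real and u :: "(real^'n) \<times> real \<Rightarrow> real"
    assume u: "regular_up_to_boundary b u" "extension_solution s a p Cns u"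
    interpret P: extension_problem s a p b Cns u
      using assms dim u by unfold_locales auto
    have eC: "P.cA - P.cB - 1 = C"
      by (simp add: P.cA_def P.cB_def P.m_def P.\<alpha>_def C_def \<alpha>_def m_def)
    show "mono_on {0<..} (energy s a p Cns u)"
      by (rule P.mono_energy) (use C eC in simp)
    fix \<rho> :: real assume \<rho>: "0 < \<rho>"
    show "energy s a p Cns u differentiable (at \<rho>)"
      using P.has_real_derivative_energy[OF \<rho>] real_differentiable_def by blast
    show "2 * C * \<rho> powr ((4 * s + 2 * a) / (p - 1) + 2 * s - 2 - real CARD('n)) * half_sphere_integral
        (\<lambda>X. snd X powr (3 - 2 * s) * ((2 * s + a) / (p - 1) * inverse (norm X) * u X + radial_deriv u X)\<^sup>2) \<rho>
      \<le> deriv (energy s a p Cns u) \<rho>"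
      using P.energy_derivative_bound[OF \<rho>] unfolding eC P.powr_exponents(2) assms(5)[symmetric] .
  qed
qed

end
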